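(* Let $X_t=\sigma W_t+\theta t$, $t\ge0$, with $\sigma>0$, $\theta\in\mathbb R$ and $W$ a standard Brownian motion on $\mathbb R$, and let $T=(T_t)_{t\ge0}$ be a Thorin (GGC) subordinator independent of $X$, with drift $a\ge0$ and Thorin measure $\rho$. Then $Y=(X_{T_t})_{t\ge0}$ is a Thorin process with Thorin triplet $(b,a\sigma^2,\tau)$, where $$b=\theta a+\theta\int_{\{t\ge\sigma^2/2+|\theta|\}}\frac{\rho(dt)}{t}-\operatorname{sgn}(\theta)\int_{[\sigma^2/2-|\theta|,\ \sigma^2/2+|\theta|)}\frac{\rho(dt)}{f(t)+|\theta|/\sigma^2},$$ $$\tau_+=(f_\sharp\rho)^{\theta/\sigma^2},\qquad\tau_-=(f_\sharp\rho)^{-\theta/\sigma^2},$$ and $f:[0,\infty)\to\left[\frac{|\theta|}{\sigma^2},\infty\right)$ is the function $$f(x)=\frac{\sqrt{\theta^2+2\sigma^2x}}{\sigma^2}.$$ Furthermore, if $a=0$, then for all $p\in[0,2]$ we have $\beta(T)\le p/2$ if and only if $\beta(Y)\le p$. Likewise, $E[|Y_t|^p]<\infty$ if and only if $E\bigl[T_t^{\,p-\frac p2\mathbf 1_{\{\theta=0\}}}\bigr]<\infty$ ($t>0$).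
   Context: A Thorin (GGC) subordinator with drift $a\ge0$ and Thorin measure $\rho$ is an increasing Lévy process with $E[e^{-sT_1}]=\exp\bigl(-as+\int_0^\infty\log\frac{x}{x+s}\rho(dx)\bigr)$, $s\ge0$, where $\rho$ is a measure on $(0,\infty)$, finite on compact subsets of $(0,\infty)$, with $\int_0^1|\log x|\rho(dx)<\infty$ and $\int_1^\infty x^{-1}\rho(dx)<\infty$. A Thorin process on $\mathbb R$ is a Lévy process $Y$ such that $\mathcal L(Y_1)$ is a weak limit of finite convolutions of laws of $Vx$ ($V$ gamma, $x\in\mathbb R\setminus\{0\}$); it has Thorin triplet $(b,\theta_2,\tau)$ if $\log E[e^{izY_1}]=izb-\frac{\theta_2}{2}z^2-\int_{\mathbb R}\bigl(\log(1-\frac{iz}{x})+\frac{iz}{x}\mathbf 1_{\{|x|\ge1\}}\bigr)\tau(dx)$, where $\tau(B)=\tau_+(B\cap(0,\infty))+\tau_-((-B)\cap(0,\infty))$ with $\tau_\pm$ measures on $(0,\infty)$, and $\int_{\{|x|\le1\}}(1+|\log|x||)\tau(dx)+\int_{\{|x|>1\}}x^{-2}\tau(dx)<\infty$. $f_\sharp\rho(B)=\rho(f^{-1}(B))$ is the pushforward; $\eta^c(B)=\eta(B+c)$ is the left translation of a measure $\eta$ by $c$ (the pushforward under $x\mapsto x-c$). For a Lévy process $Z$ without Gaussian part and Lévy measure $\nu$, $\beta(Z)=\inf\{p>0:\int_{\{|x|\le1\}}|x|^p\nu(dx)<\infty\}$. $\operatorname{sgn}(0)=0$. *)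

theory Defs
  imports "HOL-Probability.Probability"
begin

section \<open>Levy processes\<close>

text \<open>
  A real process is a family \<open>X :: real \<Rightarrow> 'a \<Rightarrow> real\<close> of which only the times
  \<open>t \<ge> 0\<close> matter. Path properties are required almost surely. Consequently a time-changed process
  \<open>\<lambda>t \<omega>. X (T t \<omega>) \<omega>\<close> is in general measurable only up to null sets and has to be viewed
  as a process on \<open>completion M\<close>.
\<close>

definition independent_increments :: "'a measure \<Rightarrow> (real \<Rightarrow> 'a \<Rightarrow> real) \<Rightarrow> bool" where
  "independent_increments M X \<longleftrightarrow>
    (\<forall>(n::nat) (t::nat \<Rightarrow> real). 0 \<le> t 0 \<and> (\<forall>i<n. t i < t (Suc i)) \<longrightarrow>
      prob_space.indep_vars M (\<lambda>_. borel) (\<lambda>i \<omega>. X (t (Suc i)) \<omega> - X (t i) \<omega>) {..<n})"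

definition stationary_increments :: "'a measure \<Rightarrow> (real \<Rightarrow> 'a \<Rightarrow> real) \<Rightarrow> bool" where
  "stationary_increments M X \<longleftrightarrow>
    (\<forall>s\<ge>0. \<forall>h\<ge>0. distr M borel (\<lambda>\<omega>. X (s + h) \<omega> - X s \<omega>) =
                  distr M borel (\<lambda>\<omega>. X h \<omega> - X 0 \<omega>))"

definition cadlag :: "(real \<Rightarrow> real) \<Rightarrow> bool" where
  "cadlag x \<longleftrightarrow>
    (\<forall>t\<ge>0. (x \<longlongrightarrow> x t) (at_right t)) \<and> (\<forall>t>0. \<exists>l. (x \<longlongrightarrow> l) (at_left t))"

text \<open>
  Stochastic continuity is not listed separately: it follows from right-continuity
  and stationarity of the increments.
\<close>

definition levy_process :: "'a measure \<Rightarrow> (real \<Rightarrow> 'a \<Rightarrow> real) \<Rightarrow> bool" where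
  "levy_process M X \<longleftrightarrow>
    prob_space M \<and>
    (\<forall>t\<ge>0. X t \<in> borel_measurable M) \<and>
    (AE \<omega> in M. X 0 \<omega> = 0) \<and>
    independent_increments M X \<and>
    stationary_increments M X \<and>
    (AE \<omega> in M. cadlag (\<lambda>t. X t \<omega>))"

definition standard_brownian_motion :: "'a measure \<Rightarrow> (real \<Rightarrow> 'a \<Rightarrow> real) \<Rightarrow> bool" where
  "standard_brownian_motion M W \<longleftrightarrow>
    levy_process M W \<and>
    (\<forall>t>0. distributed M lborel (W t) (\<lambda>x. ennreal (normal_density 0 (sqrt t) x))) \<and>
    (AE \<omega> in M. continuous_on {0..} (\<lambda>t. W t \<omega>))"

definition independent_processes ::
    "'a measure \<Rightarrow> (real \<Rightarrow> 'a \<Rightarrow> real) \<Rightarrow> (real \<Rightarrow> 'a \<Rightarrow> real) \<Rightarrow> bool" where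
  "independent_processes M X T \<longleftrightarrow>
    prob_space.indep_var M
      (\<Pi>\<^sub>M t\<in>{0..}. borel) (\<lambda>\<omega>. \<lambda>t\<in>{0..}. X t \<omega>)
      (\<Pi>\<^sub>M t\<in>{0..}. borel) (\<lambda>\<omega>. \<lambda>t\<in>{0..}. T t \<omega>)"


section \<open>Levy measure and the index \<open>\<beta>\<close>\<close>

definition is_levy_measure :: "real measure \<Rightarrow> bool" where
  "is_levy_measure \<nu> \<longleftrightarrow>
    sets \<nu> = sets borel \<and> emeasure \<nu> {0} = 0 \<and>
    (\<integral>\<^sup>+x. ennreal (min 1 (x\<^sup>2)) \<partial>\<nu>) < \<infinity>"

definition has_levy_triplet ::
    "'a measure \<Rightarrow> (real \<Rightarrow> 'a \<Rightarrow> real) \<Rightarrow> real \<Rightarrow> real \<Rightarrow> real measure \<Rightarrow> bool" where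
  "has_levy_triplet M Z b c \<nu> \<longleftrightarrow>
    0 \<le> c \<and> is_levy_measure \<nu> \<and>
    (\<forall>z. char (distr M borel (Z 1)) z =
      exp (\<i> * of_real (z * b) - of_real (c / 2 * z\<^sup>2) +
        (CLINT x|\<nu>. iexp (z * x) - 1 - \<i> * of_real (z * x * indicator {-1..1} x))))"

text \<open>
  The Levy measure of a Levy process without Gaussian part; existence and uniqueness
  for such processes is the Levy-Khintchine theorem.
\<close>

definition levy_measure_of :: "'a measure \<Rightarrow> (real \<Rightarrow> 'a \<Rightarrow> real) \<Rightarrow> real measure" where
  "levy_measure_of M Z = (THE \<nu>. \<exists>b. has_levy_triplet M Z b 0 \<nu>)"

definition beta_index :: "'a measure \<Rightarrow> (real \<Rightarrow> 'a \<Rightarrow> real) \<Rightarrow> real" where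
  "beta_index M Z =
    Inf {p. 0 < p \<and> (\<integral>\<^sup>+x\<in>{x. \<bar>x\<bar> \<le> 1}. ennreal (\<bar>x\<bar> powr p) \<partial>levy_measure_of M Z) < \<infinity>}"


section \<open>Thorin subordinators\<close>

text \<open>Measures on \<open>(0,\<infinity>)\<close> are Borel measures on \<open>\<real>\<close> not charging \<open>(-\<infinity>,0]\<close>.\<close>

definition thorin_measure :: "real measure \<Rightarrow> bool" where
  "thorin_measure \<rho> \<longleftrightarrow>
    sets \<rho> = sets borel \<and> emeasure \<rho> {..0} = 0 \<and>
    (\<forall>K. compact K \<and> K \<subseteq> {0<..} \<longrightarrow> emeasure \<rho> K < \<infinity>) \<and>
    (\<integral>\<^sup>+x\<in>{0<..1}. ennreal \<bar>ln x\<bar> \<partial>\<rho>) < \<infinity> \<and>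
    (\<integral>\<^sup>+x\<in>{1..}. ennreal (1 / x) \<partial>\<rho>) < \<infinity>"

definition thorin_subordinator ::
    "'a measure \<Rightarrow> (real \<Rightarrow> 'a \<Rightarrow> real) \<Rightarrow> real \<Rightarrow> real measure \<Rightarrow> bool" where
  "thorin_subordinator M T a \<rho> \<longleftrightarrow>
    levy_process M T \<and> (AE \<omega> in M. mono_on {0..} (\<lambda>t. T t \<omega>)) \<and>
    0 \<le> a \<and> thorin_measure \<rho> \<and>
    (\<forall>s\<ge>0. (LINT \<omega>|M. exp (- s * T 1 \<omega>)) = exp (- a * s + (LINT x|\<rho>. ln (x / (x + s)))))"


section \<open>Thorin processes\<close>

definition gamma_density :: "real \<Rightarrow> real \<Rightarrow> real \<Rightarrow> real" where
  "gamma_density k l v =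
    (if 0 < v then l powr k / Gamma k * v powr (k - 1) * exp (- l * v) else 0)"

inductive_set gamma_convolutions :: "real measure set" where
  scaled: "0 < k \<Longrightarrow> 0 < l \<Longrightarrow> x \<noteq> 0 \<Longrightarrow>
    distr (density lborel (\<lambda>v. ennreal (gamma_density k l v))) borel (\<lambda>v. v * x)
      \<in> gamma_convolutions"
| convolve: "\<mu> \<in> gamma_convolutions \<Longrightarrow> \<nu> \<in> gamma_convolutions \<Longrightarrow>
    convolution \<mu> \<nu> \<in> gamma_convolutions"

definition thorin_process :: "'a measure \<Rightarrow> (real \<Rightarrow> 'a \<Rightarrow> real) \<Rightarrow> bool" where
  "thorin_process M Y \<longleftrightarrow>
    levy_process M Y \<and>
    (\<exists>\<mu>. (\<forall>n. \<mu> n \<in> gamma_convolutions) \<and> weak_conv_m \<mu> (distr M borel (Y 1)))"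

definition two_sided :: "real measure \<Rightarrow> real measure \<Rightarrow> real measure" where
  "two_sided \<tau>p \<tau>m = measure_of UNIV (sets borel)
    (\<lambda>B. emeasure \<tau>p (B \<inter> {0<..}) + emeasure \<tau>m (uminus ` B \<inter> {0<..}))"

text \<open>
  \<open>\<tau>p\<close> and \<open>\<tau>m\<close> are the measures \<open>\<tau>\<^sub>+\<close> and \<open>\<tau>\<^sub>-\<close> on \<open>(0,\<infinity>)\<close> that determine \<open>\<tau>\<close>.
  The exponent is continuous in \<open>z\<close> and vanishes at \<open>0\<close>, so the identity for
  the exponentials says that it is the (distinguished) logarithm of the characteristic
  function. The inner logarithm is the principal one, at points of real part \<open>1\<close>.
\<close>

definition has_thorin_triplet ::
    "'a measure \<Rightarrow> (real \<Rightarrow> 'a \<Rightarrow> real) \<Rightarrow> real \<Rightarrow> real \<Rightarrow> real measure \<Rightarrow> real measure \<Rightarrow> bool"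
where
  "has_thorin_triplet M Y b \<theta>2 \<tau>p \<tau>m \<longleftrightarrow>
    0 \<le> \<theta>2 \<and>
    sets \<tau>p = sets borel \<and> emeasure \<tau>p {..0} = 0 \<and>
    sets \<tau>m = sets borel \<and> emeasure \<tau>m {..0} = 0 \<and>
    (let \<tau> = two_sided \<tau>p \<tau>m in
      (\<integral>\<^sup>+x\<in>{x. \<bar>x\<bar> \<le> 1}. ennreal (1 + \<bar>ln \<bar>x\<bar>\<bar>) \<partial>\<tau>) +
        (\<integral>\<^sup>+x\<in>{x. \<bar>x\<bar> > 1}. ennreal (1 / x\<^sup>2) \<partial>\<tau>) < \<infinity> \<and>
      (\<forall>z::real. char (distr M borel (Y 1)) z =
        exp (\<i> * of_real (z * b) - of_real (\<theta>2 / 2 * z\<^sup>2) -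
          (CLINT x|\<tau>. Ln (1 - \<i> * of_real z / of_real x) +
             \<i> * of_real z / of_real x * indicator {x. \<bar>x\<bar> \<ge> 1} x))))"

definition left_translation :: "real measure \<Rightarrow> real \<Rightarrow> real measure" where
  "left_translation \<eta> c = distr \<eta> borel (\<lambda>x. x - c)"

end

(* Conditioning on T, approximated by times on a grid, turns expectations of products of functions of the
   increments of Y into expectations of products of functions of the increments of T. This makes Y a
   Levy process with E exp(izY_t) = E exp(-psi(z) T_t), where psi(z) = sigma^2 z^2/2 - i theta z. The
   Laplace exponent of T_1 extends to the right half-plane by analytic continuation, and everything else
   rests on the factorization

     1 + psi(z)/x = (1 - iz/p(x)) (1 + iz/m(x)),
     p(x) = f(x) - theta/sigma^2,  m(x) = f(x) + theta/sigma^2,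

   which exhibits the images of rho under p and m as tau_+ and tau_-. The drift b collects the
   compensating terms. Riemann sums of the exponent, with the drift a of T imitated by an atom of
   mass of order aN at N, give gamma convolutions converging to the law of Y_1. The Levy measures have
   densities int exp(-xu) tau(dx) / u by Frullani's integral, so both indices are decided by the tails
   of rho because p(x) and m(x) grow like sqrt x. Finally Y_t has the law of
   sigma sqrt(T_t) N + theta T_t with N standard normal and independent of T, which gives the moments. *)

theory Submission
  imports Defs "HOL-Complex_Analysis.Complex_Analysis"
begin

section \<open>Subordination of continuous Levy processes\<close>

text \<open>The grid is forced by measurability. Independence of X and T concerns the product
  sigma-algebra on path space, for which evaluating a random path at a random real time is not
  measurable. Rounded times take countably many values, and continuity of X recovers Y as an almost
  sure limit, hence on the completion only. The test functions are bounded and continuous so that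
  they survive this limit. The factorization passes to logarithms without branch correction because
  both factors have real part 1. As p and m grow only like sqrt x, neither 1/p nor 1/m need be
  integrable at infinity, but the difference 1/p - 1/m = \<theta>/x is; the thresholds in the drift
  are the points where p and m reach 1. The index refers to the Levy measure by a definite
  description, so its uniqueness has to be proved: second differences of the exponent with steps 1
  and sqrt 2 are the Fourier transform of a finite measure whose density with respect to the Levy
  measure vanishes only at 0. For the moments, drift and Gaussian term must not cancel; this is
  secured by keeping only normal values with the sign of \<theta>.\<close>

lemma cts_step_bounds: "a < b \<Longrightarrow> 0 \<le> cts_step a b x \<and> cts_step a b x \<le> 1"
  by (auto simp: cts_step_def divide_simps)

lemma cts_step_tendsto_indicator:
  "(\<lambda>k. cts_step a (a + 1 / real (Suc k)) x) \<longlonglongrightarrow> indicator {..a} x"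
proof (cases "x \<le> a")
  case True
  then show ?thesis by (simp add: cts_step_def)
next
  case False
  have "(\<lambda>k. 1 / real (Suc k)) \<longlonglongrightarrow> 0"
    using LIMSEQ_inverse_real_of_nat by (simp add: inverse_eq_divide)
  then have "\<forall>\<^sub>F k in sequentially. 1 / real (Suc k) < x - a"
    by (rule order_tendstoD) (use False in simp)
  then have "\<forall>\<^sub>F k in sequentially. cts_step a (a + 1 / real (Suc k)) x = indicator {..a} x"
    by eventually_elim (use False in \<open>simp add: cts_step_def\<close>)
  then show ?thesis by (rule tendsto_eventually)
qed

text \<open>Half-lines generate the Borel sets and their indicators are bounded limits of continuous
  steps, so dominated convergence turns the product formula for functions into one for
  probabilities. This is the form of independence that \<open>decouple\<close> can supply.\<close>

lemma (in prob_space) indep_vars_bounded_continuous: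
  fixes Z :: "'i \<Rightarrow> 'a \<Rightarrow> real"
  assumes fin: "finite I"
    and rv: "\<And>i. i \<in> I \<Longrightarrow> Z i \<in> borel_measurable M"
    and eq: "\<And>g :: 'i \<Rightarrow> real \<Rightarrow> real. (\<And>i. continuous_on UNIV (g i)) \<Longrightarrow> (\<And>i x. norm (g i x) \<le> 1) \<Longrightarrow>
       expectation (\<lambda>\<omega>. \<Prod>i\<in>I. g i (Z i \<omega>)) = (\<Prod>i\<in>I. expectation (\<lambda>\<omega>. g i (Z i \<omega>)))"
  shows "indep_vars (\<lambda>_. borel) Z I"
proof (cases "I = {}")
  case True
  then show ?thesis by (simp add: indep_vars_def indep_sets_def)
next
  case False
  \<comment> \<open>Choosing the whole line for an index drops it from the product, so the formula
    over the full index set also covers subfamilies.\<close>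
  let ?E = "insert UNIV (range (atMost :: real \<Rightarrow> real set))"
  have sb: "sets borel = sigma_sets UNIV ?E"
  proof
    show "sets borel \<subseteq> sigma_sets UNIV ?E"
      unfolding borel_eq_atMost by (auto simp: intro!: sigma_sets_mono')
    show "sigma_sets UNIV ?E \<subseteq> sets (borel :: real measure)"
      by (rule sets.sigma_sets_subset[of _ "borel :: real measure", simplified]) auto
  qed
  have "indep_vars (\<lambda>_. borel) Z I \<longleftrightarrow> (\<forall>A\<in>(\<Pi> i\<in>I. ?E).
    prob (\<Inter>j\<in>I. Z j -` A j \<inter> space M) = (\<Prod>j\<in>I. prob (Z j -` A j \<inter> space M)))"
  proof (rule indep_vars_finite[OF False fin])
    show "Int_stable ?E" for i :: 'i
    proof (rule Int_stableI)
      fix a b :: "real set" assume "a \<in> ?E" "b \<in> ?E"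
      moreover have "{..x} \<inter> {..y} = {..min x y}" for x y :: real by auto
      ultimately show "a \<inter> b \<in> ?E" by auto
    qed
  qed (use sb rv in auto)
  also have \<dots>
  proof
    fix A assume A: "A \<in> (\<Pi> i\<in>I. ?E)"
    have "\<forall>i\<in>I. \<exists>x. A i = UNIV \<or> A i = {..x}" using A by (auto simp: Pi_iff)
    then obtain x where x: "\<And>i. i \<in> I \<Longrightarrow> A i = UNIV \<or> A i = {..x i}" by metis
    define g where "g k i = (if A i = UNIV then (\<lambda>_. 1) else cts_step (x i) (x i + 1 / real (Suc k)))"
      for k i
    have gc: "continuous_on UNIV (g k i)" for k i
      unfolding g_def by (auto intro!: uniformly_continuous_imp_continuous cts_step_uniformly_continuous)
    have gb: "norm (g k i y) \<le> 1" for k i y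
      unfolding g_def using cts_step_bounds[of "x i" "x i + 1 / real (Suc k)" y] by auto
    have gm[measurable]: "g k i \<in> borel_measurable borel" for k i
      by (rule borel_measurable_continuous_onI[OF gc])
    have gl: "(\<lambda>k. g k i y) \<longlonglongrightarrow> indicator (A i) y" if "i \<in> I" for i y
      using x[OF that] cts_step_tendsto_indicator[of "x i" y] unfolding g_def by (cases "A i = UNIV") auto
    note rv[measurable]
    have Am: "A i \<in> sets borel" if "i \<in> I" for i using x[OF that] by auto
    have L: "(\<lambda>k. expectation (\<lambda>\<omega>. \<Prod>i\<in>I. g k i (Z i \<omega>))) \<longlonglongrightarrow>
       expectation (\<lambda>\<omega>. \<Prod>i\<in>I. indicator (A i) (Z i \<omega>))"
    proof (rule integral_dominated_convergence[where w="\<lambda>_. 1"])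
      show "(\<lambda>\<omega>. \<Prod>i\<in>I. indicator (A i) (Z i \<omega>) :: real) \<in> borel_measurable M"
        using Am rv by measurable
      show "AE \<omega> in M. norm (\<Prod>i\<in>I. g k i (Z i \<omega>)) \<le> 1" for k
        using gb by (auto simp: abs_prod intro!: prod_le_1)
    qed (use gl in \<open>auto intro!: tendsto_prod\<close>)
    have R: "(\<lambda>k. expectation (\<lambda>\<omega>. g k i (Z i \<omega>))) \<longlonglongrightarrow>
       expectation (\<lambda>\<omega>. indicat_real (A i) (Z i \<omega>))" if i: "i \<in> I" for i
    proof (rule integral_dominated_convergence[where w="\<lambda>_. 1"])
      show "(\<lambda>\<omega>. indicator (A i) (Z i \<omega>) :: real) \<in> borel_measurable M"
        using Am[OF i] rv[OF i] by measurable
    qed (use gl[OF i] gb rv[OF i] in \<open>auto\<close>)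
    have "(\<lambda>k. expectation (\<lambda>\<omega>. \<Prod>i\<in>I. g k i (Z i \<omega>))) \<longlonglongrightarrow> (\<Prod>i\<in>I. expectation (\<lambda>\<omega>. indicat_real (A i) (Z i \<omega>)))"
      unfolding eq[OF gc gb] by (intro tendsto_prod R)
    with L have "expectation (\<lambda>\<omega>. \<Prod>i\<in>I. indicat_real (A i) (Z i \<omega>)) =
        (\<Prod>i\<in>I. expectation (\<lambda>\<omega>. indicat_real (A i) (Z i \<omega>)))"
      by (rule LIMSEQ_unique)
    moreover have "expectation (\<lambda>\<omega>. indicat_real (A i) (Z i \<omega>)) = prob (Z i -` A i \<inter> space M)" if "i \<in> I" for i
    proof -
      have "expectation (\<lambda>\<omega>. indicat_real (A i) (Z i \<omega>)) = expectation (indicator (Z i -` A i \<inter> space M))"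
        by (rule Bochner_Integration.integral_cong) (auto simp: indicator_def)
      then show ?thesis using that Am rv by simp
    qed
    moreover have "expectation (\<lambda>\<omega>. \<Prod>i\<in>I. indicat_real (A i) (Z i \<omega>)) = prob (\<Inter>j\<in>I. Z j -` A j \<inter> space M)"
    proof -
      have m: "(\<Inter>j\<in>I. Z j -` A j \<inter> space M) \<in> sets M"
        using False fin Am rv by (intro sets.finite_INT) auto
      have "expectation (\<lambda>\<omega>. \<Prod>i\<in>I. indicat_real (A i) (Z i \<omega>)) =
          expectation (indicator (\<Inter>j\<in>I. Z j -` A j \<inter> space M))"
      proof (rule Bochner_Integration.integral_cong[OF refl])
        fix \<omega> assume "\<omega> \<in> space M"
        then show "(\<Prod>i\<in>I. indicator (A i) (Z i \<omega>)) = (indicator (\<Inter>j\<in>I. Z j -` A j \<inter> space M) \<omega> :: real)"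
          using fin False by (auto simp: indicator_def prod_eq_1_iff intro!: prod_zero)
      qed
      then show ?thesis using m by simp
    qed
    ultimately show "prob (\<Inter>j\<in>I. Z j -` A j \<inter> space M) = (\<Prod>j\<in>I. prob (Z j -` A j \<inter> space M))"
      by simp
  qed
  finally show ?thesis by simp
qed

text \<open>The pointwise \<open>lim\<close> is measurable for \<open>M\<close> and differs from
  \<open>f\<close> only on a null set, which the completion absorbs. This is how the time-changed
  process becomes measurable.\<close>

lemma borel_measurable_completion_AE_LIMSEQ:
  fixes f :: "'a \<Rightarrow> 'b::{banach, second_countable_topology}"
  assumes f[measurable]: "\<And>k. h k \<in> borel_measurable M" and lim: "AE \<omega> in M. (\<lambda>k. h k \<omega>) \<longlonglongrightarrow> f \<omega>"
  shows "f \<in> borel_measurable (completion M)"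
proof -
  let ?g = "\<lambda>\<omega>. lim (\<lambda>k. h k \<omega>)"
  have g[measurable]: "?g \<in> borel_measurable M" by measurable
  have ae: "AE \<omega> in completion M. ?g \<omega> = f \<omega>"
    by (rule AE_completion) (use lim in eventually_elim, auto intro: limI)
  show ?thesis
  proof (rule measurableI)
    fix A :: "'b set" assume "A \<in> sets borel"
    then have 1: "?g -` A \<inter> space M \<in> sets (completion M)" by (auto intro!: measurable_sets[OF g])
    show "f -` A \<inter> space (completion M) \<in> sets (completion M)"
      by (rule completion.in_sets_AE[OF _ 1]) (use ae in eventually_elim, auto)
  qed simp
qed

lemma prob_space_completion:
  "prob_space M \<Longrightarrow> prob_space (completion M)"
  by (auto intro!: prob_spaceI simp: prob_space.emeasure_space_1)

text \<open>The shift by \<open>i / Suc k\<close> keeps the times of the \<open>i\<close>-th and the next increment distinct, since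
  \<^const>\<open>independent_increments\<close> only speaks about strictly increasing times.\<close>

definition grid :: "nat \<Rightarrow> nat \<Rightarrow> real \<Rightarrow> real" where
  "grid k i u = real (nat \<lceil>real (Suc k) * u\<rceil>) / real (Suc k) + real i / real (Suc k)"

lemma grid_nonneg: "0 \<le> grid k i u"
  by (simp add: grid_def)

lemma grid_less: "u \<le> v \<Longrightarrow> grid k i u < grid k (Suc i) v"
proof -
  assume "u \<le> v"
  then have "real (nat \<lceil>real (Suc k) * u\<rceil>) \<le> real (nat \<lceil>real (Suc k) * v\<rceil>)"
    by (intro of_nat_mono nat_mono ceiling_mono mult_left_mono) auto
  then have "real (nat \<lceil>real (Suc k) * u\<rceil>) + real i < real (nat \<lceil>real (Suc k) * v\<rceil>) + real (Suc i)"
    using of_nat_Suc[of i] by linarith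
  then show ?thesis unfolding grid_def add_divide_distrib[symmetric]
    by (intro divide_strict_right_mono) simp_all
qed

lemma grid_tendsto: 
  assumes "0 \<le> u" shows "(\<lambda>k. grid k i u) \<longlonglongrightarrow> u"
proof (rule tendsto_sandwich[of "\<lambda>_. u" _ _ "\<lambda>k. u + real (Suc i) * inverse (real (Suc k))"])
  have *: "u * real (Suc k) \<le> real (nat \<lceil>real (Suc k) * u\<rceil>)" "real (nat \<lceil>real (Suc k) * u\<rceil>) \<le> u * real (Suc k) + 1" for k
  proof -
    have "0 \<le> real (Suc k) * u" using assms by simp
    then have "0 \<le> \<lceil>real (Suc k) * u\<rceil>" by linarith
    then have "real (nat \<lceil>real (Suc k) * u\<rceil>) = of_int \<lceil>real (Suc k) * u\<rceil>" by simp
    then show "u * real (Suc k) \<le> real (nat \<lceil>real (Suc k) * u\<rceil>)" "real (nat \<lceil>real (Suc k) * u\<rceil>) \<le> u * real (Suc k) + 1"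
      by (simp_all add: mult.commute)
  qed
  show "\<forall>\<^sub>F k in sequentially. u \<le> grid k i u"
  proof (rule always_eventually, rule allI)
    fix k
    have "u * real (Suc k) \<le> grid k i u * real (Suc k)"
      using *(1)[of k] unfolding grid_def add_divide_distrib[symmetric] by simp
    then show "u \<le> grid k i u" by (subst (asm) mult_le_cancel_right) auto
  qed
  show "\<forall>\<^sub>F k in sequentially. grid k i u \<le> u + real (Suc i) * inverse (real (Suc k))"
  proof (rule always_eventually, rule allI)
    fix k
    have "grid k i u * real (Suc k) = real (nat \<lceil>real (Suc k) * u\<rceil>) + real i"
      unfolding grid_def add_divide_distrib[symmetric] by simp
    moreover have "(u + real (Suc i) * inverse (real (Suc k))) * real (Suc k) = u * real (Suc k) + real (Suc i)"
      by (simp add: distrib_right)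
    ultimately have "grid k i u * real (Suc k) \<le> (u + real (Suc i) * inverse (real (Suc k))) * real (Suc k)"
      using *(2)[of k] of_nat_Suc[of i] by linarith
    then show "grid k i u \<le> u + real (Suc i) * inverse (real (Suc k))" by (subst (asm) mult_le_cancel_right) auto
  qed
  show "(\<lambda>k. u + real (Suc i) * inverse (real (Suc k))) \<longlonglongrightarrow> u"
    using tendsto_add[OF tendsto_const tendsto_mult[OF tendsto_const LIMSEQ_inverse_real_of_nat], of u "real (Suc i)"] by simp
qed auto

section \<open>The process X at the times of an independent increasing Levy process T\<close>

locale subordination = prob_space M for M :: "'a measure" +
  fixes X T :: "real \<Rightarrow> 'a \<Rightarrow> real"
  assumes levy_X: "levy_process M X" and levy_T: "levy_process M T"
    and continuous_X: "AE \<omega> in M. continuous_on {0..} (\<lambda>t. X t \<omega>)"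
    and mono_T: "AE \<omega> in M. mono_on {0..} (\<lambda>t. T t \<omega>)"
    and indep_XT: "independent_processes M X T"
begin

definition Y :: "real \<Rightarrow> 'a \<Rightarrow> real" where
  "Y t \<omega> = X (T t \<omega>) \<omega>"

text \<open>The convolution semigroup of X applied to \<open>g\<close> and evaluated at 0.
  Truncating the time by \<open>max 0\<close> lets continuity and measurability in \<open>u\<close>
  be stated on the whole line.\<close>

definition transition :: "(real \<Rightarrow> 'b::{banach, second_countable_topology}) \<Rightarrow> real \<Rightarrow> 'b" where
  "transition g u = (\<integral>\<omega>. g (X (max 0 u) \<omega>) \<partial>M)"

lemma X_measurable[measurable]: "0 \<le> t \<Longrightarrow> X t \<in> borel_measurable M"
  and T_measurable[measurable]: "0 \<le> t \<Longrightarrow> T t \<in> borel_measurable M"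
  using levy_X levy_T by (auto simp: levy_process_def)

lemma X_0: "AE \<omega> in M. X 0 \<omega> = 0" and T_0: "AE \<omega> in M. T 0 \<omega> = 0"
  using levy_X levy_T by (auto simp: levy_process_def)

lemma T_nonneg: "AE \<omega> in M. \<forall>t\<ge>0. 0 \<le> T t \<omega>"
  using mono_T T_0 by eventually_elim (force simp: mono_on_def)

lemma X_increment:
  fixes h :: "real \<Rightarrow> 'b::{banach, second_countable_topology}"
  assumes "0 \<le> s" "s \<le> t" and [measurable]: "h \<in> borel_measurable borel"
  shows "(\<integral>\<omega>. h (X t \<omega> - X s \<omega>) \<partial>M) = transition h (t - s)"
proof -
  have st: "distr M borel (\<lambda>\<omega>. X (s + (t - s)) \<omega> - X s \<omega>) = distr M borel (\<lambda>\<omega>. X (t - s) \<omega> - X 0 \<omega>)"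
    using levy_X assms(1,2) unfolding levy_process_def stationary_increments_def by (metis diff_ge_0_iff_ge)
  have "(\<integral>\<omega>. h (X t \<omega> - X s \<omega>) \<partial>M) = (\<integral>x. h x \<partial>distr M borel (\<lambda>\<omega>. X (s + (t - s)) \<omega> - X s \<omega>))"
    using assms by (subst integral_distr) auto
  also have "\<dots> = (\<integral>\<omega>. h (X (t - s) \<omega> - X 0 \<omega>) \<partial>M)"
    unfolding st using assms by (subst integral_distr) auto
  also have "\<dots> = (\<integral>\<omega>. h (X (t - s) \<omega>) \<partial>M)"
    using assms by (intro integral_cong_AE, measurable) (use X_0 in auto)
  finally show ?thesis using assms by (simp add: transition_def)
qed

text \<open>Path continuity of X and dominated convergence; this is what allows the limit on the
  side of T in \<open>decouple\<close>.\<close>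

lemma continuous_transition:
  fixes g :: "real \<Rightarrow> 'b::{banach, second_countable_topology}"
  assumes g: "continuous_on UNIV g" "\<And>x. norm (g x) \<le> 1"
  shows "continuous_on UNIV (transition g)"
proof -
  have gm[measurable]: "g \<in> borel_measurable borel" by (rule borel_measurable_continuous_onI[OF g(1)])
  have "(\<lambda>k. transition g (x k)) \<longlonglongrightarrow> transition g l" if "x \<longlonglongrightarrow> l" for x l
    unfolding transition_def
  proof (rule integral_dominated_convergence[where w="\<lambda>_. 1"])
    show "AE \<omega> in M. (\<lambda>k. g (X (max 0 (x k)) \<omega>)) \<longlonglongrightarrow> g (X (max 0 l) \<omega>)"
      using continuous_X
    proof eventually_elim
      fix \<omega> assume c: "continuous_on {0..} (\<lambda>t. X t \<omega>)"
      have "(\<lambda>k. X (max 0 (x k)) \<omega>) \<longlonglongrightarrow> X (max 0 l) \<omega>"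
        by (rule continuous_on_tendsto_compose[OF c]) (auto intro!: tendsto_intros that)
      then show "(\<lambda>k. g (X (max 0 (x k)) \<omega>)) \<longlonglongrightarrow> g (X (max 0 l) \<omega>)"
        by (rule continuous_on_tendsto_compose[OF g(1)]) auto
    qed
  qed (use g(2) in auto)
  then show ?thesis unfolding continuous_on_sequentially by (auto simp: comp_def)
qed

lemma norm_transition_le:
  assumes "\<And>x. norm (g x) \<le> 1"
  shows "norm (transition g u) \<le> 1"
proof -
  have "norm (transition g u) \<le> (\<integral>\<omega>. 1 \<partial>M)"
    unfolding transition_def using assms by (intro order_trans[OF integral_norm_bound] integral_mono') auto
  then show ?thesis by (simp add: prob_space)
qed

lemma X_increments_prod:
  fixes g :: "nat \<Rightarrow> real \<Rightarrow> 'c::{real_normed_field,banach,second_countable_topology}"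
  assumes s: "0 \<le> s 0" "\<And>i. i < n \<Longrightarrow> s i < s (Suc i)"
    and [measurable]: "\<And>i. g i \<in> borel_measurable borel" and b: "\<And>i x. norm (g i x) \<le> 1"
  shows "(\<integral>\<omega>. (\<Prod>i<n. g i (X (s (Suc i)) \<omega> - X (s i) \<omega>)) \<partial>M) = (\<Prod>i<n. transition (g i) (s (Suc i) - s i))"
proof -
  have nn: "i \<le> n \<Longrightarrow> 0 \<le> s i" for i
  proof (induction i)
    case (Suc i)
    then show ?case using s(2)[of i] by auto
  qed (use s in auto)
  have "indep_vars (\<lambda>_. borel) (\<lambda>i \<omega>. X (s (Suc i)) \<omega> - X (s i) \<omega>) {..<n}"
    using levy_X s unfolding levy_process_def independent_increments_def by blast
  then have "indep_vars (\<lambda>_. borel) (\<lambda>i \<omega>. g i (X (s (Suc i)) \<omega> - X (s i) \<omega>)) {..<n}"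
    by (rule indep_vars_compose2) auto
  then have "(\<integral>\<omega>. (\<Prod>i<n. g i (X (s (Suc i)) \<omega> - X (s i) \<omega>)) \<partial>M) =
      (\<Prod>i<n. \<integral>\<omega>. g i (X (s (Suc i)) \<omega> - X (s i) \<omega>) \<partial>M)"
    by (rule indep_vars_lebesgue_integral[rotated])
       (use nn b in \<open>auto intro!: integrable_const_bound[where B=1]\<close>)
  also have "\<dots> = (\<Prod>i<n. transition (g i) (s (Suc i) - s i))"
    by (intro prod.cong X_increment) (use nn s in \<open>auto intro: less_imp_le\<close>)
  finally show ?thesis .
qed

lemma Y_approx:
  assumes "0 \<le> t"
  shows "AE \<omega> in M. (\<lambda>k. X (grid k i (T t \<omega>)) \<omega>) \<longlonglongrightarrow> Y t \<omega>"
  using continuous_X T_nonneg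
proof eventually_elim
  fix \<omega> assume c: "continuous_on {0..} (\<lambda>t. X t \<omega>)" and "\<forall>t\<ge>0. 0 \<le> T t \<omega>"
  then have "0 \<le> T t \<omega>" using assms by auto
  then show "(\<lambda>k. X (grid k i (T t \<omega>)) \<omega>) \<longlonglongrightarrow> Y t \<omega>"
    unfolding Y_def
    by (intro continuous_on_tendsto_compose[OF c] grid_tendsto) (auto simp: grid_nonneg)
qed

abbreviation path_algebra :: "(real \<Rightarrow> real) measure" where
  "path_algebra \<equiv> \<Pi>\<^sub>M t\<in>{0..}. borel"

text \<open>Path evaluation at a variable time is not measurable for the product sigma-algebra. The
  rounded time has countably many values, and on each of them the map is a coordinate
  projection.\<close>

lemma measurable_eval_grid[measurable]:
  assumes t: "0 \<le> t"
  shows "(\<lambda>p. fst p (grid k i (snd p t))) \<in> borel_measurable (path_algebra \<Otimes>\<^sub>M path_algebra)"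
proof -
  have "(\<lambda>p. snd p t) \<in> borel_measurable (path_algebra \<Otimes>\<^sub>M path_algebra)"
    by (rule measurable_compose[OF measurable_snd measurable_component_singleton]) (use t in auto)
  then have 1: "(\<lambda>p. nat \<lceil>real (Suc k) * snd p t\<rceil>) \<in> path_algebra \<Otimes>\<^sub>M path_algebra \<rightarrow>\<^sub>M count_space UNIV"
    by measurable
  have 2: "(\<lambda>p. fst p (real m / real (Suc k) + real i / real (Suc k))) \<in> borel_measurable (path_algebra \<Otimes>\<^sub>M path_algebra)" for m
    by (rule measurable_compose[OF measurable_fst measurable_component_singleton]) auto
  show ?thesis unfolding grid_def by (rule measurable_compose_countable[OF 2 1])
qed

lemma X_path_measurable: "(\<lambda>\<omega>. \<lambda>t\<in>{0..}. X t \<omega>) \<in> M \<rightarrow>\<^sub>M path_algebra"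
  and T_path_measurable: "(\<lambda>\<omega>. \<lambda>t\<in>{0..}. T t \<omega>) \<in> M \<rightarrow>\<^sub>M path_algebra"
  by (auto intro!: measurable_restrict)

lemma measurable_X_grid:
  assumes t: "0 \<le> t"
  shows "(\<lambda>\<omega>. X (grid k i (T t \<omega>)) \<omega>) \<in> borel_measurable M"
  using measurable_compose[OF measurable_Pair[OF X_path_measurable T_path_measurable] measurable_eval_grid[OF t, of k i]] t
  by (simp add: grid_nonneg)

lemma Y_measurable[measurable]: "0 \<le> t \<Longrightarrow> Y t \<in> borel_measurable (completion M)"
  by (rule borel_measurable_completion_AE_LIMSEQ[OF measurable_X_grid[of t _ 0] Y_approx])

text \<open>By independence the two paths have a product law, so Fubini freezes the path of T and
  leaves increments of X at deterministic times. These times are strictly increasing even where T is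
  constant, because the level \<open>i\<close> of the grid moves with the index.\<close>

lemma decouple_grid:
  fixes g :: "nat \<Rightarrow> real \<Rightarrow> 'c::{real_normed_field,banach,second_countable_topology}"
  assumes t: "\<And>i. i \<le> n \<Longrightarrow> 0 \<le> t i" "\<And>i. i < n \<Longrightarrow> t i \<le> t (Suc i)"
    and [measurable]: "\<And>i. g i \<in> borel_measurable borel" "\<And>i. transition (g i) \<in> borel_measurable borel"
    and b: "\<And>i x. norm (g i x) \<le> 1"
  shows "(\<integral>\<omega>. (\<Prod>i<n. g i (X (grid k (Suc i) (T (t (Suc i)) \<omega>)) \<omega> - X (grid k i (T (t i) \<omega>)) \<omega>)) \<partial>M) =
     (\<integral>\<omega>. (\<Prod>i<n. transition (g i) (grid k (Suc i) (T (t (Suc i)) \<omega>) - grid k i (T (t i) \<omega>))) \<partial>M)"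
    (is "?L = ?R")
proof -
  let ?XX = "\<lambda>\<omega>. \<lambda>t\<in>{0..}. X t \<omega>" and ?TT = "\<lambda>\<omega>. \<lambda>t\<in>{0..}. T t \<omega>"
  let ?F = "\<lambda>p::(real\<Rightarrow>real)\<times>(real\<Rightarrow>real). \<Prod>i<n. g i (fst p (grid k (Suc i) (snd p (t (Suc i)))) - fst p (grid k i (snd p (t i))))"
  let ?PX = "distr M path_algebra ?XX" and ?PT = "distr M path_algebra ?TT"
  interpret PX: prob_space ?PX by (rule prob_space_distr[OF X_path_measurable])
  interpret PT: prob_space ?PT by (rule prob_space_distr[OF T_path_measurable])
  interpret P: pair_prob_space ?PX ?PT ..
  have Fm[measurable]: "?F \<in> borel_measurable (path_algebra \<Otimes>\<^sub>M path_algebra)"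
  proof (rule borel_measurable_prod)
    fix i assume "i \<in> {..<n}"
    then have "0 \<le> t i" "0 \<le> t (Suc i)" using t by auto
    then show "(\<lambda>p. g i (fst p (grid k (Suc i) (snd p (t (Suc i)))) - fst p (grid k i (snd p (t i))))) \<in> borel_measurable (path_algebra \<Otimes>\<^sub>M path_algebra)"
      by (intro measurable_compose[OF borel_measurable_diff[OF measurable_eval_grid measurable_eval_grid]]) auto
  qed
  have Fb: "norm (?F p) \<le> 1" for p
    using b unfolding prod_norm[symmetric] by (intro prod_le_1) auto
  have F2[measurable]: "?F \<in> borel_measurable (?PX \<Otimes>\<^sub>M ?PT)"
    using Fm by (simp cong: measurable_cong_sets sets_pair_measure_cong)
  have Hm: "(\<lambda>y. \<integral>x. ?F (x, y) \<partial>?PX) \<in> borel_measurable path_algebra"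
  proof -
    have "(\<lambda>q. ?F (snd q, fst q)) \<in> borel_measurable (path_algebra \<Otimes>\<^sub>M path_algebra)"
      by (rule measurable_compose[OF measurable_Pair[OF measurable_snd measurable_fst] Fm])
    then have "(\<lambda>q. ?F (snd q, fst q)) \<in> borel_measurable (path_algebra \<Otimes>\<^sub>M ?PX)"
      by (simp cong: measurable_cong_sets sets_pair_measure_cong)
    then show ?thesis
      by (intro PX.borel_measurable_lebesgue_integral) (simp add: split_beta')
  qed
  have "?L = (\<integral>\<omega>. ?F (?XX \<omega>, ?TT \<omega>) \<partial>M)"
    using t by (intro Bochner_Integration.integral_cong prod.cong) (auto simp: grid_nonneg Suc_le_eq)
  also have "\<dots> = (\<integral>p. ?F p \<partial>distr M (path_algebra \<Otimes>\<^sub>M path_algebra) (\<lambda>\<omega>. (?XX \<omega>, ?TT \<omega>)))"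
    by (rule integral_distr[symmetric, OF measurable_Pair[OF X_path_measurable T_path_measurable] Fm])
  also have "distr M (path_algebra \<Otimes>\<^sub>M path_algebra) (\<lambda>\<omega>. (?XX \<omega>, ?TT \<omega>)) = ?PX \<Otimes>\<^sub>M ?PT"
    using indep_XT unfolding independent_processes_def indep_var_distribution_eq by simp
  also have "(\<integral>p. ?F p \<partial>(?PX \<Otimes>\<^sub>M ?PT)) = (\<integral>y. \<integral>x. ?F (x, y) \<partial>?PX \<partial>?PT)"
  proof -
    have "integrable (?PX \<Otimes>\<^sub>M ?PT) ?F"
      by (intro P.integrable_const_bound[where B=1] AE_I2 Fb F2)
    then show ?thesis using P.integral_snd[of "\<lambda>x y. ?F (x, y)"] by (simp add: split_beta')
  qed
  also have "\<dots> = (\<integral>\<omega>'. \<integral>x. ?F (x, ?TT \<omega>') \<partial>?PX \<partial>M)"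
    by (rule integral_distr[OF T_path_measurable Hm])
  also have "\<dots> = ?R"
  proof (rule integral_cong_AE)
    show "(\<lambda>\<omega>'. \<integral>x. ?F (x, ?TT \<omega>') \<partial>?PX) \<in> borel_measurable M"
      by (rule measurable_compose[OF T_path_measurable Hm])
    show "AE \<omega>' in M. (\<integral>x. ?F (x, ?TT \<omega>') \<partial>?PX) =
      (\<Prod>i<n. transition (g i) (grid k (Suc i) (T (t (Suc i)) \<omega>') - grid k i (T (t i) \<omega>')))"
      using mono_T
    proof eventually_elim
      fix \<omega>' assume m: "mono_on {0..} (\<lambda>t. T t \<omega>')"
      have "grid k i (T (t i) \<omega>') < grid k (Suc i) (T (t (Suc i)) \<omega>')" if "i < n" for i
        using that t by (intro grid_less mono_onD[OF m]) auto
      then have "(\<integral>\<omega>. (\<Prod>i<n. g i (X (grid k (Suc i) (T (t (Suc i)) \<omega>')) \<omega> - X (grid k i (T (t i) \<omega>')) \<omega>)) \<partial>M) =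
      (\<Prod>i<n. transition (g i) (grid k (Suc i) (T (t (Suc i)) \<omega>') - grid k i (T (t i) \<omega>')))"
        by (intro X_increments_prod[where s="\<lambda>i. grid k i (T (t i) \<omega>')"]) (auto simp: b grid_nonneg)
      moreover have "(\<integral>x. ?F (x, ?TT \<omega>') \<partial>?PX) = (\<integral>\<omega>. ?F (?XX \<omega>, ?TT \<omega>') \<partial>M)"
      proof (rule integral_distr[OF X_path_measurable])
        have "?TT \<omega>' \<in> space path_algebra" by (auto simp: space_PiM)
        then show "(\<lambda>x. ?F (x, ?TT \<omega>')) \<in> borel_measurable path_algebra"
          using Fm by (rule measurable_compose[OF measurable_Pair2'])
      qed
      moreover have "\<dots> = (\<integral>\<omega>. (\<Prod>i<n. g i (X (grid k (Suc i) (T (t (Suc i)) \<omega>')) \<omega> - X (grid k i (T (t i) \<omega>')) \<omega>)) \<partial>M)"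
        using t by (intro Bochner_Integration.integral_cong prod.cong refl) (auto simp: grid_nonneg Suc_le_eq)
      ultimately show "(\<integral>x. ?F (x, ?TT \<omega>') \<partial>?PX) =
        (\<Prod>i<n. transition (g i) (grid k (Suc i) (T (t (Suc i)) \<omega>') - grid k i (T (t i) \<omega>')))"
        by simp
    qed
    have gT: "(\<lambda>\<omega>. grid k i (T s \<omega>)) \<in> borel_measurable M" if "0 \<le> s" for i s
      unfolding grid_def using that by measurable
    show "(\<lambda>\<omega>'. \<Prod>i<n. transition (g i) (grid k (Suc i) (T (t (Suc i)) \<omega>') - grid k i (T (t i) \<omega>'))) \<in> borel_measurable M"
      using t by (intro borel_measurable_prod measurable_compose[OF borel_measurable_diff[OF gT gT]]) auto
  qed
  finally show ?thesis .
qed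

text \<open>Limit of \<open>decouple_grid\<close> as the mesh tends to 0: continuity of the paths of
  X gives the left side and continuity of the transition functions the right side. All factors are
  bounded by 1, which supplies the majorant.\<close>

lemma decouple:
  fixes g :: "nat \<Rightarrow> real \<Rightarrow> 'c::{real_normed_field,banach,second_countable_topology}"
  assumes t: "0 \<le> t 0" "\<And>i. i < n \<Longrightarrow> t i \<le> t (Suc i)"
    and g: "\<And>i. continuous_on UNIV (g i)" and b: "\<And>i x. norm (g i x) \<le> 1"
  shows "(\<integral>\<omega>. (\<Prod>i<n. g i (Y (t (Suc i)) \<omega> - Y (t i) \<omega>)) \<partial>completion M) =
     (\<integral>\<omega>. (\<Prod>i<n. transition (g i) (T (t (Suc i)) \<omega> - T (t i) \<omega>)) \<partial>M)"
proof (rule LIMSEQ_unique)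
  have [measurable]: "g i \<in> borel_measurable borel" for i
    by (rule borel_measurable_continuous_onI[OF g])
  note cs = continuous_transition[OF g b]
  have [measurable]: "transition (g i) \<in> borel_measurable borel" for i
    by (rule borel_measurable_continuous_onI[OF cs])
  have nn: "i \<le> n \<Longrightarrow> 0 \<le> t i" for i
  proof (induction i)
    case (Suc i)
    then show ?case using t(2)[of i] by auto
  qed (use t in auto)
  note [measurable] = measurable_X_grid
  have gT[measurable]: "(\<lambda>\<omega>. grid k i (T s \<omega>)) \<in> borel_measurable M" if "0 \<le> s" for k i s
    unfolding grid_def using that by measurable
  let ?f = "\<lambda>k \<omega>. \<Prod>i<n. g i (X (grid k (Suc i) (T (t (Suc i)) \<omega>)) \<omega> - X (grid k i (T (t i) \<omega>)) \<omega>)"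
  let ?h = "\<lambda>k \<omega>. \<Prod>i<n. transition (g i) (grid k (Suc i) (T (t (Suc i)) \<omega>) - grid k i (T (t i) \<omega>))"
  have fm: "?f k \<in> borel_measurable M" for k
    using nn by (intro borel_measurable_prod measurable_compose[OF borel_measurable_diff]) (auto intro!: measurable_X_grid)
  have "integral\<^sup>L M (?f k) = integral\<^sup>L M (?h k)" for k
    by (rule decouple_grid) (use nn t b in auto)
  then have eq: "integral\<^sup>L (completion M) (?f k) = integral\<^sup>L M (?h k)" for k
    by (simp add: integral_completion[OF fm])
  interpret C: prob_space "completion M" by (rule prob_space_completion) unfold_locales
  show "(\<lambda>k. integral\<^sup>L (completion M) (?f k)) \<longlonglongrightarrow>
      (\<integral>\<omega>. (\<Prod>i<n. g i (Y (t (Suc i)) \<omega> - Y (t i) \<omega>)) \<partial>completion M)"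
  proof (rule integral_dominated_convergence[where w="\<lambda>_. 1"])
    have "AE \<omega> in M. \<forall>i\<in>{..<n}. (\<lambda>k. X (grid k (Suc i) (T (t (Suc i)) \<omega>)) \<omega>) \<longlonglongrightarrow> Y (t (Suc i)) \<omega> \<and>
        (\<lambda>k. X (grid k i (T (t i) \<omega>)) \<omega>) \<longlonglongrightarrow> Y (t i) \<omega>"
      using nn by (intro AE_finite_allI AE_conjI Y_approx) auto
    then show "AE \<omega> in completion M. (\<lambda>k. ?f k \<omega>) \<longlonglongrightarrow> (\<Prod>i<n. g i (Y (t (Suc i)) \<omega> - Y (t i) \<omega>))"
      by (intro AE_completion, eventually_elim)
         (intro tendsto_prod continuous_on_tendsto_compose[OF g] tendsto_diff, auto)
    show "(\<lambda>\<omega>. \<Prod>i<n. g i (Y (t (Suc i)) \<omega> - Y (t i) \<omega>)) \<in> borel_measurable (completion M)"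
      using nn by (intro borel_measurable_prod measurable_compose[OF borel_measurable_diff]) auto
    show "AE \<omega> in completion M. norm (?f k \<omega>) \<le> 1" for k
      using b unfolding prod_norm[symmetric] by (intro AE_I2 prod_le_1) auto
  qed (use fm in \<open>auto intro: measurable_completion\<close>)
  show "(\<lambda>k. integral\<^sup>L (completion M) (?f k)) \<longlonglongrightarrow>
      (\<integral>\<omega>. (\<Prod>i<n. transition (g i) (T (t (Suc i)) \<omega> - T (t i) \<omega>)) \<partial>M)"
    unfolding eq
  proof (rule integral_dominated_convergence[where w="\<lambda>_. 1"])
    show "AE \<omega> in M. (\<lambda>k. ?h k \<omega>) \<longlonglongrightarrow> (\<Prod>i<n. transition (g i) (T (t (Suc i)) \<omega> - T (t i) \<omega>))"
      using T_nonneg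
    proof eventually_elim
      fix \<omega> assume T: "\<forall>t\<ge>0. 0 \<le> T t \<omega>"
      show "(\<lambda>k. ?h k \<omega>) \<longlonglongrightarrow> (\<Prod>i<n. transition (g i) (T (t (Suc i)) \<omega> - T (t i) \<omega>))"
        by (intro tendsto_prod continuous_on_tendsto_compose[OF cs] tendsto_diff grid_tendsto)
           (use T nn in auto)
    qed
    show "AE \<omega> in M. norm (?h k \<omega>) \<le> 1" for k
      using norm_transition_le[OF b] unfolding prod_norm[symmetric] by (intro AE_I2 prod_le_1) auto
  qed (use nn in \<open>auto intro!: borel_measurable_prod\<close>)
qed

lemma decouple_increment:
  fixes g :: "real \<Rightarrow> 'c::{real_normed_field,banach,second_countable_topology}"
  assumes "0 \<le> s" "s \<le> t" and "continuous_on UNIV g" and "\<And>x. norm (g x) \<le> 1"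
  shows "(\<integral>\<omega>. g (Y t \<omega> - Y s \<omega>) \<partial>completion M) = (\<integral>\<omega>. transition g (T t \<omega> - T s \<omega>) \<partial>M)"
  using decouple[of "\<lambda>i. if i = 0 then s else t" 1 "\<lambda>_. g"] assms by simp

lemma Y_0: "AE \<omega> in completion M. Y 0 \<omega> = 0"
  by (rule AE_completion) (use X_0 T_0 in eventually_elim, auto simp: Y_def)

lemma cadlag_Y: "AE \<omega> in completion M. cadlag (\<lambda>t. Y t \<omega>)"
proof (rule AE_completion)
  have "AE \<omega> in M. cadlag (\<lambda>t. T t \<omega>)" using levy_T by (auto simp: levy_process_def)
  with continuous_X T_nonneg show "AE \<omega> in M. cadlag (\<lambda>t. Y t \<omega>)"
  proof eventually_elim
    fix \<omega> assume c: "continuous_on {0..} (\<lambda>t. X t \<omega>)" and nn: "\<forall>t\<ge>0. 0 \<le> T t \<omega>"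
      and T: "cadlag (\<lambda>t. T t \<omega>)"
    note comp = continuous_on_tendsto_compose[OF c]
    show "cadlag (\<lambda>t. Y t \<omega>)" unfolding cadlag_def Y_def
    proof safe
      fix t :: real assume t: "0 \<le> t"
      show "((\<lambda>t. X (T t \<omega>) \<omega>) \<longlongrightarrow> X (T t \<omega>) \<omega>) (at_right t)"
      proof (rule comp)
        show "((\<lambda>t. T t \<omega>) \<longlongrightarrow> T t \<omega>) (at_right t)" using T t by (auto simp: cadlag_def)
        show "\<forall>\<^sub>F x in at_right t. T x \<omega> \<in> {0..}"
          using nn t unfolding eventually_at_right_field by (intro exI[of _ "t + 1"]) auto
      qed (use nn t in auto)
    next
      fix t :: real assume t: "0 < t"
      then obtain l where l: "((\<lambda>t. T t \<omega>) \<longlongrightarrow> l) (at_left t)" using T by (auto simp: cadlag_def)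
      have ev: "\<forall>\<^sub>F x in at_left t. 0 \<le> T x \<omega>"
        using nn t unfolding eventually_at_left_field by (intro exI[of _ 0]) auto
      have "0 \<le> l" by (rule tendsto_lowerbound[OF l ev]) simp
      then have "((\<lambda>t. X (T t \<omega>) \<omega>) \<longlongrightarrow> X l \<omega>) (at_left t)"
        using ev by (intro comp[OF l]) auto
      then show "\<exists>l. ((\<lambda>t. X (T t \<omega>) \<omega>) \<longlongrightarrow> l) (at_left t)" by blast
    qed
  qed
qed

lemma T_increment:
  fixes h :: "real \<Rightarrow> 'b::{banach, second_countable_topology}"
  assumes "0 \<le> s" "0 \<le> t" and [measurable]: "h \<in> borel_measurable borel"
  shows "(\<integral>\<omega>. h (T (s + t) \<omega> - T s \<omega>) \<partial>M) = (\<integral>\<omega>. h (T t \<omega>) \<partial>M)"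
proof -
  have st: "distr M borel (\<lambda>\<omega>. T (s + t) \<omega> - T s \<omega>) = distr M borel (\<lambda>\<omega>. T t \<omega> - T 0 \<omega>)"
    using levy_T assms unfolding levy_process_def stationary_increments_def by auto
  have "(\<integral>\<omega>. h (T (s + t) \<omega> - T s \<omega>) \<partial>M) = (\<integral>x. h x \<partial>distr M borel (\<lambda>\<omega>. T (s + t) \<omega> - T s \<omega>))"
    using assms by (subst integral_distr) auto
  also have "\<dots> = (\<integral>\<omega>. h (T t \<omega> - T 0 \<omega>) \<partial>M)"
    unfolding st using assms by (subst integral_distr) auto
  also have "\<dots> = (\<integral>\<omega>. h (T t \<omega>) \<partial>M)"
    using assms by (intro integral_cong_AE, measurable) (use T_0 in auto)
  finally show ?thesis .
qed

lemma real_distribution_distr_completion: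
  assumes "f \<in> borel_measurable (completion M)"
  shows "real_distribution (distr (completion M) borel f)"
proof -
  interpret C: prob_space "completion M" by (rule prob_space_completion) unfold_locales
  show ?thesis using assms by (intro real_distribution.intro C.prob_space_distr) (auto simp: real_distribution_axioms_def)
qed

lemma char_Y_increment:
  assumes "0 \<le> s" "0 \<le> t"
  shows "char (distr (completion M) borel (\<lambda>\<omega>. Y (s + t) \<omega> - Y s \<omega>)) z =
    (\<integral>\<omega>. transition (\<lambda>x. iexp (z * x)) (T t \<omega>) \<partial>M)"
proof -
  have c: "continuous_on UNIV (\<lambda>x. iexp (z * x))" by (intro continuous_intros)
  have sm: "transition (\<lambda>x. iexp (z * x)) \<in> borel_measurable borel"
    by (rule borel_measurable_continuous_onI[OF continuous_transition[OF c]]) simp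
  have "char (distr (completion M) borel (\<lambda>\<omega>. Y (s + t) \<omega> - Y s \<omega>)) z =
     (\<integral>\<omega>. iexp (z * (Y (s + t) \<omega> - Y s \<omega>)) \<partial>completion M)"
    unfolding char_def using assms by (subst integral_distr) auto
  also have "\<dots> = (\<integral>\<omega>. transition (\<lambda>x. iexp (z * x)) (T (s + t) \<omega> - T s \<omega>) \<partial>M)"
    by (rule decouple_increment[OF _ _ c]) (use assms in auto)
  also have "\<dots> = (\<integral>\<omega>. transition (\<lambda>x. iexp (z * x)) (T t \<omega>) \<partial>M)"
    by (rule T_increment[OF assms sm])
  finally show ?thesis .
qed

lemma char_Y:
  assumes "0 \<le> t"
  shows "char (distr (completion M) borel (Y t)) z = (\<integral>\<omega>. transition (\<lambda>x. iexp (z * x)) (T t \<omega>) \<partial>M)"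
proof -
  have "distr (completion M) borel (Y t) = distr (completion M) borel (\<lambda>\<omega>. Y (0 + t) \<omega> - Y 0 \<omega>)"
    using assms Y_0 by (intro distr_cong_AE) auto
  then show ?thesis using char_Y_increment[of 0 t z] assms by simp
qed

text \<open>Independence uses \<open>decouple\<close> twice, for the whole product and for each
  single factor, with the independence of the increments of T in between. Stationarity is read off
  characteristic functions.\<close>

theorem levy_process_Y: "levy_process (completion M) Y"
  unfolding levy_process_def
proof (intro conjI allI impI)
  show "prob_space (completion M)" by (rule prob_space_completion) unfold_locales
  then interpret C: prob_space "completion M" .
  show "independent_increments (completion M) Y"
    unfolding independent_increments_def
  proof (intro allI impI)
    fix n and t :: "nat \<Rightarrow> real" assume t: "0 \<le> t 0 \<and> (\<forall>i<n. t i < t (Suc i))"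
    then have t0: "0 \<le> t 0" and tS: "\<And>i. i < n \<Longrightarrow> t i < t (Suc i)" by auto
    have nn: "i \<le> n \<Longrightarrow> 0 \<le> t i" for i
    proof (induction i)
      case (Suc i)
      then show ?case using tS[of i] by auto
    qed (use t0 in auto)
    show "C.indep_vars (\<lambda>_. borel) (\<lambda>i \<omega>. Y (t (Suc i)) \<omega> - Y (t i) \<omega>) {..<n}"
    proof (rule C.indep_vars_bounded_continuous)
      fix g :: "nat \<Rightarrow> real \<Rightarrow> real"
      assume g: "\<And>i. continuous_on UNIV (g i)" and b: "\<And>i x. norm (g i x) \<le> 1"
      note cs = continuous_transition[OF g b]
      have [measurable]: "transition (g i) \<in> borel_measurable borel" for i
        by (rule borel_measurable_continuous_onI[OF cs])
      have iT: "indep_vars (\<lambda>_. borel) (\<lambda>i \<omega>. T (t (Suc i)) \<omega> - T (t i) \<omega>) {..<n}"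
        using levy_T t unfolding levy_process_def independent_increments_def by blast
      have "C.expectation (\<lambda>\<omega>. \<Prod>i<n. g i (Y (t (Suc i)) \<omega> - Y (t i) \<omega>)) =
          (\<integral>\<omega>. (\<Prod>i<n. transition (g i) (T (t (Suc i)) \<omega> - T (t i) \<omega>)) \<partial>M)"
        by (rule decouple) (use t0 tS g b in \<open>auto intro: less_imp_le\<close>)
      also have "\<dots> = (\<Prod>i<n. \<integral>\<omega>. transition (g i) (T (t (Suc i)) \<omega> - T (t i) \<omega>) \<partial>M)"
      proof (rule indep_vars_lebesgue_integral)
        show "indep_vars (\<lambda>_. borel) (\<lambda>i \<omega>. transition (g i) (T (t (Suc i)) \<omega> - T (t i) \<omega>)) {..<n}"
          by (rule indep_vars_compose2[OF iT]) auto
        show "integrable M (\<lambda>\<omega>. transition (g i) (T (t (Suc i)) \<omega> - T (t i) \<omega>))" if "i \<in> {..<n}" for i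
          using nn that norm_transition_le[OF b] by (intro integrable_const_bound[where B=1]) auto
      qed simp
      also have "\<dots> = (\<Prod>i<n. C.expectation (\<lambda>\<omega>. g i (Y (t (Suc i)) \<omega> - Y (t i) \<omega>)))"
        by (intro prod.cong refl decouple_increment[symmetric]) (use nn tS g b in \<open>auto intro: less_imp_le\<close>)
      finally show "C.expectation (\<lambda>\<omega>. \<Prod>i<n. g i (Y (t (Suc i)) \<omega> - Y (t i) \<omega>)) =
        (\<Prod>i<n. C.expectation (\<lambda>\<omega>. g i (Y (t (Suc i)) \<omega> - Y (t i) \<omega>)))" .
    qed (use nn in auto)
  qed
  show "stationary_increments (completion M) Y"
    unfolding stationary_increments_def
  proof (intro allI impI)
    fix s h :: real assume sh: "0 \<le> s" "0 \<le> h"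
    show "distr (completion M) borel (\<lambda>\<omega>. Y (s + h) \<omega> - Y s \<omega>) = distr (completion M) borel (\<lambda>\<omega>. Y h \<omega> - Y 0 \<omega>)"
    proof (rule Levy_uniqueness)
      show "char (distr (completion M) borel (\<lambda>\<omega>. Y (s + h) \<omega> - Y s \<omega>)) = char (distr (completion M) borel (\<lambda>\<omega>. Y h \<omega> - Y 0 \<omega>))"
        using char_Y_increment[OF sh] char_Y_increment[of 0 h] sh by auto
    qed (use sh in \<open>auto intro!: real_distribution_distr_completion\<close>)
  qed
qed (use Y_0 cadlag_Y in auto)

end

section \<open>Laplace transforms in the right half-plane\<close>

text \<open>The mean value inequality on the ball bounds the difference quotients by
  \<open>B\<close>, after which dominated convergence along sequences applies. The real and complex
  cases are treated at once.\<close>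

lemma has_field_derivative_lebesgue_integral:
  fixes f :: "'c::{real_normed_field,banach,second_countable_topology} \<Rightarrow> 'a \<Rightarrow> 'c"
  assumes r: "0 < r" and int: "\<And>w. w \<in> ball z r \<Longrightarrow> integrable M (f w)"
    and f': "f' \<in> borel_measurable M" and B: "integrable M B"
    and D: "AE x in M. \<forall>w\<in>ball z r. \<exists>d. ((\<lambda>w. f w x) has_field_derivative d) (at w) \<and> norm d \<le> B x"
    and D0: "AE x in M. ((\<lambda>w. f w x) has_field_derivative f' x) (at z)"
  shows "((\<lambda>w. \<integral>x. f w x \<partial>M) has_field_derivative (\<integral>x. f' x \<partial>M)) (at z)"
proof -
  have zb: "z \<in> ball z r" using r by simp
  have at: "at z within ball z r = at z" by (rule at_within_open) (use zb in auto)
  have "((\<lambda>w. ((\<integral>x. f w x \<partial>M) - (\<integral>x. f z x \<partial>M)) / (w - z)) \<longlongrightarrow> (\<integral>x. f' x \<partial>M)) (at z within ball z r)"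
    unfolding tendsto_at_iff_sequentially
  proof (intro allI impI)
    fix X assume X: "\<forall>i. X i \<in> ball z r - {z}" and Xz: "X \<longlonglongrightarrow> z"
    have eq: "((\<integral>x. f (X i) x \<partial>M) - (\<integral>x. f z x \<partial>M)) / (X i - z) = (\<integral>x. (f (X i) x - f z x) / (X i - z) \<partial>M)" for i
      using X int[of "X i"] int[OF zb] by simp
    show "((\<lambda>w. ((\<integral>x. f w x \<partial>M) - (\<integral>x. f z x \<partial>M)) / (w - z)) \<circ> X) \<longlonglongrightarrow> (\<integral>x. f' x \<partial>M)"
      unfolding comp_def eq
    proof (rule integral_dominated_convergence[OF f' _ B])
      show "(\<lambda>x. (f (X i) x - f z x) / (X i - z)) \<in> borel_measurable M" for i
        using X int[of "X i"] int[OF zb] by (intro borel_measurable_divide borel_measurable_diff) auto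
      show "AE x in M. (\<lambda>i. (f (X i) x - f z x) / (X i - z)) \<longlonglongrightarrow> f' x"
        using D0
      proof eventually_elim
        fix x assume "((\<lambda>w. f w x) has_field_derivative f' x) (at z)"
        then have "((\<lambda>w. (f w x - f z x) / (w - z)) \<longlongrightarrow> f' x) (at z)" by (simp add: has_field_derivative_iff)
        then show "(\<lambda>i. (f (X i) x - f z x) / (X i - z)) \<longlonglongrightarrow> f' x"
          unfolding tendsto_at_iff_sequentially comp_def using X Xz by auto
      qed
      show "AE x in M. norm ((f (X i) x - f z x) / (X i - z)) \<le> B x" for i
        using D
      proof eventually_elim
        fix x assume "\<forall>w\<in>ball z r. \<exists>d. ((\<lambda>w. f w x) has_field_derivative d) (at w) \<and> norm d \<le> B x"
        then obtain d where d: "\<And>w. w \<in> ball z r \<Longrightarrow> ((\<lambda>w. f w x) has_field_derivative d w) (at w)"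
          "\<And>w. w \<in> ball z r \<Longrightarrow> norm (d w) \<le> B x" by metis
        have "norm (f (X i) x - f z x) \<le> B x * norm (X i - z)"
          by (rule field_differentiable_bound[where S="ball z r" and f'=d])
             (use d X zb in \<open>auto intro: has_field_derivative_at_within\<close>)
        then show "norm ((f (X i) x - f z x) / (X i - z)) \<le> B x"
          using X by (simp add: norm_divide divide_le_eq)
      qed
    qed
  qed
  then show ?thesis unfolding at by (simp add: has_field_derivative_iff)
qed

lemma holomorphic_eq_on_right_half_plane:
  assumes f: "f holomorphic_on {w. 0 < Re w}" and g: "g holomorphic_on {w. 0 < Re w}"
    and eq: "\<And>s. 0 < s \<Longrightarrow> f (of_real s) = g (of_real s)" and w: "0 < Re w"
  shows "f w = g w"
proof -
  have "f w - g w = 0"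
  proof (rule analytic_continuation[of "\<lambda>w. f w - g w" "{w. 0 < Re w}" "of_real ` {0<..}" 1])
    show "1 islimpt complex_of_real ` {0<..}"
      unfolding islimpt_approachable
    proof (intro allI impI)
      fix e :: real assume "0 < e"
      moreover have "complex_of_real (1 + e / 2) - 1 = complex_of_real (e / 2)" by simp
      moreover have "cmod (complex_of_real (e / 2)) = \<bar>e / 2\<bar>" by (rule norm_of_real)
      ultimately show "\<exists>x'\<in>complex_of_real ` {0<..}. x' \<noteq> 1 \<and> dist x' 1 < e"
        by (intro bexI[of _ "complex_of_real (1 + e / 2)"]) (auto simp: dist_norm simp del: of_real_add of_real_divide)
    qed
  qed (use f g eq w in \<open>auto intro!: holomorphic_intros convex_connected convex_halfspace_Re_gt open_halfspace_Re_gt\<close>)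
  then show ?thesis by simp
qed

context prob_space
begin

lemma integrable_laplace:
  assumes T: "T \<in> borel_measurable M" "AE \<omega> in M. 0 \<le> T \<omega>" and w: "0 \<le> Re w"
  shows "integrable M (\<lambda>\<omega>. exp (- (w * complex_of_real (T \<omega>))))"
proof (rule integrable_const_bound[where B=1])
  show "AE \<omega> in M. norm (exp (- (w * complex_of_real (T \<omega>)))) \<le> 1"
    using T(2) by eventually_elim (use w in simp)
qed (use T in measurable)

lemma holomorphic_laplace:
  assumes T[measurable]: "T \<in> borel_measurable M" and pos: "AE \<omega> in M. 0 \<le> T \<omega>"
  shows "(\<lambda>w. \<integral>\<omega>. exp (- (w * complex_of_real (T \<omega>))) \<partial>M) holomorphic_on {w. 0 < Re w}"
proof (rule holomorphic_onI)
  fix w :: complex assume "w \<in> {w. 0 < Re w}"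
  then have w: "0 < Re w" by simp
  define r where "r = Re w / 2"
  have r: "0 < r" using w by (simp add: r_def)
  have bl: "r < Re v" if "v \<in> ball w r" for v
    using that abs_Re_le_cmod[of "w - v"] by (auto simp: dist_norm r_def)
  have "((\<lambda>w. \<integral>\<omega>. exp (- (w * complex_of_real (T \<omega>))) \<partial>M) has_field_derivative
      (\<integral>\<omega>. - complex_of_real (T \<omega>) * exp (- (w * complex_of_real (T \<omega>))) \<partial>M)) (at w)"
  proof (rule has_field_derivative_lebesgue_integral[where B="\<lambda>_. 1/r", OF r])
    show "AE \<omega> in M. \<forall>v\<in>ball w r. \<exists>d. ((\<lambda>v. exp (- (v * complex_of_real (T \<omega>)))) has_field_derivative d) (at v) \<and> norm d \<le> 1 / r"
      using pos
    proof (eventually_elim, intro ballI exI conjI)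
      fix \<omega> v assume T0: "0 \<le> T \<omega>" and v: "v \<in> ball w r"
      show "((\<lambda>v. exp (- (v * complex_of_real (T \<omega>)))) has_field_derivative - complex_of_real (T \<omega>) * exp (- (v * complex_of_real (T \<omega>)))) (at v)"
        by (auto intro!: derivative_eq_intros)
      have "norm (- complex_of_real (T \<omega>) * exp (- (v * complex_of_real (T \<omega>)))) = T \<omega> * exp (- (Re v * T \<omega>))"
        using T0 by (simp add: norm_mult)
      also have "\<dots> \<le> T \<omega> * exp (- (r * T \<omega>))"
        using T0 bl[OF v] by (intro mult_left_mono) (auto intro: mult_right_mono)
      \<comment> \<open>The inequality y <= exp y at y = r T.\<close>
      also have "\<dots> \<le> 1 / r"
      proof -
        have "r * T \<omega> \<le> exp (r * T \<omega>)" using exp_ge_add_one_self[of "r * T \<omega>"] by linarith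
        then show ?thesis using r by (simp add: exp_minus field_simps)
      qed
      finally show "norm (- complex_of_real (T \<omega>) * exp (- (v * complex_of_real (T \<omega>)))) \<le> 1 / r" .
    qed
    show "AE \<omega> in M. ((\<lambda>w. exp (- (w * complex_of_real (T \<omega>)))) has_field_derivative - complex_of_real (T \<omega>) * exp (- (w * complex_of_real (T \<omega>)))) (at w)"
      by (auto intro!: derivative_eq_intros)
    show "integrable M (\<lambda>\<omega>. exp (- (v * complex_of_real (T \<omega>))))" if "v \<in> ball w r" for v
      using bl[OF that] r by (intro integrable_laplace T pos) auto
  qed auto
  then show "(\<lambda>w. \<integral>\<omega>. exp (- (w * complex_of_real (T \<omega>))) \<partial>M) field_differentiable at w within {w. 0 < Re w}"
    using field_differentiable_at_within field_differentiable_def by blast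
qed

lemma continuous_laplace:
  assumes T[measurable]: "T \<in> borel_measurable M" and pos: "AE \<omega> in M. 0 \<le> T \<omega>"
  shows "continuous_on {w. 0 \<le> Re w} (\<lambda>w. \<integral>\<omega>. exp (- (w * complex_of_real (T \<omega>))) \<partial>M)"
  unfolding continuous_on_sequentially
proof (intro allI ballI impI)
  fix x a assume a: "a \<in> {w. 0 \<le> Re w}" and x: "(\<forall>n. x n \<in> {w. 0 \<le> Re w}) \<and> x \<longlonglongrightarrow> a"
  show "((\<lambda>w. \<integral>\<omega>. exp (- (w * complex_of_real (T \<omega>))) \<partial>M) \<circ> x) \<longlonglongrightarrow> (\<integral>\<omega>. exp (- (a * complex_of_real (T \<omega>))) \<partial>M)"
    unfolding comp_def
  proof (rule integral_dominated_convergence[where w="\<lambda>_. 1"])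
    show "AE \<omega> in M. norm (exp (- (x n * complex_of_real (T \<omega>)))) \<le> 1" for n
      using pos by eventually_elim (use x in auto)
  qed (use x in \<open>auto intro!: tendsto_intros\<close>)
qed

text \<open>The identity theorem settles the open half-plane; a point on the boundary is approached
  by \<open>w + 1 / Suc n\<close> and both sides are continuous there. The boundary matters because
  characteristic functions of positive variables are Laplace transforms on the imaginary
  axis.\<close>

lemma laplace_extension:
  assumes T: "T \<in> borel_measurable M" "AE \<omega> in M. 0 \<le> T \<omega>"
    and h: "h holomorphic_on {w. 0 < Re w}" "continuous_on {w. 0 \<le> Re w} h"
    and eq: "\<And>s. 0 < s \<Longrightarrow> complex_of_real (\<integral>\<omega>. exp (- (s * T \<omega>)) \<partial>M) = h (of_real s)"
    and w: "0 \<le> Re w"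
  shows "(\<integral>\<omega>. exp (- (w * complex_of_real (T \<omega>))) \<partial>M) = h w"
proof -
  let ?L = "\<lambda>w. \<integral>\<omega>. exp (- (w * complex_of_real (T \<omega>))) \<partial>M"
  have eq': "?L (of_real s) = h (of_real s)" if "0 < s" for s
  proof -
    have "?L (of_real s) = (\<integral>\<omega>. complex_of_real (exp (- (s * T \<omega>))) \<partial>M)"
      by (rule Bochner_Integration.integral_cong) (simp_all flip: exp_of_real)
    also have "\<dots> = complex_of_real (\<integral>\<omega>. exp (- (s * T \<omega>)) \<partial>M)"
      by (rule integral_complex_of_real)
    finally show ?thesis using eq[OF that] by simp
  qed
  have in1: "?L v = h v" if "0 < Re v" for v
    by (rule holomorphic_eq_on_right_half_plane[OF holomorphic_laplace[OF T] h(1) eq' that])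
  let ?x = "\<lambda>n. w + of_real (inverse (real (Suc n)))"
  have x: "?x \<longlonglongrightarrow> w"
    using tendsto_add[OF tendsto_const tendsto_of_real[OF LIMSEQ_inverse_real_of_nat], of w] by simp
  have xp: "0 < Re (?x n)" for n
    using w by (simp add: add_nonneg_pos)
  have 1: "(\<lambda>n. ?L (?x n)) \<longlonglongrightarrow> ?L w"
    by (rule continuous_on_tendsto_compose[OF continuous_laplace[OF T] x]) (use w xp in \<open>auto intro: less_imp_le\<close>)
  have 2: "(\<lambda>n. h (?x n)) \<longlonglongrightarrow> h w"
    by (rule continuous_on_tendsto_compose[OF h(2) x]) (use w xp in \<open>auto intro: less_imp_le\<close>)
  show ?thesis
    using 1 2 unfolding in1[OF xp] by (rule LIMSEQ_unique)
qed

end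

section \<open>Bounds for the principal logarithm at points of real part at least 1\<close>

lemma one_plus_not_nonpos: "0 \<le> Re w \<Longrightarrow> 1 + w \<notin> \<real>\<^sub>\<le>\<^sub>0"
  by (auto simp: complex_nonpos_Reals_iff)

lemma cmod_one_plus_ge: "0 \<le> Re w \<Longrightarrow> 1 \<le> cmod (1 + w)"
  using abs_Re_le_cmod[of "1 + w"] by simp

text \<open>Taylor expansion at 0 on the convex half-plane Re v >= 0. There |1 + v| >= 1, so the
  first two derivatives of Ln (1 + v) are bounded by 1.\<close>

lemma
  assumes w: "0 \<le> Re w"
  shows norm_Ln_one_plus_le: "norm (Ln (1 + w)) \<le> norm w"
    and norm_Ln_one_plus_minus_le: "norm (Ln (1 + w) - w) \<le> norm w ^ 2"
proof -
  let ?S = "{w. 0 \<le> Re w}"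
  have cv: "convex ?S" by (rule convex_halfspace_Re_ge)
  have nz: "1 + v \<noteq> 0" if "v \<in> ?S" for v :: complex
    using cmod_one_plus_ge[of v] that by auto
  let ?f = "\<lambda>i v. if i = 0 then Ln (1 + v) else if i = 1 then 1 / (1 + v) else - (1 / (1 + v) ^ 2)"
  have d: "(?f i has_field_derivative ?f (Suc i) v) (at v within ?S)" if "v \<in> ?S" "i \<le> 1" for i v
  proof (cases "i = 0")
    case True
    then show ?thesis using that one_plus_not_nonpos[of v]
      by (auto intro!: derivative_eq_intros simp: inverse_eq_divide)
  next
    case False
    then have "i = 1" using that by auto
    then show ?thesis using that nz[of v]
      by (auto intro!: derivative_eq_intros simp: power2_eq_square divide_simps)
  qed
  have b1: "norm (?f (Suc 0) v) \<le> 1" and b2: "norm (?f (Suc 1) v) \<le> 1" if "v \<in> ?S" for v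
    using cmod_one_plus_ge[of v] that by (auto simp: norm_divide norm_power divide_le_eq intro!: one_le_power)
  show "norm (Ln (1 + w)) \<le> norm w"
    using field_Taylor[of ?S 0 ?f 1 0 w, OF cv d b1] w by simp
  show "norm (Ln (1 + w) - w) \<le> norm w ^ 2"
    using field_Taylor[of ?S 1 ?f 1 0 w, OF cv d b2] w by (simp add: power2_eq_square)
qed

text \<open>Replaces the bound |w| / x for small x, where 1 / x need not be integrable: the real
  part of the logarithm grows only like |ln x| and the imaginary part is at most pi.\<close>

lemma norm_Ln_one_plus_divide_le:
  assumes w: "0 \<le> Re w" and x: "0 < x" "x \<le> 1" and R: "norm w \<le> R"
  shows "norm (Ln (1 + w / of_real x)) \<le> ln (1 + R) + \<bar>ln x\<bar> + pi"
proof -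
  let ?u = "1 + w / complex_of_real x"
  have u1: "1 \<le> norm ?u" using w x by (intro cmod_one_plus_ge) simp
  then have "norm (Ln ?u) \<le> \<bar>ln (norm ?u)\<bar> + \<bar>Im (Ln ?u)\<bar>"
    using cmod_le[of "Ln ?u"] by (subst (asm) Re_Ln) auto
  also have "\<bar>Im (Ln ?u)\<bar> \<le> pi"
  proof -
    have "?u \<noteq> 0" using u1 by auto
    then show ?thesis using mpi_less_Im_Ln[of ?u] Im_Ln_le_pi[of ?u] by linarith
  qed
  also have "\<bar>ln (norm ?u)\<bar> = ln (norm ?u)" using u1 by simp
  also have "ln (norm ?u) \<le> ln ((1 + R) / x)"
  proof (rule ln_mono)
    have "norm ?u \<le> 1 + norm w / x"
      using norm_triangle_ineq[of 1 "w / of_real x"] x by (simp add: norm_divide)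
    also have "\<dots> \<le> (1 + R) / x" using x R by (simp add: divide_simps)
    finally show "norm ?u \<le> (1 + R) / x" .
  qed (use u1 in auto)
  also have "ln ((1 + R) / x) = ln (1 + R) + \<bar>ln x\<bar>"
    using x R norm_ge_zero[of w] by (subst ln_div) (auto simp del: norm_ge_zero)
  finally show ?thesis by simp
qed

section \<open>Integrability against a Thorin measure and the Laplace exponent of T\<close>

lemma thorin_measureD:
  assumes "thorin_measure \<rho>"
  shows thorin_sets: "sets \<rho> = sets borel"
    and thorin_AE_pos: "AE x in \<rho>. 0 < x"
    and thorin_finite: "emeasure \<rho> {0<..1} < \<infinity>"
    and thorin_ln: "(\<integral>\<^sup>+x\<in>{0<..1}. ennreal \<bar>ln x\<bar> \<partial>\<rho>) < \<infinity>"
    and thorin_inverse: "(\<integral>\<^sup>+x\<in>{1..}. ennreal (1 / x) \<partial>\<rho>) < \<infinity>"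
proof -
  show s[measurable_cong, simp]: "sets \<rho> = sets borel" using assms by (simp add: thorin_measure_def)
  have "{..0} \<in> null_sets \<rho>" using assms by (auto simp: thorin_measure_def null_sets_def)
  then show "AE x in \<rho>. 0 < x" using AE_not_in by fastforce
  show l: "(\<integral>\<^sup>+x\<in>{0<..1}. ennreal \<bar>ln x\<bar> \<partial>\<rho>) < \<infinity>" and "(\<integral>\<^sup>+x\<in>{1..}. ennreal (1 / x) \<partial>\<rho>) < \<infinity>"
    using assms by (auto simp: thorin_measure_def)
  \<comment> \<open>The weight |ln x| vanishes at 1, so it bounds the mass only away from 1, here by
    |ln x| >= ln 2; the interval from 1/2 to 1 is compact.\<close>
  have "emeasure \<rho> {0<..1/2} = (\<integral>\<^sup>+x. indicator {0<..1/2} x \<partial>\<rho>)" by simp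
  also have "\<dots> \<le> (\<integral>\<^sup>+x. ennreal (1 / ln 2) * (ennreal \<bar>ln x\<bar> * indicator {0<..1} x) \<partial>\<rho>)"
  proof (rule nn_integral_mono)
    fix x :: real
    show "indicator {0<..1/2} x \<le> ennreal (1 / ln 2) * (ennreal \<bar>ln x\<bar> * indicator {0<..1} x)"
    proof (cases "x \<in> {0<..1/2}")
      case True
      then have "ln x \<le> ln (1/2)" by (intro ln_mono) auto
      then have "ln 2 \<le> \<bar>ln x\<bar>" using True by (simp add: ln_div)
      moreover have "0 < ln (2::real)" by simp
      ultimately have "1 \<le> \<bar>ln x\<bar> / ln 2" by (simp only: le_divide_eq_1_pos)
      then have "1 \<le> 1 / ln 2 * \<bar>ln x\<bar>" by (simp only: times_divide_eq_left mult_1)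
      then have "ennreal 1 \<le> ennreal (1 / ln 2 * \<bar>ln x\<bar>)" by (rule ennreal_leI)
      also have "\<dots> = ennreal (1 / ln 2) * ennreal \<bar>ln x\<bar>" by (rule ennreal_mult) auto
      finally show ?thesis using True by simp
    qed simp
  qed
  also have "\<dots> = ennreal (1 / ln 2) * (\<integral>\<^sup>+x\<in>{0<..1}. ennreal \<bar>ln x\<bar> \<partial>\<rho>)"
    by (rule nn_integral_cmult) measurable
  also have "\<dots> < \<infinity>" using l by (simp add: ennreal_mult_less_top)
  finally have 1: "emeasure \<rho> {0<..1/2} < \<infinity>" .
  have "compact {1/2..1::real}" "{1/2..1::real} \<subseteq> {0<..}" by auto
  then have 2: "emeasure \<rho> {1/2..1} < \<infinity>" using assms unfolding thorin_measure_def by blast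
  have "emeasure \<rho> {0<..1} \<le> emeasure \<rho> ({0<..1/2} \<union> {1/2..1})"
    by (rule emeasure_mono) auto
  also have "\<dots> \<le> emeasure \<rho> {0<..1/2} + emeasure \<rho> {1/2..1}"
    by (rule emeasure_subadditive) auto
  also have "\<dots> < \<infinity>" using 1 2 by simp
  finally show "emeasure \<rho> {0<..1} < \<infinity>" .
qed

text \<open>A common majorant, split at 1 exactly as the two integrability conditions on a Thorin
  measure.\<close>

abbreviation thorin_dominator :: "real \<Rightarrow> real \<Rightarrow> real" where
  "thorin_dominator R x \<equiv> if x \<le> 1 then R + \<bar>ln x\<bar> else R / x"

lemma integrable_thorin_dominator:
  assumes \<rho>: "thorin_measure \<rho>" and R: "0 \<le> R"
  shows "integrable \<rho> (\<lambda>x. thorin_dominator R x)"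
proof (rule integrableI_bounded)
  note [measurable_cong] = thorin_sets[OF \<rho>]
  show "(\<lambda>x. thorin_dominator R x) \<in> borel_measurable \<rho>" by measurable
  have "(\<integral>\<^sup>+x. norm (thorin_dominator R x) \<partial>\<rho>) \<le>
     (\<integral>\<^sup>+x. ennreal R * indicator {0<..1} x + ennreal \<bar>ln x\<bar> * indicator {0<..1} x + ennreal R * (ennreal (1 / x) * indicator {1..} x) \<partial>\<rho>)"
  proof (rule nn_integral_mono_AE)
    show "AE x in \<rho>. ennreal (norm (thorin_dominator R x)) \<le>
      ennreal R * indicator {0<..1} x + ennreal \<bar>ln x\<bar> * indicator {0<..1} x + ennreal R * (ennreal (1 / x) * indicator {1..} x)"
      using thorin_AE_pos[OF \<rho>]
    proof eventually_elim
      case (elim x)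
      moreover have "\<bar>R - ln x\<bar> = R - ln x" if "x \<le> 1" 
      proof -
        have "ln x \<le> 0" using that elim by simp
        then show ?thesis using R by linarith
      qed
      ultimately show ?case using R
        by (cases "x \<le> 1") (auto simp: ennreal_plus[symmetric] ennreal_mult[symmetric] indicator_def simp del: ennreal_plus)
    qed
  qed
  also have "\<dots> = ennreal R * emeasure \<rho> {0<..1} + (\<integral>\<^sup>+x\<in>{0<..1}. ennreal \<bar>ln x\<bar> \<partial>\<rho>) + ennreal R * (\<integral>\<^sup>+x\<in>{1..}. ennreal (1 / x) \<partial>\<rho>)"
    by (simp add: nn_integral_add nn_integral_cmult nn_integral_cmult_indicator)
  also have "\<dots> < \<infinity>"
    using thorin_finite[OF \<rho>] thorin_ln[OF \<rho>] thorin_inverse[OF \<rho>] by (simp add: ennreal_mult_less_top)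
  finally show "(\<integral>\<^sup>+x. norm (thorin_dominator R x) \<partial>\<rho>) < \<infinity>" .
qed

text \<open>The constant is the sum of those of the two regimes: ln (1 + R) + pi for x <= 1 and R
  from the linear bound for x > 1. Being uniform in |w| <= R, the bound also serves for limits in
  w.\<close>

lemma norm_Ln_one_plus_divide_le_dominator:
  assumes w: "0 \<le> Re w" "norm w \<le> R" and x: "0 < x"
  shows "norm (Ln (1 + w / of_real x)) \<le>
    thorin_dominator (ln (1 + R) + pi + R) x"
proof -
  have R: "0 \<le> R" using w norm_ge_zero[of w] by linarith
  then have l: "0 \<le> ln (1 + R)" by simp
  show ?thesis
  proof (cases "x \<le> 1")
    case True
    then show ?thesis using norm_Ln_one_plus_divide_le[OF w(1) x True w(2)] R by simp
  next
    case False
    have "norm (Ln (1 + w / of_real x)) \<le> norm (w / of_real x)"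
      using w x by (intro norm_Ln_one_plus_le) simp
    also have "\<dots> = norm w / x" using x by (simp add: norm_divide)
    also have "\<dots> \<le> (ln (1 + R) + pi + R) / x"
      using w l x pi_gt_zero by (intro divide_right_mono) linarith+
    finally show ?thesis using False by simp
  qed
qed

text \<open>The driftless part of the Laplace exponent of T, a Thorin-Bernstein function, continued
  to complex arguments by the principal logarithm.\<close>

definition thorin_exponent :: "real measure \<Rightarrow> complex \<Rightarrow> complex" where
  "thorin_exponent \<rho> w = (\<integral>x. Ln (1 + w / of_real x) \<partial>\<rho>)"

lemma integrable_thorin_exponent:
  assumes \<rho>: "thorin_measure \<rho>" and w: "0 \<le> Re w"
  shows "integrable \<rho> (\<lambda>x. Ln (1 + w / of_real x))"
proof (rule Bochner_Integration.integrable_bound[OF integrable_thorin_dominator[OF \<rho>, of "ln (1 + norm w) + pi + norm w"]])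
  note [measurable_cong] = thorin_sets[OF \<rho>]
  show "(\<lambda>x. Ln (1 + w / of_real x)) \<in> borel_measurable \<rho>" by measurable
  show "AE x in \<rho>. norm (Ln (1 + w / of_real x)) \<le> norm (thorin_dominator (ln (1 + norm w) + pi + norm w) x)"
    using thorin_AE_pos[OF \<rho>]
  proof eventually_elim
    case (elim x)
    show ?case using norm_Ln_one_plus_divide_le_dominator[OF w order_refl elim] by (rule order_trans) simp
  qed
qed simp

lemma continuous_thorin_exponent:
  assumes \<rho>: "thorin_measure \<rho>"
  shows "continuous_on {w. 0 \<le> Re w} (thorin_exponent \<rho>)"
  unfolding continuous_on_sequentially
proof (intro allI ballI impI)
  fix x a assume a: "a \<in> {w. 0 \<le> Re w}" and x: "(\<forall>n. x n \<in> {w. 0 \<le> Re w}) \<and> x \<longlonglongrightarrow> a"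
  note [measurable_cong] = thorin_sets[OF \<rho>]
  obtain R where R: "\<And>n. norm (x n) \<le> R"
    using x convergent_imp_Bseq[of x] by (auto simp: convergent_def Bseq_def)
  then have R0: "0 \<le> R" using norm_ge_zero order_trans by blast
  show "(thorin_exponent \<rho> \<circ> x) \<longlonglongrightarrow> thorin_exponent \<rho> a"
    unfolding comp_def thorin_exponent_def
  proof (rule integral_dominated_convergence[OF _ _ integrable_thorin_dominator[OF \<rho>, of "ln (1 + R) + pi + R"]])
    show "AE y in \<rho>. norm (Ln (1 + x n / of_real y)) \<le> thorin_dominator (ln (1 + R) + pi + R) y" for n
      using thorin_AE_pos[OF \<rho>]
      by eventually_elim (rule norm_Ln_one_plus_divide_le_dominator, use x R in auto)
    show "AE y in \<rho>. (\<lambda>n. Ln (1 + x n / of_real y)) \<longlonglongrightarrow> Ln (1 + a / of_real y)"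
      using thorin_AE_pos[OF \<rho>]
    proof eventually_elim
      case (elim y)
      then show ?case
        using x a by (intro tendsto_intros one_plus_not_nonpos) auto
    qed
  qed (use R0 in auto)
qed

lemma holomorphic_thorin_exponent:
  assumes \<rho>: "thorin_measure \<rho>"
  shows "thorin_exponent \<rho> holomorphic_on {w. 0 < Re w}"
proof (rule holomorphic_onI)
  note [measurable_cong] = thorin_sets[OF \<rho>]
  fix w :: complex assume "w \<in> {w. 0 < Re w}"
  then have w: "0 < Re w" by simp
  define r where "r = Re w / 2"
  have r: "0 < r" using w by (simp add: r_def)
  have bl: "r < Re v" if "v \<in> ball w r" for v
    using that abs_Re_le_cmod[of "w - v"] by (auto simp: dist_norm r_def)
  have dv: "((\<lambda>v. Ln (1 + v / complex_of_real x)) has_field_derivative 1 / (of_real x + v)) (at v)" 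
    if "0 < x" "v \<in> ball w r" for x v
  proof -
    have "1 + v / complex_of_real x \<noteq> 0"
      using one_plus_not_nonpos[of "v / of_real x"] that bl[of v] r by auto
    then show ?thesis
      using that bl[of v] r one_plus_not_nonpos[of "v / of_real x"]
      by (auto intro!: derivative_eq_intros simp: field_simps)
  qed
  have "((\<lambda>w. \<integral>x. Ln (1 + w / of_real x) \<partial>\<rho>) has_field_derivative (\<integral>x. 1 / (of_real x + w) \<partial>\<rho>)) (at w)"
  proof (rule has_field_derivative_lebesgue_integral[OF r _ _ integrable_thorin_dominator[OF \<rho>, of "1 / r + 1"]])
    show "AE x in \<rho>. \<forall>v\<in>ball w r. \<exists>d. ((\<lambda>v. Ln (1 + v / complex_of_real x)) has_field_derivative d) (at v) \<and>
        norm d \<le> thorin_dominator (1 / r + 1) x"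
      using thorin_AE_pos[OF \<rho>]
    proof (eventually_elim, intro ballI exI conjI)
      fix x v assume x: "0 < (x::real)" and v: "v \<in> ball w r"
      show "((\<lambda>v. Ln (1 + v / complex_of_real x)) has_field_derivative 1 / (of_real x + v)) (at v)"
        by (rule dv[OF x v])
      have "x + r \<le> norm (complex_of_real x + v)"
        using abs_Re_le_cmod[of "complex_of_real x + v"] bl[OF v] by simp
      then have "norm (1 / (complex_of_real x + v)) \<le> 1 / (x + r)"
        using x r by (auto simp: norm_divide intro!: divide_left_mono mult_pos_pos)
      \<comment> \<open>The derivative is at most 1 / r for small x and at most 1 / x for large x;
        the constant 1 / r + 1 covers both.\<close>
      also have "\<dots> \<le> thorin_dominator (1 / r + 1) x"
      proof (cases "x \<le> 1")
        case True
        have "1 / (x + r) \<le> 1 / r" using x r by (simp add: frac_le)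
        then show ?thesis using True by simp
      next
        case False
        have "1 / (x + r) \<le> 1 / x" using x r by (simp add: frac_le)
        also have "\<dots> \<le> (1 / r + 1) / x" using x r by (intro divide_right_mono) auto
        finally show ?thesis using False by simp
      qed
      finally show "norm (1 / (complex_of_real x + v)) \<le> thorin_dominator (1 / r + 1) x" .
    qed
    show "AE x in \<rho>. ((\<lambda>w. Ln (1 + w / complex_of_real x)) has_field_derivative 1 / (complex_of_real x + w)) (at w)"
      using thorin_AE_pos[OF \<rho>] by eventually_elim (rule dv, use r in auto)
    show "integrable \<rho> (\<lambda>x. Ln (1 + v / complex_of_real x))" if "v \<in> ball w r" for v
      using bl[OF that] r by (intro integrable_thorin_exponent[OF \<rho>]) auto
  qed (use r in auto)
  then show "thorin_exponent \<rho> field_differentiable at w within {w. 0 < Re w}"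
    unfolding thorin_exponent_def[abs_def]
    using field_differentiable_at_within field_differentiable_def by blast
qed

lemma thorin_exponent_of_real:
  assumes \<rho>: "thorin_measure \<rho>" and s: "0 \<le> s"
  shows "thorin_exponent \<rho> (of_real s) = - complex_of_real (LINT x|\<rho>. ln (x / (x + s)))"
proof -
  note [measurable_cong] = thorin_sets[OF \<rho>]
  have "thorin_exponent \<rho> (of_real s) = (\<integral>x. complex_of_real (- ln (x / (x + s))) \<partial>\<rho>)"
    unfolding thorin_exponent_def
  proof (rule integral_cong_AE)
    show "AE x in \<rho>. Ln (1 + complex_of_real s / complex_of_real x) = complex_of_real (- ln (x / (x + s)))"
      using thorin_AE_pos[OF \<rho>]
    proof eventually_elim
      case (elim x)
      have "1 + complex_of_real s / complex_of_real x = of_real ((x + s) / x)" 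
        using elim by (simp add: field_simps)
      moreover have "- ln (x / (x + s)) = ln ((x + s) / x)" using elim s by (simp add: ln_div)
      moreover have "0 < (x + s) / x" using elim s by simp
      ultimately show ?case by (simp only: Ln_of_real)
    qed
  qed measurable
  also have "\<dots> = complex_of_real (LINT x|\<rho>. - ln (x / (x + s)))" by (rule integral_complex_of_real)
  finally show ?thesis by simp
qed

lemma thorin_subordinator_laplace:
  assumes T: "thorin_subordinator M T a \<rho>" and w: "0 \<le> Re w"
  shows "(\<integral>\<omega>. exp (- (w * complex_of_real (T 1 \<omega>))) \<partial>M) = exp (- (of_real a * w) - thorin_exponent \<rho> w)"
proof -
  have levy: "levy_process M T" and mono: "AE \<omega> in M. mono_on {0..} (\<lambda>t. T t \<omega>)" and \<rho>: "thorin_measure \<rho>"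
    and lap: "\<And>s. 0 \<le> s \<Longrightarrow> (LINT \<omega>|M. exp (- s * T 1 \<omega>)) = exp (- a * s + (LINT x|\<rho>. ln (x / (x + s))))"
    using T by (auto simp: thorin_subordinator_def)
  interpret prob_space M using levy by (simp add: levy_process_def)
  have T1: "T 1 \<in> borel_measurable M" and T0: "AE \<omega> in M. T 0 \<omega> = 0"
    using levy by (auto simp: levy_process_def)
  have pos: "AE \<omega> in M. 0 \<le> T 1 \<omega>"
    using mono T0
  proof eventually_elim
    case (elim \<omega>)
    then show ?case using mono_onD[OF elim(1), of 0 1] by simp
  qed
  show ?thesis
  proof (rule laplace_extension[OF T1 pos, of "\<lambda>w. exp (- (of_real a * w) - thorin_exponent \<rho> w)"])
    show "complex_of_real (\<integral>\<omega>. exp (- (s * T 1 \<omega>)) \<partial>M) = exp (- (of_real a * of_real s) - thorin_exponent \<rho> (of_real s))"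
      if "0 < s" for s
      using lap[of s] that by (simp add: thorin_exponent_of_real[OF \<rho>] exp_of_real[symmetric])
  qed (use w in \<open>auto intro!: holomorphic_intros continuous_intros holomorphic_thorin_exponent[OF \<rho>] continuous_thorin_exponent[OF \<rho>]\<close>)
qed

section \<open>Gamma distributions and their Laplace transforms\<close>

lemma nn_integral_gamma_density_1:
  assumes "0 < k"
  shows "(\<integral>\<^sup>+v. ennreal (gamma_density k 1 v) \<partial>lborel) = 1"
proof -
  have "((\<lambda>t. t powr (k - 1) / exp t) has_integral Gamma k) {0..}"
    by (rule Gamma_integral_real[OF assms])
  then have "((\<lambda>t. 1 / Gamma k * (t powr (k - 1) / exp t)) has_integral 1 / Gamma k * Gamma k) {0..}"
    by (rule has_integral_mult_right)
  then have "((\<lambda>t. 1 / Gamma k * (t powr (k - 1) / exp t)) has_integral 1) {0..}"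
    using Gamma_real_pos[OF assms] by simp
  then have "(gamma_density k 1 has_integral 1) {0..}"
    by (rule has_integral_spike[OF negligible_sing[of 0], rotated]) (auto simp: gamma_density_def exp_minus field_simps)
  then have "((\<lambda>x. if x \<in> {0..} then gamma_density k 1 x else 0) has_integral 1) UNIV"
    by (simp only: has_integral_restrict_UNIV)
  then have hi: "(gamma_density k 1 has_integral 1) UNIV"
    by (rule has_integral_eq[rotated]) (auto simp: gamma_density_def)
  have [measurable]: "gamma_density k 1 \<in> borel_measurable borel" unfolding gamma_density_def[abs_def] by measurable
  have "(\<integral>\<^sup>+v. ennreal (gamma_density k 1 v) \<partial>lborel) = ennreal 1"
    by (rule nn_integral_has_integral_lborel[OF _ _ hi])
       (use Gamma_real_pos[OF assms] in \<open>auto simp: gamma_density_def\<close>)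
  then show ?thesis by simp
qed

lemma gamma_density_measurable[measurable]: "gamma_density k l \<in> borel_measurable borel"
  unfolding gamma_density_def[abs_def] by measurable

lemma gamma_density_nonneg: "0 < k \<Longrightarrow> 0 \<le> gamma_density k l v"
  using Gamma_real_pos[of k] by (simp add: gamma_density_def)

lemma nn_integral_gamma_density:
  assumes "0 < k" "0 < l"
  shows "(\<integral>\<^sup>+v. ennreal (gamma_density k l v) \<partial>lborel) = 1"
proof -
  have "gamma_density k l v = l * gamma_density k 1 (l * v)" for v
    using assms by (auto simp: gamma_density_def zero_less_mult_iff powr_mult powr_diff field_simps)
  then have "(\<integral>\<^sup>+v. ennreal (gamma_density k l v) \<partial>lborel) = (\<integral>\<^sup>+v. ennreal l * ennreal (gamma_density k 1 (0 + l * v)) \<partial>lborel)"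
    using assms by (simp add: ennreal_mult')
  also have "\<dots> = ennreal \<bar>l\<bar> * (\<integral>\<^sup>+v. ennreal (gamma_density k 1 (0 + l * v)) \<partial>lborel)"
    using assms by (subst nn_integral_cmult) auto
  also have "\<dots> = (\<integral>\<^sup>+v. ennreal (gamma_density k 1 v) \<partial>lborel)"
    using assms by (subst nn_integral_real_affine[of _ l 0]) auto
  finally show ?thesis using nn_integral_gamma_density_1 assms by simp
qed

lemma prob_space_gamma: 
  assumes "0 < k" "0 < l"
  shows "prob_space (density lborel (\<lambda>v. ennreal (gamma_density k l v)))"
  using nn_integral_gamma_density[OF assms] by (intro prob_spaceI) (simp add: emeasure_density)

lemma gamma_laplace:
  assumes k: "0 < k" and l: "0 < l" and w: "0 \<le> Re w"
  shows "(\<integral>v. exp (- (w * complex_of_real v)) \<partial>density lborel (\<lambda>v. ennreal (gamma_density k l v))) =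
    exp (- of_real k * Ln (1 + w / of_real l))"
proof -
  let ?D = "density lborel (\<lambda>v. ennreal (gamma_density k l v))"
  interpret prob_space ?D by (rule prob_space_gamma[OF k l])
  show ?thesis
  proof (rule laplace_extension[of "\<lambda>v. v" "\<lambda>w. exp (- of_real k * Ln (1 + w / of_real l))"])
    show "AE v in ?D. 0 \<le> v"
      by (subst AE_density) (auto simp: gamma_density_def)
    have nz: "1 + w / complex_of_real l \<notin> \<real>\<^sub>\<le>\<^sub>0" if "0 \<le> Re w" for w
      using that l by (intro one_plus_not_nonpos) auto
    show "(\<lambda>w. exp (- of_real k * Ln (1 + w / of_real l))) holomorphic_on {w. 0 < Re w}"
      by (intro holomorphic_intros nz) (use l in auto)
    show "continuous_on {w. 0 \<le> Re w} (\<lambda>w. exp (- of_real k * Ln (1 + w / of_real l)))"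
      by (intro continuous_intros nz) (use l in auto)
    fix s :: real assume s: "0 < s"
    \<comment> \<open>Exponential tilting turns the gamma density of rate l into that of rate l + s,
      up to the factor which is the Laplace transform.\<close>
    have e: "exp (- (s * v)) * gamma_density k l v = (l / (l + s)) powr k * gamma_density k (l + s) v" for v
    proof -
      have 1: "exp (- (s * v)) * exp (- (l * v)) = exp (- ((l + s) * v))"
        by (simp add: exp_add[symmetric] algebra_simps)
      have 2: "(l / (l + s)) powr k * (l + s) powr k = l powr k"
        using l s by (simp add: powr_divide)
      show ?thesis
      proof (cases "0 < v")
        case True
        then have "exp (- (s * v)) * gamma_density k l v =
            l powr k / Gamma k * v powr (k - 1) * (exp (- (s * v)) * exp (- (l * v)))"
          by (simp add: gamma_density_def)
        also have "\<dots> = (l / (l + s)) powr k * gamma_density k (l + s) v"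
          unfolding 1 2[symmetric] using True by (simp add: gamma_density_def left_diff_distrib distrib_right)
        finally show ?thesis .
      qed (simp add: gamma_density_def)
    qed
    have "(\<integral>v. exp (- (s * v)) \<partial>?D) = enn2real (\<integral>\<^sup>+v. ennreal (exp (- (s * v))) \<partial>?D)"
      by (rule integral_eq_nn_integral) auto
    also have "(\<integral>\<^sup>+v. ennreal (exp (- (s * v))) \<partial>?D) = (\<integral>\<^sup>+v. ennreal ((l / (l + s)) powr k) * ennreal (gamma_density k (l + s) v) \<partial>lborel)"
    proof -
      have "ennreal (gamma_density k l v) * ennreal (exp (- (s * v))) = ennreal ((l / (l + s)) powr k) * ennreal (gamma_density k (l + s) v)" for v
        using e[of v] gamma_density_nonneg[OF k] by (simp add: ennreal_mult'[symmetric] ennreal_mult''[symmetric] mult.commute)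
      then show ?thesis by (subst nn_integral_density) auto
    qed
    also have "\<dots> = ennreal ((l / (l + s)) powr k)"
      using nn_integral_gamma_density[OF k, of "l + s"] l s by (subst nn_integral_cmult) auto
    finally have "(\<integral>v. exp (- (s * v)) \<partial>?D) = (l / (l + s)) powr k" by simp
    also have "\<dots> = exp (- k * ln (1 + s / l))"
      using l s by (simp add: powr_def ln_div field_simps)
    finally show "complex_of_real (\<integral>v. exp (- (s * v)) \<partial>?D) = exp (- of_real k * Ln (1 + of_real s / of_real l))"
      using l s by (simp add: exp_of_real[symmetric] Ln_of_real[symmetric] add_pos_pos)
  qed (use w in auto)
qed

lemma char_scaled_gamma:
  assumes "0 < k" "0 < l"
  shows "char (distr (density lborel (\<lambda>v. ennreal (gamma_density k l v))) borel (\<lambda>v. v * x)) z =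
    exp (- of_real k * Ln (1 - \<i> * of_real (z * x) / of_real l))"
proof -
  have "char (distr (density lborel (\<lambda>v. ennreal (gamma_density k l v))) borel (\<lambda>v. v * x)) z =
     (\<integral>v. exp (- ((- \<i> * of_real (z * x)) * complex_of_real v)) \<partial>density lborel (\<lambda>v. ennreal (gamma_density k l v)))"
    unfolding char_def by (subst integral_distr) (auto simp: mult_ac)
  then show ?thesis using gamma_laplace[OF assms, of "- \<i> * of_real (z * x)"] by simp
qed

section \<open>Thorin measures\<close>

text \<open>One half of the integrability condition of a Thorin triplet. It is weaker at infinity
  than the condition for subordinators, as it has to hold for the images of \<rho> under square-root
  maps.\<close>

definition thorin_part :: "real measure \<Rightarrow> bool" where
  "thorin_part \<eta> \<longleftrightarrow> sets \<eta> = sets borel \<and> (AE x in \<eta>. 0 < x) \<and>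
    (\<integral>\<^sup>+x\<in>{0<..1}. ennreal (1 + \<bar>ln x\<bar>) \<partial>\<eta>) < \<infinity> \<and> (\<integral>\<^sup>+x\<in>{1<..}. ennreal (1 / x\<^sup>2) \<partial>\<eta>) < \<infinity>"

lemma thorin_partD:
  assumes "thorin_part \<eta>"
  shows "sets \<eta> = sets borel" "AE x in \<eta>. 0 < x"
    "(\<integral>\<^sup>+x\<in>{0<..1}. ennreal (1 + \<bar>ln x\<bar>) \<partial>\<eta>) < \<infinity>" "(\<integral>\<^sup>+x\<in>{1<..}. ennreal (1 / x\<^sup>2) \<partial>\<eta>) < \<infinity>"
  using assms by (auto simp: thorin_part_def)

text \<open>\<open>thorin_root \<sigma> \<theta>\<close> and \<open>thorin_root \<sigma> (- \<theta>)\<close> are the translates of \<open>f\<close> in the theorem; their values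
  at \<open>x\<close> are the moduli of the two roots of the quadratic polynomial in \<open>\<i> * z\<close> in
  \<open>thorin_root_factorization\<close> below.\<close>

definition thorin_root :: "real \<Rightarrow> real \<Rightarrow> real \<Rightarrow> real" where
  "thorin_root \<sigma> \<theta> x = (sqrt (\<theta>\<^sup>2 + 2 * \<sigma>\<^sup>2 * x) - \<theta>) / \<sigma>\<^sup>2"

lemma thorin_root_measurable[measurable]: "thorin_root \<sigma> \<theta> \<in> borel_measurable borel"
  unfolding thorin_root_def[abs_def] by measurable

section \<open>Growth of the two roots and their thresholds\<close>

context
  fixes \<sigma> \<theta> x :: real
  assumes \<sigma>: "0 < \<sigma>" and x: "0 < x"
begin

lemma sqrt_greater_abs: "\<bar>\<theta>\<bar> < sqrt (\<theta>\<^sup>2 + 2 * \<sigma>\<^sup>2 * x)"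
  using \<sigma> x by (intro real_less_rsqrt) simp

lemma thorin_root_pos: "0 < thorin_root \<sigma> \<theta> x" 
  using sqrt_greater_abs \<sigma> unfolding thorin_root_def by (intro divide_pos_pos) auto

lemma thorin_root_mult: "thorin_root \<sigma> \<theta> x * thorin_root \<sigma> (- \<theta>) x = 2 * x / \<sigma>\<^sup>2"
proof -
  have "(sqrt (\<theta>\<^sup>2 + 2 * \<sigma>\<^sup>2 * x) - \<theta>) * (sqrt (\<theta>\<^sup>2 + 2 * \<sigma>\<^sup>2 * x) + \<theta>) = (sqrt (\<theta>\<^sup>2 + 2 * \<sigma>\<^sup>2 * x))\<^sup>2 - \<theta>\<^sup>2"
    by (simp add: power2_eq_square algebra_simps)
  also have "\<dots> = 2 * \<sigma>\<^sup>2 * x" using x by simp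
  finally show ?thesis using \<sigma> by (simp add: thorin_root_def power2_eq_square field_simps)
qed

lemma thorin_root_diff: "thorin_root \<sigma> (- \<theta>) x - thorin_root \<sigma> \<theta> x = 2 * \<theta> / \<sigma>\<^sup>2"
  using \<sigma> by (simp add: thorin_root_def field_simps)

text \<open>Difference over product of the two roots. Positivity of the second root is a premise
  because \<theta> is fixed in this context, so that \<open>thorin_root_pos\<close> speaks of the
  first root only.\<close>

lemma inverse_thorin_root_diff: "1 / thorin_root \<sigma> \<theta> x - 1 / thorin_root \<sigma> (- \<theta>) x = \<theta> / x"
  if "0 < thorin_root \<sigma> (- \<theta>) x"
proof -
  have "1 / thorin_root \<sigma> \<theta> x - 1 / thorin_root \<sigma> (- \<theta>) x =
      (thorin_root \<sigma> (- \<theta>) x - thorin_root \<sigma> \<theta> x) / (thorin_root \<sigma> \<theta> x * thorin_root \<sigma> (- \<theta>) x)"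
    using thorin_root_pos that by (simp add: field_simps)
  then show ?thesis unfolding thorin_root_mult thorin_root_diff using \<sigma> by simp
qed

text \<open>The source of the thresholds \<sigma>^2/2 + \<theta> and \<sigma>^2/2 - \<theta> in the
  drift: the triplet compensates at |x| >= 1, which is pulled back to \<rho> here.\<close>

lemma thorin_root_ge_1_iff: "1 \<le> thorin_root \<sigma> \<theta> x \<longleftrightarrow> \<sigma>\<^sup>2 / 2 + \<theta> \<le> x"
proof -
  have "1 \<le> thorin_root \<sigma> \<theta> x \<longleftrightarrow> \<sigma>\<^sup>2 + \<theta> \<le> sqrt (\<theta>\<^sup>2 + 2 * \<sigma>\<^sup>2 * x)"
    using \<sigma> by (auto simp: thorin_root_def le_divide_eq)
  \<comment> \<open>Squaring needs a nonnegative left side. If \<sigma>^2 + \<theta> <= 0, the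
    comparison is true, and so is the claimed one, since then \<sigma>^2/2 + \<theta> < 0 <
    x.\<close>
  also have "\<dots> \<longleftrightarrow> \<sigma>\<^sup>2 + \<theta> \<le> 0 \<or> (\<sigma>\<^sup>2 + \<theta>)\<^sup>2 \<le> \<theta>\<^sup>2 + 2 * \<sigma>\<^sup>2 * x"
  proof -
    have "A \<le> sqrt B \<longleftrightarrow> A \<le> 0 \<or> A\<^sup>2 \<le> B" if "0 \<le> B" for A B :: real
    proof (cases "A \<le> 0")
      case True
      then show ?thesis using real_sqrt_ge_zero[OF that] by linarith
    next
      case False
      have "A\<^sup>2 \<le> B" if "A \<le> sqrt B"
        using power_mono[OF that, of 2] False \<open>0 \<le> B\<close> by simp
      then show ?thesis using False real_le_rsqrt[of A B] by blast
    qed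
    then show ?thesis using x by simp
  qed
  also have "(\<sigma>\<^sup>2 + \<theta>)\<^sup>2 \<le> \<theta>\<^sup>2 + 2 * \<sigma>\<^sup>2 * x \<longleftrightarrow> \<sigma>\<^sup>2 * (\<sigma>\<^sup>2 + 2 * \<theta>) \<le> \<sigma>\<^sup>2 * (2 * x)"
    by (simp add: power2_eq_square algebra_simps)
  also have "\<dots> \<longleftrightarrow> \<sigma>\<^sup>2 + 2 * \<theta> \<le> 2 * x" using \<sigma> by (subst mult_le_cancel_left_pos) auto
  finally show ?thesis using \<sigma> x by (auto simp: field_simps) (smt (verit) zero_less_power)
qed

text \<open>The difference sqrt(...) - \<theta> may cancel, so it is rationalized through the
  product of the roots into 2 x / (sqrt(...) + \<theta>), whose denominator is easy to bound. Near 0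
  the linear order is the right one when \<theta> > 0; at infinity the order is sqrt x.\<close>

lemma thorin_root_ge:
  "2 / (sqrt (\<theta>\<^sup>2 + 2 * \<sigma>\<^sup>2) + \<bar>\<theta>\<bar>) * (if x \<le> 1 then x else sqrt x) \<le> thorin_root \<sigma> \<theta> x"
proof -
  let ?s = "sqrt (\<theta>\<^sup>2 + 2 * \<sigma>\<^sup>2 * x)" and ?c = "sqrt (\<theta>\<^sup>2 + 2 * \<sigma>\<^sup>2) + \<bar>\<theta>\<bar>"
  have c: "0 < ?c" using \<sigma> by (intro add_pos_nonneg) (auto intro: add_nonneg_pos)
  have p: "0 < ?s + \<theta>" using sqrt_greater_abs by simp
  have "thorin_root \<sigma> \<theta> x = (2 * x / \<sigma>\<^sup>2) / thorin_root \<sigma> (- \<theta>) x"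
  proof -
    have "0 < thorin_root \<sigma> (- \<theta>) x" using p \<sigma> by (simp add: thorin_root_def)
    then show ?thesis unfolding thorin_root_mult[symmetric] by simp
  qed
  also have "\<dots> = 2 * x / (?s + \<theta>)"
    using \<sigma> p by (simp add: thorin_root_def)
  finally have e: "thorin_root \<sigma> \<theta> x = 2 * x / (?s + \<theta>)" .
  show ?thesis
  proof (cases "x \<le> 1")
    case True
    have "?s + \<theta> \<le> ?c"
      using \<sigma> True by (intro add_mono real_sqrt_le_mono) (auto intro!: mult_left_le)
    then show ?thesis using True x c p unfolding e by (simp add: frac_le)
  next
    case False
    have "?s \<le> sqrt ((\<theta>\<^sup>2 + 2 * \<sigma>\<^sup>2) * x)"
      using False by (intro real_sqrt_le_mono) (simp add: distrib_right mult_left_le[of 1 "\<theta>\<^sup>2", simplified] mult_le_cancel_left1)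
    then have "?s \<le> sqrt (\<theta>\<^sup>2 + 2 * \<sigma>\<^sup>2) * sqrt x" by (simp add: real_sqrt_mult)
    moreover have "\<theta> \<le> \<bar>\<theta>\<bar> * sqrt x"
      using False mult_left_mono[of 1 "sqrt x" "\<bar>\<theta>\<bar>"] by auto
    ultimately have "?s + \<theta> \<le> ?c * sqrt x" by (simp add: distrib_right)
    then have "2 * x / (?c * sqrt x) \<le> 2 * x / (?s + \<theta>)"
      using p c x by (intro divide_left_mono) auto
    moreover have "2 * x / (?c * sqrt x) = 2 / ?c * sqrt x"
    proof -
      have "2 * (r * r) / (C * r) = 2 / C * r" if "0 < r" "0 < C" for r C :: real
        using that by simp
      from this[of "sqrt x" ?c] show ?thesis using x c by simp
    qed
    ultimately show ?thesis using False e by simp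
  qed
qed

end

section \<open>The factorization of the Brownian exponent and the images of \<rho>\<close>

definition bm_exponent :: "real \<Rightarrow> real \<Rightarrow> real \<Rightarrow> complex" where
  "bm_exponent \<sigma> \<theta> z = of_real (\<sigma>\<^sup>2 * z\<^sup>2 / 2) - \<i> * of_real (\<theta> * z)"

lemma Re_bm_exponent: "0 \<le> Re (bm_exponent \<sigma> \<theta> z)"
  by (simp add: bm_exponent_def)

text \<open>Expanding the left side, only 1/p - 1/m = \<theta>/x and p m = 2 x / \<sigma>^2
  enter.\<close>

lemma thorin_root_factorization:
  assumes \<sigma>: "0 < \<sigma>" and x: "0 < x"
  shows "(1 - \<i> * of_real z / of_real (thorin_root \<sigma> \<theta> x)) * (1 + \<i> * of_real z / of_real (thorin_root \<sigma> (- \<theta>) x)) =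
    1 + bm_exponent \<sigma> \<theta> z / of_real x"
proof -
  let ?p = "thorin_root \<sigma> \<theta> x" and ?m = "thorin_root \<sigma> (- \<theta>) x"
  have pos: "0 < ?p" "0 < ?m" using thorin_root_pos[OF \<sigma> x] by auto
  have "(1 - \<i> * of_real z / of_real ?p) * (1 + \<i> * of_real z / of_real ?m) =
     1 - \<i> * of_real (z * (1 / ?p - 1 / ?m)) + of_real (z\<^sup>2 * (1 / (?p * ?m)))"
    using pos by (simp add: field_simps power2_eq_square)
  also have "\<dots> = 1 - \<i> * of_real (z * (\<theta> / x)) + of_real (z\<^sup>2 * (1 / (2 * x / \<sigma>\<^sup>2)))"
    unfolding inverse_thorin_root_diff[OF \<sigma> x pos(2)] thorin_root_mult[OF \<sigma> x] ..
  also have "\<dots> = 1 + bm_exponent \<sigma> \<theta> z / of_real x"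
    using x \<sigma> by (simp add: bm_exponent_def field_simps)
  finally show ?thesis .
qed

text \<open>Both factors have real part 1, hence arguments strictly between -pi/2 and pi/2, and the
  sum of the arguments stays within the principal branch.\<close>

lemma Ln_one_plus_bm_exponent:
  assumes \<sigma>: "0 < \<sigma>" and x: "0 < x"
  shows "Ln (1 + bm_exponent \<sigma> \<theta> z / of_real x) =
    Ln (1 - \<i> * of_real z / of_real (thorin_root \<sigma> \<theta> x)) + Ln (1 + \<i> * of_real z / of_real (thorin_root \<sigma> (- \<theta>) x))"
proof -
  have im: "\<bar>Im (Ln (1 + \<i> * of_real y))\<bar> < pi / 2 \<and> 1 + \<i> * of_real y \<noteq> 0" for y :: real
    using Re_Ln_pos_lt[of "1 + \<i> * of_real y"] by (auto simp: complex_eq_iff)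
  let ?u = "1 - \<i> * of_real z / of_real (thorin_root \<sigma> \<theta> x)" and ?v = "1 + \<i> * of_real z / of_real (thorin_root \<sigma> (- \<theta>) x)"
  have u: "?u = 1 + \<i> * of_real (- z / thorin_root \<sigma> \<theta> x)" and v: "?v = 1 + \<i> * of_real (z / thorin_root \<sigma> (- \<theta>) x)"
    by simp_all
  have 1: "\<bar>Im (Ln ?u)\<bar> < pi / 2 \<and> ?u \<noteq> 0" unfolding u by (rule im)
  have 2: "\<bar>Im (Ln ?v)\<bar> < pi / 2 \<and> ?v \<noteq> 0" unfolding v by (rule im)
  have "Ln (?u * ?v) = Ln ?u + Ln ?v"
    using 1 2 by (intro Ln_times_simple) (auto simp: abs_less_iff)
  then show ?thesis unfolding thorin_root_factorization[OF assms] .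
qed

text \<open>Makes the results on Levy measures below available for T itself, besides the two images
  of \<rho>.\<close>

lemma thorin_part_thorin_measure:
  assumes \<rho>: "thorin_measure \<rho>" shows "thorin_part \<rho>"
proof -
  note s[measurable_cong] = thorin_sets[OF \<rho>]
  have "(\<integral>\<^sup>+x\<in>{0<..1}. ennreal (1 + \<bar>ln x\<bar>) \<partial>\<rho>) = (\<integral>\<^sup>+x. indicator {0<..1} x + ennreal \<bar>ln x\<bar> * indicator {0<..1} x \<partial>\<rho>)"
    by (intro nn_integral_cong) (simp add: indicator_def)
  also have "\<dots> = emeasure \<rho> {0<..1} + (\<integral>\<^sup>+x\<in>{0<..1}. ennreal \<bar>ln x\<bar> \<partial>\<rho>)"
    using s by (subst nn_integral_add) auto
  also have "\<dots> < \<infinity>" using thorin_finite[OF \<rho>] thorin_ln[OF \<rho>] by simp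
  finally have 1: "(\<integral>\<^sup>+x\<in>{0<..1}. ennreal (1 + \<bar>ln x\<bar>) \<partial>\<rho>) < \<infinity>" .
  have "(\<integral>\<^sup>+x\<in>{1<..}. ennreal (1 / x\<^sup>2) \<partial>\<rho>) \<le> (\<integral>\<^sup>+x\<in>{1..}. ennreal (1 / x) \<partial>\<rho>)"
  proof (rule nn_integral_mono)
    fix x :: real
    show "ennreal (1 / x\<^sup>2) * indicator {1<..} x \<le> ennreal (1 / x) * indicator {1..} x"
    proof (cases "1 < x")
      case True
      then have "1 / x\<^sup>2 \<le> 1 / x" by (intro divide_left_mono) (auto simp: power2_eq_square)
      then show ?thesis using True by (simp add: ennreal_leI)
    qed simp
  qed
  also have "\<dots> < \<infinity>" by (rule thorin_inverse[OF \<rho>])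
  finally show ?thesis using 1 s thorin_AE_pos[OF \<rho>] by (simp add: thorin_part_def)
qed

text \<open>By \<open>thorin_root_ge\<close> the root is at least c x for x <= 1 and c sqrt x
  beyond. Hence its logarithm is controlled by |ln c| + |ln x|, and its inverse square by 1 / (c^2
  x).\<close>

lemma thorin_part_distr_thorin_root:
  assumes \<rho>: "thorin_measure \<rho>" and \<sigma>: "0 < \<sigma>"
  shows "thorin_part (distr \<rho> borel (thorin_root \<sigma> \<theta>))"
proof -
  note s[measurable_cong] = thorin_sets[OF \<rho>]
  let ?P = "thorin_root \<sigma> \<theta>"
  define c where "c = 2 / (sqrt (\<theta>\<^sup>2 + 2 * \<sigma>\<^sup>2) + \<bar>\<theta>\<bar>)"
  have "0 < sqrt (\<theta>\<^sup>2 + 2 * \<sigma>\<^sup>2) + \<bar>\<theta>\<bar>" using \<sigma> by (intro add_pos_nonneg) (auto intro: add_nonneg_pos)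
  then have c: "0 < c" by (simp add: c_def)
  \<comment> \<open>One constant that serves in all four combinations of x <= 1 or x > 1 with root
    <= 1 or root > 1; the inequalities \<open>R1\<close> to \<open>R4\<close> are these
    cases.\<close>
  define R where "R = (1 + \<bar>ln c\<bar>) * (1 + 1 / c\<^sup>2)"
  let ?D = "\<lambda>x. thorin_dominator R x"
  have R: "0 \<le> R" by (simp add: R_def)
  have R1: "1 + \<bar>ln c\<bar> \<le> R" and R2: "(1 + \<bar>ln c\<bar>) / c\<^sup>2 \<le> R" and R3: "1 / c\<^sup>2 \<le> R" and R4: "1 \<le> R"
  proof -
    have e: "R = (1 + \<bar>ln c\<bar>) + (1 + \<bar>ln c\<bar>) / c\<^sup>2" by (simp add: R_def distrib_left)
    have "1 / c\<^sup>2 \<le> (1 + \<bar>ln c\<bar>) / c\<^sup>2" by (intro divide_right_mono) auto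
    moreover have "0 \<le> 1 / c\<^sup>2" by simp
    ultimately show "1 + \<bar>ln c\<bar> \<le> R" "(1 + \<bar>ln c\<bar>) / c\<^sup>2 \<le> R" "1 / c\<^sup>2 \<le> R" "1 \<le> R"
      unfolding e by linarith+
  qed
  have fin: "(\<integral>\<^sup>+x. ennreal (?D x) \<partial>\<rho>) < \<infinity>"
    using integrable_thorin_dominator[OF \<rho> R] R thorin_AE_pos[OF \<rho>]
    by (subst (asm) integrable_iff_bounded) (auto elim!: order.strict_trans1[rotated] intro!: nn_integral_mono ennreal_leI)
  have lb: "c * (if x \<le> 1 then x else sqrt x) \<le> ?P x" if "0 < x" for x
    using thorin_root_ge[OF \<sigma> that, of \<theta>] by (simp add: c_def)
  have "(\<integral>\<^sup>+x\<in>{0<..1}. ennreal (1 + \<bar>ln x\<bar>) \<partial>distr \<rho> borel ?P) = (\<integral>\<^sup>+x. ennreal (1 + \<bar>ln (?P x)\<bar>) * indicator {0<..1} (?P x) \<partial>\<rho>)"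
    by (rule nn_integral_distr) measurable
  also have "\<dots> \<le> (\<integral>\<^sup>+x. ennreal (?D x) \<partial>\<rho>)"
  proof (rule nn_integral_mono_AE)
    show "AE x in \<rho>. ennreal (1 + \<bar>ln (?P x)\<bar>) * indicator {0<..1} (?P x) \<le> ennreal (?D x)"
      using thorin_AE_pos[OF \<rho>]
    proof eventually_elim
      fix x :: real assume x: "0 < x"
      show "ennreal (1 + \<bar>ln (?P x)\<bar>) * indicator {0<..1} (?P x) \<le> ennreal (?D x)"
      proof (cases "?P x \<le> 1")
        case True
        have Pp: "0 < ?P x" by (rule thorin_root_pos[OF \<sigma> x])
        have "1 + \<bar>ln (?P x)\<bar> \<le> ?D x"
        proof (cases "x \<le> 1")
          case x1: True
          have "ln (c * x) \<le> ln (?P x)" using lb[OF x] x1 x c by (intro ln_mono) auto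
          then have "ln c + ln x \<le> ln (?P x)" using c x by (simp add: ln_mult)
          moreover have "ln (?P x) \<le> 0" using True Pp by simp
          ultimately show ?thesis using x1 R1 by auto
        next
          \<comment> \<open>A root at most 1 with x > 1 forces c^2 x <= 1, so the constant bound 1 +
            |ln c| may be multiplied by 1 / (c^2 x) >= 1 to reach the form R / x.\<close>
          case x1: False
          have sx: "1 \<le> sqrt x" using x1 by simp
          then have "c * 1 \<le> c * sqrt x" using c by (intro mult_left_mono) auto
          then have cP: "c \<le> ?P x" "c * sqrt x \<le> 1" using lb[OF x] x1 True by auto
          have "ln c \<le> ln (?P x)" using cP c by (intro ln_mono) auto
          moreover have "ln (?P x) \<le> 0" using True Pp by simp
          ultimately have 1: "1 + \<bar>ln (?P x)\<bar> \<le> 1 + \<bar>ln c\<bar>" by auto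
          have "(c * sqrt x)\<^sup>2 \<le> 1" using cP(2) c sx by (intro power_le_one) auto
          then have "c\<^sup>2 * x \<le> 1" using x by (simp add: power_mult_distrib)
          then have "1 \<le> 1 / c\<^sup>2 / x" using c x by (simp add: field_simps)
          then have "(1 + \<bar>ln c\<bar>) * 1 \<le> (1 + \<bar>ln c\<bar>) * (1 / c\<^sup>2 / x)" by (intro mult_left_mono) auto
          also have "\<dots> = (1 + \<bar>ln c\<bar>) / c\<^sup>2 / x" by simp
          also have "\<dots> \<le> R / x" using R2 x by (intro divide_right_mono) auto
          finally show ?thesis using 1 x1 by simp
        qed
        then show ?thesis using Pp True by (simp add: ennreal_leI)
      qed simp
    qed
  qed
  also note fin
  finally have 1: "(\<integral>\<^sup>+x\<in>{0<..1}. ennreal (1 + \<bar>ln x\<bar>) \<partial>distr \<rho> borel ?P) < \<infinity>" .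
  have "(\<integral>\<^sup>+x\<in>{1<..}. ennreal (1 / x\<^sup>2) \<partial>distr \<rho> borel ?P) = (\<integral>\<^sup>+x. ennreal (1 / (?P x)\<^sup>2) * indicator {1<..} (?P x) \<partial>\<rho>)"
    by (rule nn_integral_distr) measurable
  also have "\<dots> \<le> (\<integral>\<^sup>+x. ennreal (?D x) \<partial>\<rho>)"
  proof (rule nn_integral_mono_AE)
    show "AE x in \<rho>. ennreal (1 / (?P x)\<^sup>2) * indicator {1<..} (?P x) \<le> ennreal (?D x)"
      using thorin_AE_pos[OF \<rho>]
    proof eventually_elim
      fix x :: real assume x: "0 < x"
      show "ennreal (1 / (?P x)\<^sup>2) * indicator {1<..} (?P x) \<le> ennreal (?D x)"
      proof (cases "1 < ?P x")
        case True
        have "1 / (?P x)\<^sup>2 \<le> ?D x"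
        proof (cases "x \<le> 1")
          case x1: True
          have "1 / (?P x)\<^sup>2 \<le> 1" using True by simp
          then show ?thesis using x1 R4 by auto
        next
          case x1: False
          have "(c * sqrt x)\<^sup>2 \<le> (?P x)\<^sup>2" using lb[OF x] x1 c by (intro power_mono) auto
          then have "c\<^sup>2 * x \<le> (?P x)\<^sup>2" using x by (simp add: power_mult_distrib)
          then have "1 / (?P x)\<^sup>2 \<le> 1 / (c\<^sup>2 * x)" using c x thorin_root_pos[OF \<sigma> x, of \<theta>]
            by (intro divide_left_mono mult_pos_pos) auto
          also have "\<dots> = 1 / c\<^sup>2 / x" by simp
          also have "\<dots> \<le> R / x" using R3 x by (intro divide_right_mono) auto
          finally show ?thesis using x1 by simp
        qed
        then show ?thesis using True by (simp add: ennreal_leI)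
      qed simp
    qed
  qed
  also note fin
  finally have 2: "(\<integral>\<^sup>+x\<in>{1<..}. ennreal (1 / x\<^sup>2) \<partial>distr \<rho> borel ?P) < \<infinity>" .
  have "AE x in distr \<rho> borel ?P. 0 < x"
    using thorin_AE_pos[OF \<rho>] by (subst AE_distr_iff) (auto elim!: eventually_mono intro: thorin_root_pos[OF \<sigma>])
  with 1 2 show ?thesis by (simp add: thorin_part_def)
qed

section \<open>The integrand of the Thorin exponent\<close>

definition thorin_integrand :: "real \<Rightarrow> real \<Rightarrow> complex" where
  "thorin_integrand z x = Ln (1 - \<i> * of_real z / of_real x) + \<i> * of_real z / of_real x * indicator {x. \<bar>x\<bar> \<ge> 1} x"

lemma thorin_integrand_measurable[measurable]: "thorin_integrand z \<in> borel_measurable borel"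
  unfolding thorin_integrand_def[abs_def] by measurable

lemma thorin_integrand_uminus: "thorin_integrand z (- x) = thorin_integrand (- z) x"
  by (auto simp: thorin_integrand_def indicator_def)

lemma norm_thorin_integrand_le:
  assumes "0 < x"
  shows "norm (thorin_integrand z x) \<le> (ln (1 + \<bar>z\<bar>) + pi + 1 + z\<^sup>2) * ((1 + \<bar>ln x\<bar>) * indicator {0<..1} x + 1 / x\<^sup>2 * indicator {1<..} x)"
proof -
  let ?w = "- \<i> * of_real z / complex_of_real x"
  have l: "0 \<le> ln (1 + \<bar>z\<bar>)" by simp
  have nw: "norm (- \<i> * complex_of_real z) = \<bar>z\<bar>" by (simp add: norm_mult)
  have w2: "norm (Ln (1 + ?w) - ?w) \<le> z\<^sup>2 / x\<^sup>2"
    using norm_Ln_one_plus_minus_le[of ?w] by (simp add: norm_mult norm_divide power_divide)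
  \<comment> \<open>The point 1 needs its own case: the integrand is already compensated there,
    while the bound still counts it with the small values.\<close>
  consider "x < 1" | "x = 1" | "1 < x" by linarith
  then show ?thesis
  proof cases
    case 1
    have "norm (Ln (1 + ?w)) \<le> ln (1 + \<bar>z\<bar>) + \<bar>ln x\<bar> + pi"
      using norm_Ln_one_plus_divide_le[of "- \<i> * of_real z" x "\<bar>z\<bar>"] assms 1 nw by auto
    also have "\<dots> \<le> (ln (1 + \<bar>z\<bar>) + pi + 1 + z\<^sup>2) * (1 + \<bar>ln x\<bar>)"
      using l pi_gt_zero by (simp add: algebra_simps add_increasing2)
    finally show ?thesis using 1 assms by (simp add: thorin_integrand_def)
  next
    case 2
    then have "norm (thorin_integrand z x) \<le> z\<^sup>2" using w2 by (simp add: thorin_integrand_def)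
    also have "\<dots> \<le> ln (1 + \<bar>z\<bar>) + pi + 1 + z\<^sup>2" using l pi_gt_zero by linarith
    finally show ?thesis using 2 by simp
  next
    case 3
    then have "norm (thorin_integrand z x) \<le> z\<^sup>2 / x\<^sup>2" using w2 by (simp add: thorin_integrand_def)
    also have "\<dots> \<le> (ln (1 + \<bar>z\<bar>) + pi + 1 + z\<^sup>2) / x\<^sup>2" using l pi_gt_zero by (intro divide_right_mono) (linarith, simp)
    finally show ?thesis using 3 by simp
  qed
qed

lemma integrable_thorin_integrand:
  assumes \<eta>: "thorin_part \<eta>"
  shows "integrable \<eta> (thorin_integrand z)"
proof (rule integrableI_bounded)
  note s[measurable_cong] = thorin_partD(1)[OF \<eta>]
  show "thorin_integrand z \<in> borel_measurable \<eta>" by measurable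
  let ?C = "ln (1 + \<bar>z\<bar>) + pi + 1 + z\<^sup>2"
  have C: "0 \<le> ?C" using pi_gt_zero by (intro add_nonneg_nonneg) auto
  have "(\<integral>\<^sup>+x. norm (thorin_integrand z x) \<partial>\<eta>) \<le>
     (\<integral>\<^sup>+x. ennreal ?C * (ennreal (1 + \<bar>ln x\<bar>) * indicator {0<..1} x + ennreal (1 / x\<^sup>2) * indicator {1<..} x) \<partial>\<eta>)"
  proof (rule nn_integral_mono_AE)
    show "AE x in \<eta>. ennreal (norm (thorin_integrand z x)) \<le> ennreal ?C * (ennreal (1 + \<bar>ln x\<bar>) * indicator {0<..1} x + ennreal (1 / x\<^sup>2) * indicator {1<..} x)"
      using thorin_partD(2)[OF \<eta>]
    proof eventually_elim
      fix x :: real assume x: "0 < x"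
      have "ennreal (norm (thorin_integrand z x)) \<le> ennreal (?C * ((1 + \<bar>ln x\<bar>) * indicator {0<..1} x + 1 / x\<^sup>2 * indicator {1<..} x))"
        by (intro ennreal_leI norm_thorin_integrand_le x)
      also have "\<dots> = ennreal ?C * (ennreal (1 + \<bar>ln x\<bar>) * indicator {0<..1} x + ennreal (1 / x\<^sup>2) * indicator {1<..} x)"
      proof -
        have "ennreal ((1 + \<bar>ln x\<bar>) * indicator {0<..1} x + 1 / x\<^sup>2 * indicator {1<..} x) =
          ennreal (1 + \<bar>ln x\<bar>) * indicator {0<..1} x + ennreal (1 / x\<^sup>2) * indicator {1<..} x"
          by (cases "x \<le> 1") (auto simp: indicator_def simp del: ennreal_plus)
        then show ?thesis using C by (subst ennreal_mult) auto
      qed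
      finally show "ennreal (norm (thorin_integrand z x)) \<le> ennreal ?C * (ennreal (1 + \<bar>ln x\<bar>) * indicator {0<..1} x + ennreal (1 / x\<^sup>2) * indicator {1<..} x)" .
    qed
  qed
  also have "\<dots> = ennreal ?C * ((\<integral>\<^sup>+x\<in>{0<..1}. ennreal (1 + \<bar>ln x\<bar>) \<partial>\<eta>) + (\<integral>\<^sup>+x\<in>{1<..}. ennreal (1 / x\<^sup>2) \<partial>\<eta>))"
    by (subst nn_integral_cmult, measurable) (simp add: nn_integral_add)
  also have "\<dots> < \<infinity>"
    using thorin_partD(3,4)[OF \<eta>] by (simp add: ennreal_mult_less_top)
  finally show "(\<integral>\<^sup>+x. norm (thorin_integrand z x) \<partial>\<eta>) < \<infinity>" .
qed

section \<open>Gluing two measures on the positive half-line into one on the line\<close>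

context
  fixes \<tau>p \<tau>m :: "real measure"
  assumes sp: "sets \<tau>p = sets borel" and sm: "sets \<tau>m = sets borel"
    and pp: "AE x in \<tau>p. 0 < x" and pm: "AE x in \<tau>m. 0 < x"
begin

lemma sets_two_sided: "sets (two_sided \<tau>p \<tau>m) = sets borel"
  using sets.sigma_sets_eq[of "borel :: real measure"] by (simp add: two_sided_def)

text \<open>As neither measure charges the nonpositive half-line, the set function in
  \<open>two_sided\<close> equals on Borel sets the sum of one measure and the reflection of the
  other. So it is countably additive, without which \<open>measure_of\<close> would return the zero
  measure.\<close>

lemma emeasure_two_sided:
  assumes B: "B \<in> sets borel"
  shows "emeasure (two_sided \<tau>p \<tau>m) B = emeasure \<tau>p B + emeasure (distr \<tau>m borel uminus) B"
proof -
  note [measurable_cong] = sp sm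
  have eq: "emeasure \<tau>p (B \<inter> {0<..}) + emeasure \<tau>m (uminus ` B \<inter> {0<..}) = emeasure \<tau>p B + emeasure (distr \<tau>m borel uminus) B"
    if B: "B \<in> sets borel" for B
  proof -
    have 1: "emeasure \<tau>p (B \<inter> {0<..}) = emeasure \<tau>p B"
      using pp B by (intro emeasure_eq_AE) (auto simp: sp)
    have im: "uminus ` B = uminus -` B \<inter> space \<tau>m"
      using sets_eq_imp_space_eq[OF sm] by (force simp: image_iff)
    have "emeasure \<tau>m (uminus ` B \<inter> {0<..}) = emeasure \<tau>m (uminus -` B \<inter> space \<tau>m)"
      using pm B unfolding im by (intro emeasure_eq_AE sets.Int measurable_sets[OF _ B]) (auto simp: sm)
    also have "\<dots> = emeasure (distr \<tau>m borel uminus) B"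
      using B by (subst emeasure_distr) auto
    finally show ?thesis using 1 by simp
  qed
  show ?thesis
  proof -
    have "emeasure (two_sided \<tau>p \<tau>m) B = emeasure \<tau>p (B \<inter> {0<..}) + emeasure \<tau>m (uminus ` B \<inter> {0<..})"
    proof (rule emeasure_measure_of[OF two_sided_def])
      show "countably_additive (sets (two_sided \<tau>p \<tau>m)) (\<lambda>B. emeasure \<tau>p (B \<inter> {0<..}) + emeasure \<tau>m (uminus ` B \<inter> {0<..}))"
      proof (rule countably_additiveI)
        fix A :: "nat \<Rightarrow> real set" assume A: "range A \<subseteq> sets (two_sided \<tau>p \<tau>m)" "disjoint_family A" "\<Union> (range A) \<in> sets (two_sided \<tau>p \<tau>m)"
        then have Ai: "A i \<in> sets borel" "\<Union> (range A) \<in> sets borel" for i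
          unfolding sets_two_sided by auto
        show "(\<Sum>i. emeasure \<tau>p (A i \<inter> {0<..}) + emeasure \<tau>m (uminus ` A i \<inter> {0<..})) =
          emeasure \<tau>p (\<Union> (range A) \<inter> {0<..}) + emeasure \<tau>m (uminus ` (\<Union> (range A)) \<inter> {0<..})"
          using A Ai unfolding eq[OF Ai(1)] eq[OF Ai(2)]
          by (subst suminf_add[symmetric]) (auto simp: suminf_emeasure sp image_subset_iff)
      qed
    qed (use B in \<open>auto simp: sets_two_sided positive_def\<close>)
    then show ?thesis by (simp add: eq[OF B])
  qed
qed

lemma nn_integral_two_sided:
  assumes g: "g \<in> borel_measurable borel"
  shows "(\<integral>\<^sup>+x. g x \<partial>two_sided \<tau>p \<tau>m) = (\<integral>\<^sup>+x. g x \<partial>\<tau>p) + (\<integral>\<^sup>+x. g (- x) \<partial>\<tau>m)"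
proof -
  note [measurable_cong] = sp sm sets_two_sided
  have "(\<integral>\<^sup>+x. g x \<partial>two_sided \<tau>p \<tau>m) = (\<integral>\<^sup>+x. g x \<partial>\<tau>p) + (\<integral>\<^sup>+x. g x \<partial>distr \<tau>m borel uminus)"
    using g
  proof (induction rule: borel_measurable_induct)
    case (set A)
    then show ?case by (simp add: emeasure_two_sided sp sets_two_sided)
  next
    case (mult u c)
    then show ?case by (simp add: nn_integral_cmult distrib_left)
  next
    case (add u v)
    then show ?case by (simp add: nn_integral_add add_ac)
  next
    case (seq U)
    have i: "incseq (\<lambda>i. \<integral>\<^sup>+x. U i x \<partial>N)" for N
      using seq(3) by (auto simp: incseq_def le_fun_def intro!: nn_integral_mono)
    show ?case using seq i
      by (simp add: nn_integral_monotone_convergence_SUP ennreal_SUP_add SUP_apply image_comp)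
  next
    case (cong f g)
    then show ?case by (simp cong: nn_integral_cong)
  qed
  then show ?thesis using g by (simp add: nn_integral_distr)
qed

text \<open>Restricting the glued measure to either open half-line, as an indicator density, gives
  back one of the pieces; the Bochner integral is then split over these densities, the origin being
  null.\<close>

lemma integral_two_sided:
  fixes g :: "real \<Rightarrow> 'b::{banach, second_countable_topology}"
  assumes g[measurable]: "g \<in> borel_measurable borel"
    and ip: "integrable \<tau>p g" and im: "integrable \<tau>m (\<lambda>x. g (- x))"
  shows "(\<integral>x. g x \<partial>two_sided \<tau>p \<tau>m) = (\<integral>x. g x \<partial>\<tau>p) + (\<integral>x. g (- x) \<partial>\<tau>m)"
proof -
  note [measurable_cong] = sp sm sets_two_sided
  let ?\<tau> = "two_sided \<tau>p \<tau>m"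
  have p0: "emeasure \<tau>p (A \<inter> {0<..}) = emeasure \<tau>p A" "emeasure \<tau>p (A \<inter> {..<0}) = 0" if "A \<in> sets borel" for A
  proof -
    show "emeasure \<tau>p (A \<inter> {0<..}) = emeasure \<tau>p A" using pp that by (intro emeasure_eq_AE) (auto simp: sp)
    have "emeasure \<tau>p (A \<inter> {..<0}) = emeasure \<tau>p {}" using pp that by (intro emeasure_eq_AE) (auto simp: sp)
    then show "emeasure \<tau>p (A \<inter> {..<0}) = 0" by simp
  qed
  have pm': "AE x in distr \<tau>m borel uminus. x < 0" using pm by (subst AE_distr_iff) auto
  have m0: "emeasure (distr \<tau>m borel uminus) (A \<inter> {..<0}) = emeasure (distr \<tau>m borel uminus) A"
    "emeasure (distr \<tau>m borel uminus) (A \<inter> {0<..}) = 0" if "A \<in> sets borel" for A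
  proof -
    show "emeasure (distr \<tau>m borel uminus) (A \<inter> {..<0}) = emeasure (distr \<tau>m borel uminus) A"
      using pm' that by (intro emeasure_eq_AE) auto
    have "emeasure (distr \<tau>m borel uminus) (A \<inter> {0<..}) = emeasure (distr \<tau>m borel uminus) {}"
      using pm' that by (intro emeasure_eq_AE) auto
    then show "emeasure (distr \<tau>m borel uminus) (A \<inter> {0<..}) = 0" by simp
  qed
  have dp: "density ?\<tau> (\<lambda>x. ennreal (indicator {0<..} x)) = \<tau>p"
  proof (rule measure_eqI)
    fix A assume "A \<in> sets (density ?\<tau> (\<lambda>x. ennreal (indicator {0<..} x)))"
    then have A: "A \<in> sets borel" by (simp add: sets_two_sided)
    have "emeasure (density ?\<tau> (\<lambda>x. ennreal (indicator {0<..} x))) A = (\<integral>\<^sup>+x. indicator (A \<inter> {0<..}) x \<partial>?\<tau>)"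
    proof -
      have "emeasure (density ?\<tau> (\<lambda>x. ennreal (indicator {0<..} x))) A = (\<integral>\<^sup>+x. ennreal (indicator {0<..} x) * indicator A x \<partial>?\<tau>)"
        using A by (intro emeasure_density) (auto simp: sets_two_sided)
      also have "\<dots> = (\<integral>\<^sup>+x. indicator (A \<inter> {0<..}) x \<partial>?\<tau>)"
        by (rule nn_integral_cong) (simp split: split_indicator)
      finally show ?thesis .
    qed
    also have "\<dots> = emeasure ?\<tau> (A \<inter> {0<..})" using A by (simp add: sets_two_sided)
    finally show "emeasure (density ?\<tau> (\<lambda>x. ennreal (indicator {0<..} x))) A = emeasure \<tau>p A"
      using A by (simp add: emeasure_two_sided p0 m0)
  qed (simp add: sets_two_sided sp)
  have dm: "density ?\<tau> (\<lambda>x. ennreal (indicator {..<0} x)) = distr \<tau>m borel uminus"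
  proof (rule measure_eqI)
    fix A assume "A \<in> sets (density ?\<tau> (\<lambda>x. ennreal (indicator {..<0} x)))"
    then have A: "A \<in> sets borel" by (simp add: sets_two_sided)
    have "emeasure (density ?\<tau> (\<lambda>x. ennreal (indicator {..<0} x))) A = (\<integral>\<^sup>+x. indicator (A \<inter> {..<0}) x \<partial>?\<tau>)"
    proof -
      have "emeasure (density ?\<tau> (\<lambda>x. ennreal (indicator {..<0} x))) A = (\<integral>\<^sup>+x. ennreal (indicator {..<0} x) * indicator A x \<partial>?\<tau>)"
        using A by (intro emeasure_density) (auto simp: sets_two_sided)
      also have "\<dots> = (\<integral>\<^sup>+x. indicator (A \<inter> {..<0}) x \<partial>?\<tau>)"
        by (rule nn_integral_cong) (simp split: split_indicator)
      finally show ?thesis .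
    qed
    also have "\<dots> = emeasure ?\<tau> (A \<inter> {..<0})" using A by (simp add: sets_two_sided)
    finally show "emeasure (density ?\<tau> (\<lambda>x. ennreal (indicator {..<0} x))) A = emeasure (distr \<tau>m borel uminus) A"
      using A by (simp add: emeasure_two_sided p0 m0)
  qed (simp add: sets_two_sided)
  have "emeasure ?\<tau> {0} = 0"
    using p0(1)[of "{0}"] m0(1)[of "{0}"] by (simp add: emeasure_two_sided)
  then have "{0} \<in> null_sets ?\<tau>" by (simp add: null_sets_def sets_two_sided)
  then have ae: "AE x in ?\<tau>. x \<noteq> 0" using AE_not_in by fastforce
  have i1: "integrable ?\<tau> (\<lambda>x. indicator {0<..} x *\<^sub>R g x)" and e1: "(\<integral>x. indicator {0<..} x *\<^sub>R g x \<partial>?\<tau>) = (\<integral>x. g x \<partial>\<tau>p)"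
    using ip integrable_density[of g ?\<tau> "indicator {0<..}"] integral_density[of g ?\<tau> "indicator {0<..}"] dp by auto
  have i2': "integrable (distr \<tau>m borel uminus) g" "(\<integral>x. g x \<partial>distr \<tau>m borel uminus) = (\<integral>x. g (- x) \<partial>\<tau>m)"
    using im by (auto simp: integrable_distr_eq integral_distr)
  have i2: "integrable ?\<tau> (\<lambda>x. indicator {..<0} x *\<^sub>R g x)" and e2: "(\<integral>x. indicator {..<0} x *\<^sub>R g x \<partial>?\<tau>) = (\<integral>x. g (- x) \<partial>\<tau>m)"
    using i2' integrable_density[of g ?\<tau> "indicator {..<0}"] integral_density[of g ?\<tau> "indicator {..<0}"] dm by auto
  have "(\<integral>x. g x \<partial>?\<tau>) = (\<integral>x. indicator {0<..} x *\<^sub>R g x + indicator {..<0} x *\<^sub>R g x \<partial>?\<tau>)"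
    by (intro integral_cong_AE) (use ae in \<open>auto simp: indicator_def\<close>)
  also have "\<dots> = (\<integral>x. g x \<partial>\<tau>p) + (\<integral>x. g (- x) \<partial>\<tau>m)"
    using i1 i2 e1 e2 by simp
  finally show ?thesis .
qed

end

section \<open>The Thorin triplet of subordinated Brownian motion\<close>

lemma cadlag_affine:
  assumes "cadlag x" shows "cadlag (\<lambda>t. c * x t + d * t)"
  unfolding cadlag_def
proof safe
  fix t :: real assume "0 \<le> t"
  then show "((\<lambda>t. c * x t + d * t) \<longlongrightarrow> c * x t + d * t) (at_right t)"
    using assms by (intro tendsto_intros) (simp add: cadlag_def)
next
  fix t :: real assume "0 < t"
  then obtain l where "(x \<longlongrightarrow> l) (at_left t)" using assms by (auto simp: cadlag_def)
  then have "((\<lambda>t. c * x t + d * t) \<longlongrightarrow> c * l + d * t) (at_left t)" by (intro tendsto_intros)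
  then show "\<exists>l. ((\<lambda>t. c * x t + d * t) \<longlongrightarrow> l) (at_left t)" by blast
qed

locale brownian_subordination =
  fixes M :: "'a measure" and W T :: "real \<Rightarrow> 'a \<Rightarrow> real" and \<sigma> \<theta> a :: real and \<rho> :: "real measure"
  assumes W: "standard_brownian_motion M W" and \<sigma>: "0 < \<sigma>" and T: "thorin_subordinator M T a \<rho>"
    and XT: "independent_processes M (\<lambda>t \<omega>. \<sigma> * W t \<omega> + \<theta> * t) T"
begin

abbreviation "BM \<equiv> \<lambda>t \<omega>. \<sigma> * W t \<omega> + \<theta> * t"

lemma levy_W: "levy_process M W"
  using W by (simp add: standard_brownian_motion_def)

lemma prob_space_M: "prob_space M"
  using levy_W by (simp add: levy_process_def)

lemma W_measurable[measurable]: "0 \<le> t \<Longrightarrow> W t \<in> borel_measurable M"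
  using levy_W by (simp add: levy_process_def)

lemma levy_BM: "levy_process M BM"
proof -
  interpret prob_space M by (rule prob_space_M)
  show ?thesis unfolding levy_process_def
  proof (intro conjI allI impI)
    show "AE \<omega> in M. \<sigma> * W 0 \<omega> + \<theta> * 0 = 0"
      using levy_W by (simp add: levy_process_def)
    show "independent_increments M BM" unfolding independent_increments_def
    proof (intro allI impI)
      fix n and t :: "nat \<Rightarrow> real" assume "0 \<le> t 0 \<and> (\<forall>i<n. t i < t (Suc i))"
      then have "indep_vars (\<lambda>_. borel) (\<lambda>i \<omega>. W (t (Suc i)) \<omega> - W (t i) \<omega>) {..<n}"
        using levy_W by (simp add: levy_process_def independent_increments_def)
      then have "indep_vars (\<lambda>_. borel) (\<lambda>i \<omega>. \<sigma> * (W (t (Suc i)) \<omega> - W (t i) \<omega>) + \<theta> * (t (Suc i) - t i)) {..<n}"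
        by (rule indep_vars_compose2) auto
      also have "(\<lambda>i \<omega>. \<sigma> * (W (t (Suc i)) \<omega> - W (t i) \<omega>) + \<theta> * (t (Suc i) - t i)) =
          (\<lambda>i \<omega>. \<sigma> * W (t (Suc i)) \<omega> + \<theta> * t (Suc i) - (\<sigma> * W (t i) \<omega> + \<theta> * t i))"
        by (simp add: algebra_simps)
      finally show "indep_vars (\<lambda>_. borel) (\<lambda>i \<omega>. \<sigma> * W (t (Suc i)) \<omega> + \<theta> * t (Suc i) - (\<sigma> * W (t i) \<omega> + \<theta> * t i)) {..<n}" .
    qed
    show "stationary_increments M BM" unfolding stationary_increments_def
    proof (intro allI impI)
      fix s h :: real assume sh: "0 \<le> s" "0 \<le> h"
      have st: "distr M borel (\<lambda>\<omega>. W (s + h) \<omega> - W s \<omega>) = distr M borel (\<lambda>\<omega>. W h \<omega> - W 0 \<omega>)"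
        using levy_W sh by (simp add: levy_process_def stationary_increments_def)
      have "distr M borel (\<lambda>\<omega>. BM (s + h) \<omega> - BM s \<omega>) = distr (distr M borel (\<lambda>\<omega>. W (s + h) \<omega> - W s \<omega>)) borel (\<lambda>x. \<sigma> * x + \<theta> * h)"
        using sh by (subst distr_distr) (auto simp: comp_def algebra_simps)
      also have "\<dots> = distr M borel (\<lambda>\<omega>. BM h \<omega> - BM 0 \<omega>)"
        unfolding st using sh by (subst distr_distr) (auto simp: comp_def algebra_simps)
      finally show "distr M borel (\<lambda>\<omega>. BM (s + h) \<omega> - BM s \<omega>) = distr M borel (\<lambda>\<omega>. BM h \<omega> - BM 0 \<omega>)" .
    qed
    show "AE \<omega> in M. cadlag (\<lambda>t. BM t \<omega>)"
    proof -
      have "AE \<omega> in M. cadlag (\<lambda>t. W t \<omega>)" using levy_W by (simp add: levy_process_def)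
      then show ?thesis by eventually_elim (rule cadlag_affine)
    qed
  qed (use prob_space_M in auto)
qed

lemma thorin_\<rho>: "thorin_measure \<rho>" and a_nonneg: "0 \<le> a"
  using T by (auto simp: thorin_subordinator_def)

sublocale subordination M BM T
proof (intro subordination.intro prob_space_M subordination_axioms.intro levy_BM XT)
  show "levy_process M T" "AE \<omega> in M. mono_on {0..} (\<lambda>t. T t \<omega>)"
    using T by (auto simp: thorin_subordinator_def)
  show "AE \<omega> in M. continuous_on {0..} (\<lambda>t. BM t \<omega>)"
    using W unfolding standard_brownian_motion_def
    by (auto elim!: eventually_mono intro!: continuous_intros)
qed

lemma W_scaled: 
  assumes u: "0 < u" 
  shows "distr M borel (\<lambda>\<omega>. W u \<omega> / sqrt u) = std_normal_distribution"
proof -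
  have "distributed M lborel (W u) (\<lambda>x. ennreal (normal_density 0 (sqrt u) x))"
    using W u by (simp add: standard_brownian_motion_def)
  then have "distributed M lborel (\<lambda>\<omega>. (W u \<omega> - 0) / sqrt u) (\<lambda>x. ennreal (std_normal_density x))"
    by (subst normal_standard_normal_convert[symmetric]) (use u in auto)
  then have "distr M lborel (\<lambda>\<omega>. W u \<omega> / sqrt u) = std_normal_distribution"
    by (simp add: distributed_def)
  then show ?thesis by (simp cong: distr_cong)
qed

lemma transition_iexp:
  assumes u: "0 \<le> u"
  shows "transition (\<lambda>x. iexp (z * x)) u = exp (- (bm_exponent \<sigma> \<theta> z * of_real u))"
\<comment> \<open>The normal law of the Brownian motion is specified at positive times only.\<close>
proof (cases "u = 0")
  case True
  have "transition (\<lambda>x. iexp (z * x)) u = (\<integral>\<omega>. 1 \<partial>M)"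
    unfolding transition_def using True X_0 by (intro integral_cong_AE) (auto elim!: eventually_mono)
  then show ?thesis using True by (simp add: prob_space)
next
  case False
  with u have u: "0 < u" by simp
  let ?q = "z * \<sigma> * sqrt u"
  have "transition (\<lambda>x. iexp (z * x)) u = (\<integral>\<omega>. iexp (z * \<theta> * u) * iexp (?q * (W u \<omega> / sqrt u)) \<partial>M)"
    unfolding transition_def using u
    by (intro Bochner_Integration.integral_cong) (auto simp: exp_add[symmetric] algebra_simps)
  also have "\<dots> = iexp (z * \<theta> * u) * (\<integral>\<omega>. iexp (?q * (W u \<omega> / sqrt u)) \<partial>M)"
    by simp
  also have "(\<integral>\<omega>. iexp (?q * (W u \<omega> / sqrt u)) \<partial>M) = char (distr M borel (\<lambda>\<omega>. W u \<omega> / sqrt u)) ?q"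
    unfolding char_def using u by (subst integral_distr) auto
  also have "\<dots> = of_real (exp (- (?q\<^sup>2) / 2))"
    unfolding W_scaled[OF u] char_std_normal_distribution ..
  also have "iexp (z * \<theta> * u) * of_real (exp (- (?q\<^sup>2) / 2)) = exp (- (bm_exponent \<sigma> \<theta> z * of_real u))"
    using u by (simp add: bm_exponent_def power_mult_distrib exp_of_real[symmetric] exp_add[symmetric] algebra_simps)
  finally show ?thesis .
qed

lemma char_Y_laplace:
  assumes t: "0 \<le> t"
  shows "char (distr (completion M) borel (Y t)) z = (\<integral>\<omega>. exp (- (bm_exponent \<sigma> \<theta> z * of_real (T t \<omega>))) \<partial>M)"
proof -
  have c: "continuous_on UNIV (\<lambda>x. iexp (z * x))" by (intro continuous_intros)
  have "transition (\<lambda>x. iexp (z * x)) \<in> borel_measurable borel"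
    by (rule borel_measurable_continuous_onI[OF continuous_transition[OF c]]) simp
  then have m: "(\<lambda>\<omega>. transition (\<lambda>x. iexp (z * x)) (T t \<omega>)) \<in> borel_measurable M"
    using t by (rule measurable_compose[OF T_measurable, rotated])
  show ?thesis unfolding char_Y[OF t]
  proof (rule integral_cong_AE[OF m])
    show "AE \<omega> in M. transition (\<lambda>x. iexp (z * x)) (T t \<omega>) = exp (- (bm_exponent \<sigma> \<theta> z * of_real (T t \<omega>)))"
      using T_nonneg by eventually_elim (rule transition_iexp, use t in auto)
  qed (use t in measurable)
qed

lemma char_Y_1:
  "char (distr (completion M) borel (Y 1)) z =
    exp (- (of_real a * bm_exponent \<sigma> \<theta> z) - thorin_exponent \<rho> (bm_exponent \<sigma> \<theta> z))"
  using char_Y_laplace[of 1 z] thorin_subordinator_laplace[OF T Re_bm_exponent] by simp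

abbreviation "\<tau>\<^sub>p \<equiv> distr \<rho> borel (thorin_root \<sigma> \<theta>)"
abbreviation "\<tau>\<^sub>m \<equiv> distr \<rho> borel (thorin_root \<sigma> (- \<theta>))"

lemmas thorin_part_p = thorin_part_distr_thorin_root[OF thorin_\<rho> \<sigma>, of \<theta>]
lemmas thorin_part_m = thorin_part_distr_thorin_root[OF thorin_\<rho> \<sigma>, of "- \<theta>"]

text \<open>The total compensation which a single point \<open>t\<close> of \<rho> causes in the
  triplet through its two images. Each of the two terms decays only like 1 / sqrt t and need not be
  integrable by itself.\<close>

definition compensator :: "real \<Rightarrow> real" where
  "compensator t = 1 / thorin_root \<sigma> \<theta> t * of_bool (1 \<le> thorin_root \<sigma> \<theta> t) -
    1 / thorin_root \<sigma> (- \<theta>) t * of_bool (1 \<le> thorin_root \<sigma> (- \<theta>) t)"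

lemma thorin_integrand_add:
  assumes t: "0 < t"
  shows "thorin_integrand z (thorin_root \<sigma> \<theta> t) + thorin_integrand (- z) (thorin_root \<sigma> (- \<theta>) t) =
    Ln (1 + bm_exponent \<sigma> \<theta> z / of_real t) + \<i> * of_real z * of_real (compensator t)"
  using thorin_root_pos[OF \<sigma> t, of \<theta>] thorin_root_pos[OF \<sigma> t, of "- \<theta>"]
  unfolding Ln_one_plus_bm_exponent[OF \<sigma> t]
  by (auto simp: thorin_integrand_def compensator_def algebra_simps)

lemma integrable_thorin_integrands:
  "integrable \<rho> (\<lambda>t. thorin_integrand z (thorin_root \<sigma> \<theta> t))"
  "integrable \<rho> (\<lambda>t. thorin_integrand z (thorin_root \<sigma> (- \<theta>) t))"
  using integrable_thorin_integrand[OF thorin_part_p, of z] integrable_thorin_integrand[OF thorin_part_m, of z]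
    thorin_sets[OF thorin_\<rho>]
  by (auto simp: integrable_distr_eq cong: measurable_cong_sets)

text \<open>Instead of an estimate: by \<open>thorin_integrand_add\<close> at z = 1 it is the
  imaginary part of a combination of functions already known to be integrable.\<close>

lemma integrable_compensator: "integrable \<rho> compensator"
proof -
  note [measurable_cong] = thorin_sets[OF thorin_\<rho>]
  have [measurable]: "compensator \<in> borel_measurable borel"
    unfolding compensator_def[abs_def] by measurable
  have "integrable \<rho> (\<lambda>t. thorin_integrand 1 (thorin_root \<sigma> \<theta> t) + thorin_integrand (- 1) (thorin_root \<sigma> (- \<theta>) t)
     - Ln (1 + bm_exponent \<sigma> \<theta> 1 / of_real t))"
    by (intro Bochner_Integration.integrable_diff Bochner_Integration.integrable_add integrable_thorin_integrands
        integrable_thorin_exponent[OF thorin_\<rho>] Re_bm_exponent)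
  then have "integrable \<rho> (\<lambda>t. Im (thorin_integrand 1 (thorin_root \<sigma> \<theta> t) + thorin_integrand (- 1) (thorin_root \<sigma> (- \<theta>) t)
     - Ln (1 + bm_exponent \<sigma> \<theta> 1 / of_real t)))"
    by (rule integrable_Im)
  then show ?thesis
  proof (rule integrable_cong_AE_imp)
    show "AE t in \<rho>. Im (thorin_integrand 1 (thorin_root \<sigma> \<theta> t) + thorin_integrand (- 1) (thorin_root \<sigma> (- \<theta>) t)
     - Ln (1 + bm_exponent \<sigma> \<theta> 1 / of_real t)) = compensator t"
      using thorin_AE_pos[OF thorin_\<rho>]
    proof eventually_elim
      case (elim t)
      show ?case using thorin_integrand_add[OF elim, of 1] by simp
    qed
  qed measurable
qed

lemma thorin_exponent_two_sided:
  "(\<integral>x. thorin_integrand z x \<partial>two_sided \<tau>\<^sub>p \<tau>\<^sub>m) = 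
    thorin_exponent \<rho> (bm_exponent \<sigma> \<theta> z) + \<i> * of_real z * of_real (\<integral>t. compensator t \<partial>\<rho>)"
proof -
  note s[measurable_cong] = thorin_sets[OF thorin_\<rho>]
  have [measurable]: "compensator \<in> borel_measurable borel"
    unfolding compensator_def[abs_def] by measurable
  have "(\<integral>x. thorin_integrand z x \<partial>two_sided \<tau>\<^sub>p \<tau>\<^sub>m) = (\<integral>x. thorin_integrand z x \<partial>\<tau>\<^sub>p) + (\<integral>x. thorin_integrand z (- x) \<partial>\<tau>\<^sub>m)"
    using thorin_partD(2)[OF thorin_part_p] thorin_partD(2)[OF thorin_part_m]
    by (intro integral_two_sided) (auto simp: thorin_integrand_uminus intro: integrable_thorin_integrand thorin_part_p thorin_part_m)
  also have "\<dots> = (\<integral>t. thorin_integrand z (thorin_root \<sigma> \<theta> t) \<partial>\<rho>) + (\<integral>t. thorin_integrand (- z) (thorin_root \<sigma> (- \<theta>) t) \<partial>\<rho>)"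
    by (simp add: integral_distr thorin_integrand_uminus)
  also have "\<dots> = (\<integral>t. thorin_integrand z (thorin_root \<sigma> \<theta> t) + thorin_integrand (- z) (thorin_root \<sigma> (- \<theta>) t) \<partial>\<rho>)"
    by (intro Bochner_Integration.integral_add[symmetric] integrable_thorin_integrands)
  also have "\<dots> = (\<integral>t. Ln (1 + bm_exponent \<sigma> \<theta> z / of_real t) + \<i> * of_real z * of_real (compensator t) \<partial>\<rho>)"
  proof (rule integral_cong_AE)
    show "AE t in \<rho>. thorin_integrand z (thorin_root \<sigma> \<theta> t) + thorin_integrand (- z) (thorin_root \<sigma> (- \<theta>) t) =
       Ln (1 + bm_exponent \<sigma> \<theta> z / of_real t) + \<i> * of_real z * of_real (compensator t)"
      using thorin_AE_pos[OF thorin_\<rho>] by eventually_elim (rule thorin_integrand_add)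
  qed measurable
  also have "\<dots> = thorin_exponent \<rho> (bm_exponent \<sigma> \<theta> z) + (\<integral>t. \<i> * of_real z * of_real (compensator t) \<partial>\<rho>)"
    unfolding thorin_exponent_def
    by (intro Bochner_Integration.integral_add integrable_thorin_exponent[OF thorin_\<rho>] Re_bm_exponent
        integrable_mult_right integrable_of_real integrable_compensator)
  also have "(\<integral>t. \<i> * of_real z * of_real (compensator t) \<partial>\<rho>) = \<i> * of_real z * of_real (\<integral>t. compensator t \<partial>\<rho>)"
    by simp
  finally show ?thesis .
qed

text \<open>Above both thresholds the two terms combine to \<theta> / t. Between them only the
  larger root has reached 1; it equals f(t) + |\<theta>|/\<sigma>^2 and is m for \<theta> > 0 and p
  for \<theta> < 0, which accounts for the factor \<open>- sgn \<theta>\<close>.\<close>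

lemma integral_compensator:
  "(\<integral>t. compensator t \<partial>\<rho>) = \<theta> * (LINT t:{\<sigma>\<^sup>2 / 2 + \<bar>\<theta>\<bar>..}|\<rho>. 1 / t)
     - sgn \<theta> * (LINT t:{\<sigma>\<^sup>2 / 2 - \<bar>\<theta>\<bar>..<\<sigma>\<^sup>2 / 2 + \<bar>\<theta>\<bar>}|\<rho>. 1 / (sqrt (\<theta>\<^sup>2 + 2 * \<sigma>\<^sup>2 * t) / \<sigma>\<^sup>2 + \<bar>\<theta>\<bar> / \<sigma>\<^sup>2))"
proof -
  note s[measurable_cong] = thorin_sets[OF thorin_\<rho>]
  define g where "g t = \<theta> * (indicator {\<sigma>\<^sup>2 / 2 + \<bar>\<theta>\<bar>..} t * (1 / t))" for t
  define h where "h t = sgn \<theta> * (indicator {\<sigma>\<^sup>2 / 2 - \<bar>\<theta>\<bar>..<\<sigma>\<^sup>2 / 2 + \<bar>\<theta>\<bar>} t * (1 / (sqrt (\<theta>\<^sup>2 + 2 * \<sigma>\<^sup>2 * t) / \<sigma>\<^sup>2 + \<bar>\<theta>\<bar> / \<sigma>\<^sup>2)))" for t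
  have [measurable]: "g \<in> borel_measurable borel" "h \<in> borel_measurable borel"
    unfolding g_def[abs_def] h_def[abs_def] by measurable
  have decomp: "compensator t = g t - h t" if t: "0 < t" for t
  proof -
    let ?p = "thorin_root \<sigma> \<theta> t" and ?m = "thorin_root \<sigma> (- \<theta>) t"
    have pos: "0 < ?p" "0 < ?m" using thorin_root_pos[OF \<sigma> t] by auto
    have ge: "1 \<le> ?p \<longleftrightarrow> \<sigma>\<^sup>2 / 2 + \<theta> \<le> t" "1 \<le> ?m \<longleftrightarrow> \<sigma>\<^sup>2 / 2 - \<theta> \<le> t"
      using thorin_root_ge_1_iff[OF \<sigma> t] by auto
    have d: "1 / ?p - 1 / ?m = \<theta> / t" by (rule inverse_thorin_root_diff[OF \<sigma> t pos(2)])
    have f: "?m = sqrt (\<theta>\<^sup>2 + 2 * \<sigma>\<^sup>2 * t) / \<sigma>\<^sup>2 + \<theta> / \<sigma>\<^sup>2" "?p = sqrt (\<theta>\<^sup>2 + 2 * \<sigma>\<^sup>2 * t) / \<sigma>\<^sup>2 + - \<theta> / \<sigma>\<^sup>2"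
      using \<sigma> by (simp_all add: thorin_root_def add_divide_distrib diff_divide_distrib)
    consider "0 < \<theta>" | "\<theta> = 0" | "\<theta> < 0" by linarith
    then show ?thesis
    proof cases
      case 1
      then have h: "h t = indicator {\<sigma>\<^sup>2 / 2 - \<theta>..<\<sigma>\<^sup>2 / 2 + \<theta>} t * (1 / ?m)" by (simp add: h_def f(1))
      consider "t < \<sigma>\<^sup>2 / 2 - \<theta>" | "\<sigma>\<^sup>2 / 2 - \<theta> \<le> t" "t < \<sigma>\<^sup>2 / 2 + \<theta>" | "\<sigma>\<^sup>2 / 2 + \<theta> \<le> t" by linarith
      then show ?thesis
        by cases (use 1 d in \<open>auto simp: compensator_def ge h g_def\<close>)
    next
      case 2
      then show ?thesis unfolding compensator_def g_def h_def by simp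
    next
      case 3
      then have h: "h t = - (indicator {\<sigma>\<^sup>2 / 2 + \<theta>..<\<sigma>\<^sup>2 / 2 - \<theta>} t * (1 / ?p))" by (simp add: h_def f(2))
      consider "t < \<sigma>\<^sup>2 / 2 + \<theta>" | "\<sigma>\<^sup>2 / 2 + \<theta> \<le> t" "t < \<sigma>\<^sup>2 / 2 - \<theta>" | "\<sigma>\<^sup>2 / 2 - \<theta> \<le> t" by linarith
      then show ?thesis
        by cases (use 3 d in \<open>auto simp: compensator_def ge h g_def\<close>)
    qed
  qed
  have gi: "integrable \<rho> g"
  \<comment> \<open>On the support of g one has t >= \<sigma>^2/2, hence 1 / t <= 2 / \<sigma>^2,
    which handles t <= 1; the summand 1 in the constant handles t > 1.\<close>
  proof (rule Bochner_Integration.integrable_bound[OF integrable_thorin_dominator[OF thorin_\<rho>, of "\<bar>\<theta>\<bar> * (1 + 2 / \<sigma>\<^sup>2)"]])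
    show "AE t in \<rho>. norm (g t) \<le> norm (thorin_dominator (\<bar>\<theta>\<bar> * (1 + 2 / \<sigma>\<^sup>2)) t)"
      using thorin_AE_pos[OF thorin_\<rho>]
    proof eventually_elim
      fix t :: real assume t: "0 < t"
      show "norm (g t) \<le> norm (thorin_dominator (\<bar>\<theta>\<bar> * (1 + 2 / \<sigma>\<^sup>2)) t)"
      proof (cases "\<sigma>\<^sup>2 / 2 + \<bar>\<theta>\<bar> \<le> t")
        case True
        then have n: "norm (g t) = \<bar>\<theta>\<bar> * (1 / t)" using t by (simp add: g_def abs_mult)
        have "\<sigma>\<^sup>2 / 2 \<le> t" using True by linarith
        then have "1 / t \<le> 1 / (\<sigma>\<^sup>2 / 2)" using \<sigma> t by (intro divide_left_mono) auto
        then have 1: "\<bar>\<theta>\<bar> * (1 / t) \<le> \<bar>\<theta>\<bar> * (1 + 2 / \<sigma>\<^sup>2)" by (intro mult_left_mono) auto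
        have "\<bar>\<theta>\<bar> * 1 \<le> \<bar>\<theta>\<bar> * (1 + 2 / \<sigma>\<^sup>2)" by (intro mult_left_mono) auto
        then have "\<bar>\<theta>\<bar> / t \<le> \<bar>\<theta>\<bar> * (1 + 2 / \<sigma>\<^sup>2) / t" using t by (intro divide_right_mono) auto
        with 1 show ?thesis unfolding n by (auto intro: order_trans[OF _ abs_ge_self])
      qed (simp add: g_def)
    qed
  qed auto
  have hi: "integrable \<rho> h"
  proof (rule integrable_cong_AE_imp[OF Bochner_Integration.integrable_diff[OF gi integrable_compensator]])
    show "AE t in \<rho>. g t - compensator t = h t"
      using thorin_AE_pos[OF thorin_\<rho>] by eventually_elim (simp add: decomp)
  qed measurable
  have [measurable]: "compensator \<in> borel_measurable borel"
    unfolding compensator_def[abs_def] by measurable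
  have "(\<integral>t. compensator t \<partial>\<rho>) = (\<integral>t. g t - h t \<partial>\<rho>)"
    by (rule integral_cong_AE) (use thorin_AE_pos[OF thorin_\<rho>] in \<open>auto elim!: eventually_mono simp: decomp\<close>)
  also have "\<dots> = (\<integral>t. g t \<partial>\<rho>) - (\<integral>t. h t \<partial>\<rho>)"
    by (rule Bochner_Integration.integral_diff[OF gi hi])
  also have "(\<integral>t. g t \<partial>\<rho>) = \<theta> * (LINT t:{\<sigma>\<^sup>2 / 2 + \<bar>\<theta>\<bar>..}|\<rho>. 1 / t)"
    unfolding g_def set_lebesgue_integral_def real_scaleR_def by (rule integral_mult_right_zero)
  also have "(\<integral>t. h t \<partial>\<rho>) = sgn \<theta> * (LINT t:{\<sigma>\<^sup>2 / 2 - \<bar>\<theta>\<bar>..<\<sigma>\<^sup>2 / 2 + \<bar>\<theta>\<bar>}|\<rho>. 1 / (sqrt (\<theta>\<^sup>2 + 2 * \<sigma>\<^sup>2 * t) / \<sigma>\<^sup>2 + \<bar>\<theta>\<bar> / \<sigma>\<^sup>2))"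
    unfolding h_def set_lebesgue_integral_def real_scaleR_def by (rule integral_mult_right_zero)
  finally show ?thesis .
qed

theorem has_thorin_triplet_Y:
  assumes b: "b = \<theta> * a + \<theta> * (LINT t:{\<sigma>\<^sup>2 / 2 + \<bar>\<theta>\<bar>..}|\<rho>. 1 / t)
     - sgn \<theta> * (LINT t:{\<sigma>\<^sup>2 / 2 - \<bar>\<theta>\<bar>..<\<sigma>\<^sup>2 / 2 + \<bar>\<theta>\<bar>}|\<rho>. 1 / (sqrt (\<theta>\<^sup>2 + 2 * \<sigma>\<^sup>2 * t) / \<sigma>\<^sup>2 + \<bar>\<theta>\<bar> / \<sigma>\<^sup>2))"
  shows "has_thorin_triplet (completion M) Y b (a * \<sigma>\<^sup>2) \<tau>\<^sub>p \<tau>\<^sub>m"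
proof -
  have b': "b = \<theta> * a + (\<integral>t. compensator t \<partial>\<rho>)" using b by (simp add: integral_compensator)
  have null: "emeasure \<eta> {..0} = 0" if "thorin_part \<eta>" for \<eta>
  proof -
    have "emeasure \<eta> {..0} = emeasure \<eta> {}"
      using thorin_partD(2)[OF that] by (intro emeasure_eq_AE) (auto simp: thorin_partD(1)[OF that])
    then show ?thesis by simp
  qed
  note p = thorin_partD[OF thorin_part_p] and m = thorin_partD[OF thorin_part_m]
  have n: "(\<integral>\<^sup>+x. G x \<partial>two_sided \<tau>\<^sub>p \<tau>\<^sub>m) = (\<integral>\<^sup>+x. G x \<partial>\<tau>\<^sub>p) + (\<integral>\<^sup>+x. G (- x) \<partial>\<tau>\<^sub>m)"
    if "G \<in> borel_measurable borel" for G
    by (rule nn_integral_two_sided[OF p(1) m(1) p(2) m(2) that])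
  \<comment> \<open>The sign \<open>s\<close> is -1 for the reflected half, where integration over
    the glued measure produces indicators evaluated at -x.\<close>
  have c1: "(\<integral>\<^sup>+x. ennreal (1 + \<bar>ln \<bar>x\<bar>\<bar>) * indicator {x. \<bar>x\<bar> \<le> 1} (s * x) \<partial>\<eta>) < \<infinity>"
    "(\<integral>\<^sup>+x. ennreal (1 / x\<^sup>2) * indicator {x. \<bar>x\<bar> > 1} (s * x) \<partial>\<eta>) < \<infinity>" if "thorin_part \<eta>" "s = 1 \<or> s = - 1" for \<eta> and s :: real
  proof -
    have "(\<integral>\<^sup>+x. ennreal (1 + \<bar>ln \<bar>x\<bar>\<bar>) * indicator {x. \<bar>x\<bar> \<le> 1} (s * x) \<partial>\<eta>) = (\<integral>\<^sup>+x\<in>{0<..1}. ennreal (1 + \<bar>ln x\<bar>) \<partial>\<eta>)"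
      using thorin_partD(2)[OF that(1)] that(2)
      by (intro nn_integral_cong_AE) (auto elim!: eventually_mono simp: indicator_def)
    then show "(\<integral>\<^sup>+x. ennreal (1 + \<bar>ln \<bar>x\<bar>\<bar>) * indicator {x. \<bar>x\<bar> \<le> 1} (s * x) \<partial>\<eta>) < \<infinity>"
      using thorin_partD(3)[OF that(1)] by simp
    have "(\<integral>\<^sup>+x. ennreal (1 / x\<^sup>2) * indicator {x. \<bar>x\<bar> > 1} (s * x) \<partial>\<eta>) = (\<integral>\<^sup>+x\<in>{1<..}. ennreal (1 / x\<^sup>2) \<partial>\<eta>)"
      using thorin_partD(2)[OF that(1)] that(2)
      by (intro nn_integral_cong_AE) (auto elim!: eventually_mono simp: indicator_def)
    then show "(\<integral>\<^sup>+x. ennreal (1 / x\<^sup>2) * indicator {x. \<bar>x\<bar> > 1} (s * x) \<partial>\<eta>) < \<infinity>"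
      using thorin_partD(4)[OF that(1)] by simp
  qed
  have fin: "(\<integral>\<^sup>+x\<in>{x. \<bar>x\<bar> \<le> 1}. ennreal (1 + \<bar>ln \<bar>x\<bar>\<bar>) \<partial>two_sided \<tau>\<^sub>p \<tau>\<^sub>m) +
      (\<integral>\<^sup>+x\<in>{x. \<bar>x\<bar> > 1}. ennreal (1 / x\<^sup>2) \<partial>two_sided \<tau>\<^sub>p \<tau>\<^sub>m) < \<infinity>"
  proof -
    have "(\<integral>\<^sup>+x\<in>{x. \<bar>x\<bar> \<le> 1}. ennreal (1 + \<bar>ln \<bar>x\<bar>\<bar>) \<partial>two_sided \<tau>\<^sub>p \<tau>\<^sub>m) < \<infinity>"
      using c1(1)[OF thorin_part_p, of 1] c1(1)[OF thorin_part_m, of "- 1"] by (subst n) auto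
    moreover have "(\<integral>\<^sup>+x\<in>{x. \<bar>x\<bar> > 1}. ennreal (1 / x\<^sup>2) \<partial>two_sided \<tau>\<^sub>p \<tau>\<^sub>m) < \<infinity>"
      using c1(2)[OF thorin_part_p, of 1] c1(2)[OF thorin_part_m, of "- 1"] by (subst n) auto
    ultimately show ?thesis by simp
  qed
  have "char (distr (completion M) borel (Y 1)) z =
        exp (\<i> * of_real (z * b) - of_real (a * \<sigma>\<^sup>2 / 2 * z\<^sup>2) -
          (CLINT x|two_sided \<tau>\<^sub>p \<tau>\<^sub>m. Ln (1 - \<i> * of_real z / of_real x) +
             \<i> * of_real z / of_real x * indicator {x. \<bar>x\<bar> \<ge> 1} x))" for z
  proof -
    define S where "S = thorin_exponent \<rho> (bm_exponent \<sigma> \<theta> z)"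
    have I: "(CLINT x|two_sided \<tau>\<^sub>p \<tau>\<^sub>m. Ln (1 - \<i> * of_real z / of_real x) +
             \<i> * of_real z / of_real x * indicator {x. \<bar>x\<bar> \<ge> 1} x) = S + \<i> * of_real z * of_real (\<integral>t. compensator t \<partial>\<rho>)"
      using thorin_exponent_two_sided[of z] unfolding thorin_integrand_def S_def .
    have "- (of_real a * bm_exponent \<sigma> \<theta> z) - S = \<i> * of_real (z * b) - of_real (a * \<sigma>\<^sup>2 / 2 * z\<^sup>2) - (S + \<i> * of_real z * of_real (\<integral>t. compensator t \<partial>\<rho>))"
      by (simp add: b' bm_exponent_def algebra_simps)
    then show ?thesis unfolding I char_Y_1 S_def[symmetric] by (rule arg_cong)
  qed
  with fin show ?thesis
    unfolding has_thorin_triplet_def Let_def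
    using a_nonneg null[OF thorin_part_p] null[OF thorin_part_m] by auto
qed

end

section \<open>The Levy measure of a Thorin measure\<close>

lemma nn_integral_exp_decay:
  assumes r: "0 < r"
  shows "(\<integral>\<^sup>+u. ennreal (indicator {0<..} u * exp (- (r * u))) \<partial>lborel) = ennreal (1 / r)"
proof -
  have "ennreal (indicator {0<..} u * exp (- (r * u))) = ennreal (1 / r) * ennreal (gamma_density 1 r u)" for u
  proof -
    have eq: "indicator {0<..} u * exp (- (r * u)) = 1 / r * gamma_density 1 r u"
      using r by (simp add: gamma_density_def indicator_def)
    show ?thesis unfolding eq using r by (intro ennreal_mult) (auto simp: gamma_density_nonneg)
  qed
  then have "(\<integral>\<^sup>+u. ennreal (indicator {0<..} u * exp (- (r * u))) \<partial>lborel) = (\<integral>\<^sup>+u. ennreal (1 / r) * ennreal (gamma_density 1 r u) \<partial>lborel)"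
    by simp
  also have "\<dots> = ennreal (1 / r)"
    using nn_integral_gamma_density[of 1 r] r by (subst nn_integral_cmult) auto
  finally show ?thesis .
qed

lemma integrable_exp_decay:
  "0 < (r::real) \<Longrightarrow> integrable lborel (\<lambda>u. indicator {0<..} u * exp (- (r * u)))"
  using nn_integral_exp_decay[of r] by (intro integrableI_nonneg) (auto simp: indicator_def)

lemma integral_cexp_decay:
  assumes c: "0 < Re c"
  shows "integrable lborel (\<lambda>u. indicat_real {0<..} u *\<^sub>R exp (- (c * of_real u)))" (is ?int)
    and "(\<integral>u. indicat_real {0<..} u *\<^sub>R exp (- (c * of_real u)) \<partial>lborel) = 1 / c"
proof -
  show int: ?int
    by (rule Bochner_Integration.integrable_bound[OF integrable_exp_decay[OF c]]) (auto simp: indicator_def)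
  \<comment> \<open>The real part of c is taken as the rate of an exponential law, and the purely
    imaginary rest is the argument of its Laplace transform, so \<open>gamma_laplace\<close> applies
    on the boundary of the half-plane.\<close>
  let ?r = "Re c" and ?w = "c - of_real (Re c)"
  have "(\<integral>v. exp (- (?w * complex_of_real v)) \<partial>density lborel (\<lambda>v. ennreal (gamma_density 1 ?r v))) =
    (\<integral>v. gamma_density 1 ?r v *\<^sub>R exp (- (?w * complex_of_real v)) \<partial>lborel)"
    by (rule integral_density) (auto simp: gamma_density_nonneg)
  also have "\<dots> = (\<integral>v. of_real ?r * (indicat_real {0<..} v *\<^sub>R exp (- (c * of_real v))) \<partial>lborel)"
  proof (rule Bochner_Integration.integral_cong[OF refl])
    fix v :: real
    have "complex_of_real (exp (- (?r * v))) * exp (- (?w * complex_of_real v)) = exp (- (c * of_real v))"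
      by (simp add: exp_of_real[symmetric] exp_add[symmetric] algebra_simps)
    then show "gamma_density 1 ?r v *\<^sub>R exp (- (?w * complex_of_real v)) = of_real ?r * (indicat_real {0<..} v *\<^sub>R exp (- (c * of_real v)))"
      using c by (simp add: gamma_density_def indicator_def scaleR_conv_of_real)
  qed
  also have "\<dots> = of_real ?r * (\<integral>v. indicat_real {0<..} v *\<^sub>R exp (- (c * of_real v)) \<partial>lborel)"
    by (rule integral_mult_right_zero)
  finally have "of_real ?r * (\<integral>v. indicat_real {0<..} v *\<^sub>R exp (- (c * of_real v)) \<partial>lborel) = exp (- Ln (1 + ?w / of_real ?r))"
    using gamma_laplace[of 1 ?r ?w] c by simp
  also have "1 + ?w / of_real ?r = c / of_real ?r" using c by (simp add: field_simps)
  also have "exp (- Ln (c / of_real ?r)) = of_real ?r / c"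
    using c by (subst exp_minus, subst exp_Ln) auto
  finally have e: "of_real ?r * (\<integral>v. indicat_real {0<..} v *\<^sub>R exp (- (c * of_real v)) \<partial>lborel) = of_real ?r * (1 / c)"
    by simp
  have "complex_of_real ?r \<noteq> 0" using c by auto
  from mult_left_cancel[OF this, THEN iffD1, OF e]
  show "(\<integral>u. indicat_real {0<..} u *\<^sub>R exp (- (c * of_real u)) \<partial>lborel) = 1 / c" .
qed

lemma norm_exp_minus_one_le: "norm (exp y - 1) \<le> exp (max 0 (Re y)) * norm (y :: complex)"
proof -
  have "norm (exp y - exp 0) \<le> exp (max 0 (Re y)) * norm (y - 0)"
  proof (rule field_differentiable_bound[where S="{v. Re v \<le> max 0 (Re y)}" and f'=exp])
    show "convex {v. Re v \<le> max 0 (Re y)}" by (rule convex_halfspace_Re_le)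
  qed (auto intro: has_field_derivative_at_within)
  then show ?thesis by simp
qed

definition frullani_integrand :: "real \<Rightarrow> complex \<Rightarrow> real \<Rightarrow> complex" where
  "frullani_integrand x w u = indicat_real {0<..} u *\<^sub>R ((1 - exp (- (w * of_real u))) * of_real (exp (- (x * u)) / u))"

lemma frullani_integrand_measurable[measurable]: "frullani_integrand x w \<in> borel_measurable borel"
  unfolding frullani_integrand_def[abs_def] by measurable

lemma integrable_frullani:
  assumes x: "0 < x" and w: "- x < Re w"
  shows "integrable lborel (frullani_integrand x w)"
proof (rule Bochner_Integration.integrable_bound)
  show "integrable lborel (\<lambda>u. norm w * (indicator {0<..} u * exp (- (x * u)) + indicator {0<..} u * exp (- ((x + Re w) * u))))"
    by (intro integrable_mult_right Bochner_Integration.integrable_add integrable_exp_decay) (use x w in auto)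
  show "AE u in lborel. norm (frullani_integrand x w u) \<le> norm (norm w * (indicator {0<..} u * exp (- (x * u)) + indicator {0<..} u * exp (- ((x + Re w) * u))))"
  proof (rule AE_I2)
    fix u :: real
    show "norm (frullani_integrand x w u) \<le> norm (norm w * (indicator {0<..} u * exp (- (x * u)) + indicator {0<..} u * exp (- ((x + Re w) * u))))"
    proof (cases "0 < u")
      case True
      let ?y = "- (w * of_real u)"
      have "norm (1 - exp ?y) \<le> exp (max 0 (Re ?y)) * norm ?y"
        using norm_exp_minus_one_le[of ?y] by (simp only: norm_minus_commute)
      also have "\<dots> \<le> (1 + exp (- (Re w * u))) * norm ?y"
        by (intro mult_right_mono) (auto simp: max_def add_increasing)
      also have "norm ?y = norm w * u" using True by (simp add: norm_mult)
      finally have "norm (1 - exp ?y) * (exp (- (x * u)) / u) \<le> (1 + exp (- (Re w * u))) * (norm w * u) * (exp (- (x * u)) / u)"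
        using True by (intro mult_right_mono) auto
      also have "\<dots> = norm w * (exp (- (x * u)) + exp (- (Re w * u)) * exp (- (x * u)))"
        using True by (simp add: field_simps)
      also have "exp (- (Re w * u)) * exp (- (x * u)) = exp (- ((x + Re w) * u))"
        by (simp add: exp_add[symmetric] algebra_simps)
      finally show ?thesis using True by (simp add: frullani_integrand_def norm_mult norm_divide)
    qed (simp add: frullani_integrand_def)
  qed
qed measurable

text \<open>Differentiation in w removes the factor 1 / u, so both sides have derivative 1 / (x + w)
  on the half-plane Re w > -x; they agree at w = 0. This half-plane is open around 0 and contains
  the imaginary axis, where the formula is used.\<close>

lemma frullani:
  assumes x: "0 < x" and w: "- x < Re w"
  shows "(\<integral>u. frullani_integrand x w u \<partial>lborel) = Ln (1 + w / of_real x)"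
proof -
  let ?S = "{w. - x < Re w}" and ?F = "\<lambda>w. \<integral>u. frullani_integrand x w u \<partial>lborel"
  have dF: "(?F has_field_derivative 1 / (of_real x + w)) (at w)" if w: "w \<in> ?S" for w
  proof -
    define r where "r = (Re w + x) / 2"
    have r: "0 < r" using w by (simp add: r_def)
    have bl: "r < Re v + x" if "v \<in> ball w r" for v
      using that abs_Re_le_cmod[of "w - v"] by (auto simp: dist_norm r_def)
    have d: "((\<lambda>v. frullani_integrand x v u) has_field_derivative indicat_real {0<..} u *\<^sub>R exp (- ((of_real x + v) * of_real u))) (at v)" for v u
    proof (cases "0 < u")
      case True
      have "((\<lambda>v. (1 - exp (- (v * of_real u))) * of_real (exp (- (x * u)) / u)) has_field_derivative
         exp (- (v * of_real u)) * of_real u * of_real (exp (- (x * u)) / u)) (at v)"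
        by (auto intro!: derivative_eq_intros)
      also have "exp (- (v * of_real u)) * of_real u * of_real (exp (- (x * u)) / u) = exp (- ((of_real x + v) * of_real u))"
        using True by (simp add: exp_of_real[symmetric] exp_add[symmetric] algebra_simps)
      finally show ?thesis using True by (simp add: frullani_integrand_def)
    qed (simp add: frullani_integrand_def)
    have "(?F has_field_derivative (\<integral>u. indicat_real {0<..} u *\<^sub>R exp (- ((of_real x + w) * of_real u)) \<partial>lborel)) (at w)"
    proof (rule has_field_derivative_lebesgue_integral[OF r _ _ integrable_exp_decay[OF r]])
      show "integrable lborel (frullani_integrand x v)" if "v \<in> ball w r" for v
        by (rule integrable_frullani[OF x]) (use bl[OF that] r in auto)
      show "AE u in lborel. \<forall>v\<in>ball w r. \<exists>d. ((\<lambda>v. frullani_integrand x v u) has_field_derivative d) (at v) \<and> norm d \<le> indicator {0<..} u * exp (- (r * u))"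
      proof (intro AE_I2 ballI)
        fix u v assume v: "v \<in> ball w r"
        have "norm (indicat_real {0<..} u *\<^sub>R exp (- ((of_real x + v) * of_real u))) \<le> indicator {0<..} u * exp (- (r * u))"
          using bl[OF v] by (auto simp: indicator_def add.commute intro: mult_right_mono)
        then show "\<exists>d. ((\<lambda>v. frullani_integrand x v u) has_field_derivative d) (at v) \<and> norm d \<le> indicator {0<..} u * exp (- (r * u))"
          using d[of u v] by blast
      qed
    qed (auto intro: d)
    then show ?thesis using integral_cexp_decay(2)[of "of_real x + w"] w by simp
  qed
  have dL: "((\<lambda>w. Ln (1 + w / of_real x)) has_field_derivative 1 / (of_real x + w)) (at w)" if w: "w \<in> ?S" for w
  proof -
    have "0 < Re (1 + w / of_real x)" using w x by (simp add: field_simps)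
    then have "1 + w / of_real x \<notin> \<real>\<^sub>\<le>\<^sub>0" "1 + w / of_real x \<noteq> 0"
      by (simp_all add: complex_nonpos_Reals_iff complex_eq_iff)
    then show ?thesis using x by (auto intro!: derivative_eq_intros simp: field_simps)
  qed
  have "\<exists>c. \<forall>w\<in>?S. ?F w - Ln (1 + w / of_real x) = c"
  proof (rule has_field_derivative_zero_constant)
    show "convex ?S" by (rule convex_halfspace_Re_gt)
    show "((\<lambda>w. ?F w - Ln (1 + w / of_real x)) has_field_derivative 0) (at w within ?S)" if "w \<in> ?S" for w
      using DERIV_diff[OF dF[OF that] dL[OF that]] by (simp add: has_field_derivative_at_within)
  qed
  then obtain c where c: "\<And>w. w \<in> ?S \<Longrightarrow> ?F w - Ln (1 + w / of_real x) = c" by blast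
  have "c = 0" using c[of 0] x by (simp add: frullani_integrand_def)
  then show ?thesis using c[of w] w by simp
qed

text \<open>The Levy density of the gamma subordinator with rate x and unit shape.\<close>

definition levy_kernel :: "real \<Rightarrow> real \<Rightarrow> real" where
  "levy_kernel x u = indicator {0<..} u * exp (- (x * u)) / u"

lemma levy_kernel_nonneg: "0 \<le> levy_kernel x u"
  by (simp add: levy_kernel_def indicator_def)

lemma levy_kernel_measurable[measurable]: "(\<lambda>p. levy_kernel (fst p) (snd p)) \<in> borel_measurable (borel \<Otimes>\<^sub>M borel)"
  unfolding levy_kernel_def by measurable

lemma levy_kernel_measurable'[measurable]: "levy_kernel x \<in> borel_measurable borel"
  unfolding levy_kernel_def[abs_def] by measurable

text \<open>The function 1 - exp(-u) has the order of min 1 u but, unlike it, can be integrated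
  against the kernel in closed form.\<close>

lemma min_one_square_le: 
  assumes "0 < (u::real)"
  shows "min 1 (u\<^sup>2) \<le> 2 * (1 - exp (- u)) * min 1 u"
proof -
  \<comment> \<open>From 1 + u <= exp u; it yields 1 - exp(-u) >= u / 2 for u <= 1 and >= 1/2
    beyond.\<close>
  have e: "exp (- u) \<le> 1 / (1 + u)"
    using exp_ge_add_one_self[of u] assms by (simp add: exp_minus inverse_eq_divide frac_le)
  show ?thesis
  proof (cases "u \<le> 1")
    case True
    have "u * u \<le> u" using True assms by (simp add: mult_left_le)
    then have "1 / (1 + u) \<le> 1 - u / 2" using assms by (simp add: field_simps)
    with e have "exp (- u) \<le> 1 - u / 2" by (rule order_trans)
    then have "u \<le> 2 * (1 - exp (- u))" by simp
    then have "u * u \<le> 2 * (1 - exp (- u)) * u" using assms by (intro mult_right_mono) auto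
    moreover have "min 1 (u\<^sup>2) \<le> u * u" by (simp add: power2_eq_square)
    moreover have "min 1 u = u" using True by simp
    ultimately show ?thesis by simp
  next
    case False
    have "1 / (1 + u) \<le> 1 / 2" using False by (simp add: frac_le)
    with e have "exp (- u) \<le> 1 / 2" by (rule order_trans)
    then have "1 \<le> 2 * (1 - exp (- u))" by simp
    then show ?thesis using False by (simp add: min_def)
  qed
qed

text \<open>In \<open>min_one_square_le\<close> the factor min 1 u is replaced by 1 for x <= 1,
  giving the Frullani value ln (1 + 1/x), and by u for x > 1, giving 1/x - 1/(x + 1) <= 1/x^2. These
  are the two weights of \<open>thorin_part\<close>.\<close>

lemma nn_integral_min_levy_kernel_le:
  assumes x: "0 < x"
  shows "(\<integral>\<^sup>+u. ennreal (min 1 (u\<^sup>2)) * ennreal (levy_kernel x u) \<partial>lborel) \<le> 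
    ennreal 2 * (ennreal (1 + \<bar>ln x\<bar>) * indicator {0<..1} x + ennreal (1 / x\<^sup>2) * indicator {1<..} x)"
proof (cases "x \<le> 1")
  case True
  have i: "integrable lborel (frullani_integrand x 1)" by (rule integrable_frullani[OF x]) (use x in simp)
  have Re: "Re (frullani_integrand x 1 u) = (1 - exp (- u)) * levy_kernel x u" for u
    by (simp add: frullani_integrand_def levy_kernel_def exp_of_real flip: of_real_minus)
  have "(\<integral>\<^sup>+u. ennreal ((1 - exp (- u)) * levy_kernel x u) \<partial>lborel) = ennreal (\<integral>u. (1 - exp (- u)) * levy_kernel x u \<partial>lborel)"
    using integrable_Re[OF i] unfolding Re
    by (intro nn_integral_eq_integral) (auto simp: levy_kernel_def indicator_def)
  also have "(\<integral>u. (1 - exp (- u)) * levy_kernel x u \<partial>lborel) = Re (Ln (1 + 1 / of_real x))"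
    using integral_Re[OF i] unfolding Re frullani[OF x, of 1] using x frullani[OF x, of 1] by simp
  also have "1 + 1 / complex_of_real x = of_real ((1 + x) / x)" using x by (simp add: field_simps)
  also have "Re (Ln (of_real ((1 + x) / x))) = ln ((1 + x) / x)" using x by (subst Ln_of_real) auto
  also have "\<dots> \<le> 1 + \<bar>ln x\<bar>"
    using x True ln_add_one_self_le_self[of x] by (simp add: ln_div)
  finally have A: "(\<integral>\<^sup>+u. ennreal ((1 - exp (- u)) * levy_kernel x u) \<partial>lborel) \<le> ennreal (1 + \<bar>ln x\<bar>)"
    by (simp add: ennreal_leI)
  have "(\<integral>\<^sup>+u. ennreal (min 1 (u\<^sup>2)) * ennreal (levy_kernel x u) \<partial>lborel) \<le> (\<integral>\<^sup>+u. ennreal 2 * ennreal ((1 - exp (- u)) * levy_kernel x u) \<partial>lborel)"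
  proof (rule nn_integral_mono)
    fix u :: real
    show "ennreal (min 1 (u\<^sup>2)) * ennreal (levy_kernel x u) \<le> ennreal 2 * ennreal ((1 - exp (- u)) * levy_kernel x u)"
    proof (cases "0 < u")
      case u: True
      have "min 1 (u\<^sup>2) \<le> 2 * (1 - exp (- u)) * 1"
        using min_one_square_le[OF u] by (rule order_trans) (intro mult_left_mono, use u in auto)
      then have "min 1 (u\<^sup>2) * levy_kernel x u \<le> 2 * (1 - exp (- u)) * 1 * levy_kernel x u"
        by (intro mult_right_mono levy_kernel_nonneg)
      also have "\<dots> = 2 * ((1 - exp (- u)) * levy_kernel x u)" by simp
      finally have "ennreal (min 1 (u\<^sup>2) * levy_kernel x u) \<le> ennreal (2 * ((1 - exp (- u)) * levy_kernel x u))"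
        by (rule ennreal_leI)
      then show ?thesis using u levy_kernel_nonneg by (simp only: ennreal_mult'' ennreal_mult'[of 2] zero_le_numeral)
    qed (simp add: levy_kernel_def)
  qed
  also have "\<dots> = ennreal 2 * (\<integral>\<^sup>+u. ennreal ((1 - exp (- u)) * levy_kernel x u) \<partial>lborel)"
    by (rule nn_integral_cmult) measurable
  also have "\<dots> \<le> ennreal 2 * ennreal (1 + \<bar>ln x\<bar>)" using A by (intro mult_left_mono) auto
  finally show ?thesis using True x by simp
next
  case False
  have i: "integrable lborel (\<lambda>u. indicator {0<..} u * exp (- (x * u)) - indicator {0<..} u * exp (- ((x + 1) * u)))"
    by (intro Bochner_Integration.integrable_diff integrable_exp_decay) (use x in auto)
  have v: "(\<integral>u. indicator {0<..} u * exp (- (r * u)) \<partial>lborel) = 1 / r" if "0 < r" for r :: real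
    using nn_integral_exp_decay[OF that] that by (subst integral_eq_nn_integral) (auto simp: indicator_def)
  let ?d = "\<lambda>u. indicator {0<..} u * exp (- (x * u)) - indicator {0<..} u * exp (- ((x + 1) * u)) :: real"
  have d: "?d u = (1 - exp (- u)) * (u * levy_kernel x u)" for u
    by (simp add: levy_kernel_def indicator_def algebra_simps exp_add[symmetric])
  have "(\<integral>\<^sup>+u. ennreal (?d u) \<partial>lborel) = ennreal (\<integral>u. ?d u \<partial>lborel)"
    by (intro nn_integral_eq_integral i AE_I2) (auto simp: indicator_def)
  also have "(\<integral>u. ?d u \<partial>lborel) = 1 / x - 1 / (x + 1)"
    using x by (subst Bochner_Integration.integral_diff) (auto intro: integrable_exp_decay simp: v simp del: distrib_right)
  also have "1 / x - 1 / (x + 1) \<le> 1 / x\<^sup>2"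
  proof -
    have "1 / x - 1 / (x + 1) = 1 / (x * (x + 1))" using x by (simp add: field_simps)
    also have "\<dots> \<le> 1 / (x * x)" using x by (intro divide_left_mono) auto
    finally show ?thesis by (simp add: power2_eq_square)
  qed
  finally have A: "(\<integral>\<^sup>+u. ennreal (?d u) \<partial>lborel) \<le> ennreal (1 / x\<^sup>2)"
    by (simp add: ennreal_leI)
  have "(\<integral>\<^sup>+u. ennreal (min 1 (u\<^sup>2)) * ennreal (levy_kernel x u) \<partial>lborel) \<le> (\<integral>\<^sup>+u. ennreal 2 * ennreal (?d u) \<partial>lborel)"
  proof (rule nn_integral_mono)
    fix u :: real
    show "ennreal (min 1 (u\<^sup>2)) * ennreal (levy_kernel x u) \<le> ennreal 2 * ennreal (?d u)"
    proof (cases "0 < u")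
      case u: True
      have "min 1 (u\<^sup>2) \<le> 2 * (1 - exp (- u)) * u"
        using min_one_square_le[OF u] by (rule order_trans) (intro mult_left_mono, use u in auto)
      then have "min 1 (u\<^sup>2) * levy_kernel x u \<le> 2 * (1 - exp (- u)) * u * levy_kernel x u"
        by (intro mult_right_mono levy_kernel_nonneg)
      also have "\<dots> = 2 * ((1 - exp (- u)) * (u * levy_kernel x u))" by simp
      finally have "ennreal (min 1 (u\<^sup>2) * levy_kernel x u) \<le> ennreal (2 * ((1 - exp (- u)) * (u * levy_kernel x u)))"
        by (rule ennreal_leI)
      then show ?thesis unfolding d using u levy_kernel_nonneg by (simp only: ennreal_mult'' ennreal_mult'[of 2] zero_le_numeral)
    qed (simp add: levy_kernel_def)
  qed
  also have "\<dots> = ennreal 2 * (\<integral>\<^sup>+u. ennreal (?d u) \<partial>lborel)"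
    by (rule nn_integral_cmult) measurable
  also have "\<dots> \<le> ennreal 2 * ennreal (1 / x\<^sup>2)" using A by (intro mult_left_mono) auto
  finally show ?thesis using False x by simp
qed

definition levy_integrand :: "real \<Rightarrow> real \<Rightarrow> complex" where
  "levy_integrand z u = iexp (z * u) - 1 - \<i> * of_real (z * u * indicator {-1..1} u)"

lemma levy_integrand_measurable[measurable]: "levy_integrand z \<in> borel_measurable borel"
  unfolding levy_integrand_def[abs_def] by measurable

lemma levy_integrand_uminus: "levy_integrand z (- u) = levy_integrand (- z) u"
  by (auto simp: levy_integrand_def indicator_def)

lemma norm_levy_integrand_le: "norm (levy_integrand z u) \<le> (2 + z\<^sup>2) * min 1 (u\<^sup>2)"
proof (cases "\<bar>u\<bar> \<le> 1")
  case True
  have "norm (levy_integrand z u) = norm (iexp (z * u) - (\<Sum>k\<le>1. (\<i> * (z * u)) ^ k / fact k))"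
    using True by (simp add: levy_integrand_def indicator_def abs_le_iff algebra_simps)
  also have "\<dots> \<le> \<bar>z * u\<bar> ^ 2 / fact 2"
    using iexp_approx1[of "z * u" 1] by (simp add: numeral_2_eq_2)
  also have "\<dots> \<le> (2 + z\<^sup>2) * u\<^sup>2"
    by (simp add: power_mult_distrib distrib_right)
  finally show ?thesis using True by (simp add: abs_square_le_1)
next
  case False
  then have "levy_integrand z u = iexp (z * u) - 1" by (auto simp: levy_integrand_def indicator_def)
  then have "norm (levy_integrand z u) \<le> 2"
    using norm_triangle_ineq4[of "iexp (z * u)" 1] by simp
  also have "\<dots> \<le> (2 + z\<^sup>2) * 1" by simp
  also have "1 = min 1 (u\<^sup>2)" using False abs_square_le_1[of u] by (auto simp: min_def)
  finally show ?thesis .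
qed

lemma integrable_levy_integrand:
  assumes \<nu>: "is_levy_measure \<nu>"
  shows "integrable \<nu> (levy_integrand z)"
proof (rule Bochner_Integration.integrable_bound)
  have s[measurable_cong]: "sets \<nu> = sets borel" using \<nu> by (simp add: is_levy_measure_def)
  show "levy_integrand z \<in> borel_measurable \<nu>" by measurable
  have "integrable \<nu> (\<lambda>u. min 1 (u\<^sup>2))"
    using \<nu> by (intro integrableI_nonneg) (auto simp: is_levy_measure_def)
  then show "integrable \<nu> (\<lambda>u. (2 + z\<^sup>2) * min 1 (u\<^sup>2))" by (rule integrable_mult_right)
  show "AE u in \<nu>. norm (levy_integrand z u) \<le> norm ((2 + z\<^sup>2) * min 1 (u\<^sup>2))"
    by (intro AE_I2 order_trans[OF norm_levy_integrand_le]) simp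
qed

text \<open>The Levy measure with density \<open>u \<mapsto> (\<integral> exp (- x * u) \<eta>(dx)) / u\<close> on the positive half-line, written
  as a marginal so that no finiteness of the inner integral is needed.\<close>

definition gamma_levy :: "real measure \<Rightarrow> real measure" where
  "gamma_levy \<eta> = distr (density (\<eta> \<Otimes>\<^sub>M lborel) (\<lambda>p. ennreal (levy_kernel (fst p) (snd p)))) borel snd"

lemma sigma_finite_thorin_part:
  assumes \<eta>: "thorin_part \<eta>"
  shows "sigma_finite_measure \<eta>"
proof
  note s = thorin_partD(1)[OF \<eta>]
  let ?A = "\<lambda>n::nat. {0<..1} \<union> {1<..real n}"
  have f1: "emeasure \<eta> {0<..1} < \<infinity>"
  proof -
    have "emeasure \<eta> {0<..1} = (\<integral>\<^sup>+x. indicator {0<..1} x \<partial>\<eta>)" by (simp add: s)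
    also have "\<dots> \<le> (\<integral>\<^sup>+x\<in>{0<..1}. ennreal (1 + \<bar>ln x\<bar>) \<partial>\<eta>)"
      by (intro nn_integral_mono) (auto simp: indicator_def)
    finally show ?thesis using thorin_partD(3)[OF \<eta>] by simp
  qed
  have f2: "emeasure \<eta> {1<..real n} < \<infinity>" for n
  proof -
    have "emeasure \<eta> {1<..real n} = (\<integral>\<^sup>+x. indicator {1<..real n} x \<partial>\<eta>)" by (simp add: s)
    also have "\<dots> \<le> (\<integral>\<^sup>+x. ennreal ((real n)\<^sup>2) * (ennreal (1 / x\<^sup>2) * indicator {1<..} x) \<partial>\<eta>)"
    proof (rule nn_integral_mono)
      fix x :: real
      show "indicator {1<..real n} x \<le> ennreal ((real n)\<^sup>2) * (ennreal (1 / x\<^sup>2) * indicator {1<..} x)"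
      proof (cases "x \<in> {1<..real n}")
        case True
        then have "x\<^sup>2 \<le> (real n)\<^sup>2" by (intro power_mono) auto
        then have "1 \<le> (real n)\<^sup>2 * (1 / x\<^sup>2)" using True by (simp add: field_simps)
        then have "ennreal 1 \<le> ennreal ((real n)\<^sup>2 * (1 / x\<^sup>2))" by (rule ennreal_leI)
        also have "\<dots> = ennreal ((real n)\<^sup>2) * ennreal (1 / x\<^sup>2)" by (rule ennreal_mult) auto
        finally show ?thesis using True by simp
      qed simp
    qed
    also have "\<dots> = ennreal ((real n)\<^sup>2) * (\<integral>\<^sup>+x\<in>{1<..}. ennreal (1 / x\<^sup>2) \<partial>\<eta>)"
      by (rule nn_integral_cmult) (simp add: s cong: measurable_cong_sets)
    also have "\<dots> < \<infinity>" using thorin_partD(4)[OF \<eta>] by (simp add: ennreal_mult_less_top)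
    finally show ?thesis .
  qed
  have f0: "emeasure \<eta> {..0} = 0"
  proof -
    have "emeasure \<eta> {..0} = emeasure \<eta> {}"
      using thorin_partD(2)[OF \<eta>] by (intro emeasure_eq_AE) (auto simp: s)
    then show ?thesis by simp
  qed
  show "\<exists>A. countable A \<and> A \<subseteq> sets \<eta> \<and> \<Union> A = space \<eta> \<and> (\<forall>a\<in>A. emeasure \<eta> a \<noteq> \<infinity>)"
  proof (intro exI[of _ "{{..0}, {0<..1}} \<union> range (\<lambda>n::nat. {1<..real n})"] conjI)
    show "\<Union> ({{..0}, {0<..1}} \<union> range (\<lambda>n::nat. {1<..real n})) = space \<eta>"
    proof -
      have "x \<in> \<Union> ({{..0}, {0<..1}} \<union> range (\<lambda>n::nat. {1<..real n}))" for x :: real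
      proof -
        obtain n where "x \<le> real n" using real_arch_simple by blast
        then show ?thesis by (cases "x \<le> 0"; cases "x \<le> 1") auto
      qed
      then show ?thesis unfolding sets_eq_imp_space_eq[OF s] space_borel by blast
    qed
  qed (use f0 f1 f2 s in \<open>auto simp: less_top\<close>)
qed

lemma sets_gamma_levy[simp, measurable_cong]: "sets (gamma_levy \<eta>) = sets borel"
  by (simp add: gamma_levy_def)

context
  fixes \<eta> :: "real measure"
  assumes \<eta>: "thorin_part \<eta>"
begin

lemma nn_integral_gamma_levy:
  assumes [measurable]: "g \<in> borel_measurable borel"
  shows "(\<integral>\<^sup>+u. g u \<partial>gamma_levy \<eta>) = (\<integral>\<^sup>+x. \<integral>\<^sup>+u. g u * ennreal (levy_kernel x u) \<partial>lborel \<partial>\<eta>)"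
proof -
  note s[measurable_cong] = thorin_partD(1)[OF \<eta>]
  have [measurable]: "(\<lambda>p. levy_kernel (fst p) (snd p)) \<in> borel_measurable (\<eta> \<Otimes>\<^sub>M lborel)"
    unfolding levy_kernel_def by measurable
  have "(\<integral>\<^sup>+u. g u \<partial>gamma_levy \<eta>) = (\<integral>\<^sup>+p. g (snd p) \<partial>density (\<eta> \<Otimes>\<^sub>M lborel) (\<lambda>p. ennreal (levy_kernel (fst p) (snd p))))"
    unfolding gamma_levy_def by (rule nn_integral_distr) auto
  also have "\<dots> = (\<integral>\<^sup>+p. ennreal (levy_kernel (fst p) (snd p)) * g (snd p) \<partial>(\<eta> \<Otimes>\<^sub>M lborel))"
    by (rule nn_integral_density) auto
  also have "\<dots> = (\<integral>\<^sup>+x. \<integral>\<^sup>+u. ennreal (levy_kernel x u) * g u \<partial>lborel \<partial>\<eta>)"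
    by (subst lborel.nn_integral_fst[symmetric]) auto
  finally show ?thesis by (simp add: mult.commute)
qed

lemma AE_gamma_levy: "AE u in gamma_levy \<eta>. 0 < u"
proof -
  have "emeasure (gamma_levy \<eta>) {..0} = (\<integral>\<^sup>+u. indicator {..0} u \<partial>gamma_levy \<eta>)" by simp
  also have "\<dots> = (\<integral>\<^sup>+x. \<integral>\<^sup>+u. indicator {..0} u * ennreal (levy_kernel x u) \<partial>lborel \<partial>\<eta>)"
    by (rule nn_integral_gamma_levy) auto
  also have "\<dots> = (\<integral>\<^sup>+x. \<integral>\<^sup>+u. 0 \<partial>(lborel :: real measure) \<partial>\<eta>)"
  proof -
    have "indicator {..0} u * ennreal (levy_kernel x u) = 0" for x u :: real
      by (auto simp: levy_kernel_def indicator_def)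
    then show ?thesis by (simp only:)
  qed
  finally have "{..0} \<in> null_sets (gamma_levy \<eta>)" by (simp add: null_sets_def)
  then show ?thesis using AE_not_in by fastforce
qed

lemma levy_gamma_levy: "(\<integral>\<^sup>+u. ennreal (min 1 (u\<^sup>2)) \<partial>gamma_levy \<eta>) < \<infinity>"
proof -
  note s[measurable_cong] = thorin_partD(1)[OF \<eta>]
  have "(\<integral>\<^sup>+u. ennreal (min 1 (u\<^sup>2)) \<partial>gamma_levy \<eta>) = (\<integral>\<^sup>+x. \<integral>\<^sup>+u. ennreal (min 1 (u\<^sup>2)) * ennreal (levy_kernel x u) \<partial>lborel \<partial>\<eta>)"
    by (rule nn_integral_gamma_levy) auto
  also have "\<dots> \<le> (\<integral>\<^sup>+x. ennreal 2 * (ennreal (1 + \<bar>ln x\<bar>) * indicator {0<..1} x + ennreal (1 / x\<^sup>2) * indicator {1<..} x) \<partial>\<eta>)"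
    by (rule nn_integral_mono_AE)
       (use thorin_partD(2)[OF \<eta>] in eventually_elim, rule nn_integral_min_levy_kernel_le)
  also have "\<dots> = ennreal 2 * ((\<integral>\<^sup>+x\<in>{0<..1}. ennreal (1 + \<bar>ln x\<bar>) \<partial>\<eta>) + (\<integral>\<^sup>+x\<in>{1<..}. ennreal (1 / x\<^sup>2) \<partial>\<eta>))"
    by (subst nn_integral_cmult, measurable) (simp add: nn_integral_add)
  also have "\<dots> < \<infinity>"
    using thorin_partD(3,4)[OF \<eta>] by (simp add: ennreal_mult_less_top)
  finally show ?thesis .
qed

lemma is_levy_measure_gamma_levy: "is_levy_measure (gamma_levy \<eta>)"
proof -
  have "emeasure (gamma_levy \<eta>) {0} = emeasure (gamma_levy \<eta>) {}"
    using AE_gamma_levy by (intro emeasure_eq_AE) (auto elim!: eventually_mono)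
  then show ?thesis using levy_gamma_levy by (simp add: is_levy_measure_def)
qed

text \<open>For fixed x, Frullani at w = -i z turns the kernel into -Ln (1 - i z / x). The Levy and
  Thorin exponents then differ only by their compensations, which are linear in z; the constant
  stays implicit because only the Levy measure is wanted.\<close>

lemma integral_levy_integrand_gamma_levy:
  "\<exists>c. \<forall>z. (\<integral>u. levy_integrand z u \<partial>gamma_levy \<eta>) = \<i> * of_real (z * c) - (\<integral>x. thorin_integrand z x \<partial>\<eta>)"
proof -
  note s[measurable_cong] = thorin_partD(1)[OF \<eta>]
  interpret sigma_finite_measure \<eta> by (rule sigma_finite_thorin_part[OF \<eta>])
  interpret P: pair_sigma_finite \<eta> lborel ..
  have [measurable]: "(\<lambda>p. levy_kernel (fst p) (snd p)) \<in> borel_measurable (\<eta> \<Otimes>\<^sub>M lborel)"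
    unfolding levy_kernel_def by measurable
  let ?H = "\<lambda>z p. levy_kernel (fst p) (snd p) *\<^sub>R levy_integrand z (snd p)"
  let ?D = "density (\<eta> \<Otimes>\<^sub>M lborel) (\<lambda>p. ennreal (levy_kernel (fst p) (snd p)))"
  have iD: "integrable ?D (\<lambda>p. levy_integrand z (snd p))" for z
    using integrable_levy_integrand[OF is_levy_measure_gamma_levy, of z]
    unfolding gamma_levy_def by (subst (asm) integrable_distr_eq) auto
  have iH: "integrable (\<eta> \<Otimes>\<^sub>M lborel) (?H z)" for z
    using iD[of z] by (subst (asm) integrable_density) (auto simp: levy_kernel_nonneg)
  have iH': "integrable (\<eta> \<Otimes>\<^sub>M lborel) (\<lambda>(x, u). levy_kernel x u *\<^sub>R levy_integrand z u)" for z
    using iH[of z] by (simp add: split_beta')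
  have I: "(\<integral>u. levy_integrand z u \<partial>gamma_levy \<eta>) = (\<integral>x. \<integral>u. levy_kernel x u *\<^sub>R levy_integrand z u \<partial>lborel \<partial>\<eta>)" for z
  proof -
    have "(\<integral>u. levy_integrand z u \<partial>gamma_levy \<eta>) = (\<integral>p. levy_integrand z (snd p) \<partial>?D)"
      unfolding gamma_levy_def by (rule integral_distr) auto
    also have "\<dots> = (\<integral>p. ?H z p \<partial>(\<eta> \<Otimes>\<^sub>M lborel))"
      by (rule integral_density) (auto simp: levy_kernel_nonneg)
    finally show ?thesis using P.integral_fst[OF iH', of z] by (simp add: split_beta')
  qed
  \<comment> \<open>The difference of the two compensations at x: the Thorin exponent truncates at x
    >= 1, the Levy exponent at jumps u <= 1.\<close>
  define \<kappa> where "\<kappa> x = indicat_real {1..} x / x - (\<integral>u. indicator {0<..1} u * exp (- (x * u)) \<partial>lborel)" for x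
  have inner: "(\<integral>u. levy_kernel x u *\<^sub>R levy_integrand z u \<partial>lborel) = \<i> * of_real z * of_real (\<kappa> x) - thorin_integrand z x"
    if x: "0 < x" for x z
  proof -
    have e: "levy_kernel x u *\<^sub>R levy_integrand z u = - frullani_integrand x (- \<i> * of_real z) u - \<i> * of_real z * of_real (indicator {0<..1} u * exp (- (x * u)))" for u
      by (auto simp: levy_kernel_def levy_integrand_def frullani_integrand_def indicator_def scaleR_conv_of_real field_simps)
    have i1: "integrable lborel (frullani_integrand x (- \<i> * of_real z))"
      by (rule integrable_frullani[OF x]) (use x in simp)
    have i2: "integrable lborel (\<lambda>u. indicator {0<..1} u * exp (- (x * u)))"
      by (rule Bochner_Integration.integrable_bound[OF integrable_exp_decay[OF x]]) (auto simp: indicator_def)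
    have "(\<integral>u. levy_kernel x u *\<^sub>R levy_integrand z u \<partial>lborel) =
       - (\<integral>u. frullani_integrand x (- \<i> * of_real z) u \<partial>lborel) - \<i> * of_real z * (\<integral>u. complex_of_real (indicator {0<..1} u * exp (- (x * u))) \<partial>lborel)"
      unfolding e using i1 i2 by (subst Bochner_Integration.integral_diff) (auto simp del: of_real_mult)
    also have "(\<integral>u. complex_of_real (indicator {0<..1} u * exp (- (x * u))) \<partial>lborel) = of_real (\<integral>u. indicator {0<..1} u * exp (- (x * u)) \<partial>lborel)"
      by (rule integral_complex_of_real)
    also have "(\<integral>u. frullani_integrand x (- \<i> * of_real z) u \<partial>lborel) = Ln (1 - \<i> * of_real z / of_real x)"
      using frullani[OF x, of "- \<i> * of_real z"] x by simp
    finally have A: "(\<integral>u. levy_kernel x u *\<^sub>R levy_integrand z u \<partial>lborel) =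
      - Ln (1 - \<i> * of_real z / of_real x) - \<i> * of_real z * of_real (\<integral>u. indicator {0<..1} u * exp (- (x * u)) \<partial>lborel)" .
    have ind: "indicator {x. 1 \<le> \<bar>x\<bar>} x = complex_of_real (indicat_real {1..} x)" using x by (auto simp: indicator_def)
    show ?thesis unfolding A thorin_integrand_def \<kappa>_def ind by (simp add: algebra_simps)
  qed
  have iI: "integrable \<eta> (\<lambda>x. \<integral>u. levy_kernel x u *\<^sub>R levy_integrand z u \<partial>lborel)" for z
    by (rule P.integrable_fst[OF iH'])
  have [measurable]: "\<kappa> \<in> borel_measurable borel"
    unfolding \<kappa>_def[abs_def] by measurable
  \<comment> \<open>Again an imaginary part at z = 1 of integrable functions, in place of a direct
    estimate.\<close>
  have i\<kappa>: "integrable \<eta> \<kappa>"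
  proof (rule integrable_cong_AE_imp)
    show "integrable \<eta> (\<lambda>x. Im ((\<integral>u. levy_kernel x u *\<^sub>R levy_integrand 1 u \<partial>lborel) + thorin_integrand 1 x))"
      by (intro integrable_Im Bochner_Integration.integrable_add iI integrable_thorin_integrand \<eta>)
    show "AE x in \<eta>. Im ((\<integral>u. levy_kernel x u *\<^sub>R levy_integrand 1 u \<partial>lborel) + thorin_integrand 1 x) = \<kappa> x"
      using thorin_partD(2)[OF \<eta>] by eventually_elim (simp add: inner)
  qed measurable
  show ?thesis
  proof (intro exI[of _ "\<integral>x. \<kappa> x \<partial>\<eta>"] allI)
    fix z
    have "(\<integral>u. levy_integrand z u \<partial>gamma_levy \<eta>) = (\<integral>x. \<i> * of_real z * of_real (\<kappa> x) - thorin_integrand z x \<partial>\<eta>)"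
      unfolding I using iI[of z] thorin_partD(2)[OF \<eta>]
      by (intro integral_cong_AE) (auto elim!: eventually_mono simp: inner intro: borel_measurable_integrable)
    also have "\<dots> = (\<integral>x. \<i> * of_real z * of_real (\<kappa> x) \<partial>\<eta>) - (\<integral>x. thorin_integrand z x \<partial>\<eta>)"
      by (intro Bochner_Integration.integral_diff integrable_mult_right integrable_of_real i\<kappa> integrable_thorin_integrand \<eta>)
    finally show "(\<integral>u. levy_integrand z u \<partial>gamma_levy \<eta>) = \<i> * of_real (z * (\<integral>x. \<kappa> x \<partial>\<eta>)) - (\<integral>x. thorin_integrand z x \<partial>\<eta>)"
      by simp
  qed
qed

end

section \<open>Uniqueness of the Levy measure and the index \<open>\<beta>\<close>\<close>

lemma continuous_integral_levy_integrand:
  assumes \<nu>: "is_levy_measure \<nu>"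
  shows "continuous_on UNIV (\<lambda>z. \<integral>u. levy_integrand z u \<partial>\<nu>)"
  unfolding continuous_on_sequentially
proof (intro allI ballI impI)
  have s[measurable_cong]: "sets \<nu> = sets borel" using \<nu> by (simp add: is_levy_measure_def)
  fix x and a :: real assume x: "(\<forall>n. x n \<in> UNIV) \<and> x \<longlonglongrightarrow> a"
  obtain R where R: "\<And>n. norm (x n) \<le> R"
    using x convergent_imp_Bseq[of x] by (auto simp: convergent_def Bseq_def)
  have i: "integrable \<nu> (\<lambda>u. min 1 (u\<^sup>2))"
    using \<nu> by (intro integrableI_nonneg) (auto simp: is_levy_measure_def)
  show "((\<lambda>z. \<integral>u. levy_integrand z u \<partial>\<nu>) \<circ> x) \<longlonglongrightarrow> (\<integral>u. levy_integrand a u \<partial>\<nu>)"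
    unfolding comp_def
  proof (rule integral_dominated_convergence[OF _ _ integrable_mult_right[OF i, of "2 + R\<^sup>2"]])
    show "AE u in \<nu>. norm (levy_integrand (x n) u) \<le> (2 + R\<^sup>2) * min 1 (u\<^sup>2)" for n
    proof (rule AE_I2)
      fix u
      have "\<bar>x n\<bar>\<^sup>2 \<le> R\<^sup>2" using R[of n] by (intro power_mono) auto
      then have "(2 + (x n)\<^sup>2) * min 1 (u\<^sup>2) \<le> (2 + R\<^sup>2) * min 1 (u\<^sup>2)" by (intro mult_right_mono) auto
      with norm_levy_integrand_le show "norm (levy_integrand (x n) u) \<le> (2 + R\<^sup>2) * min 1 (u\<^sup>2)"
        by (rule order_trans)
    qed
    show "AE u in \<nu>. (\<lambda>n. levy_integrand (x n) u) \<longlonglongrightarrow> levy_integrand a u"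
      unfolding levy_integrand_def using x by (intro AE_I2 tendsto_intros) auto
  qed measurable
qed

text \<open>Second differences of the Levy exponent remove both the drift and the compensation.\<close>

lemma levy_integrand_second_difference:
  "levy_integrand z u - (levy_integrand (z + h) u + levy_integrand (z - h) u) / 2 = (1 - cos (h * u)) *\<^sub>R iexp (z * u)"
proof -
  have 1: "iexp ((z + h) * u) = iexp (z * u) * iexp (h * u)" "iexp ((z - h) * u) = iexp (z * u) * iexp (- (h * u))"
    by (simp_all add: exp_add[symmetric] algebra_simps)
  have "(iexp (h * u) + iexp (- (h * u))) / 2 = of_real (cos (h * u))"
    by (simp add: cos_of_real[symmetric] cos_exp_eq)
  then have "iexp (h * u) + iexp (- (h * u)) = 2 * of_real (cos (h * u))" by simp
  then have "iexp (z * u) * iexp (h * u) + iexp (z * u) * iexp (- (h * u)) = 2 * of_real (cos (h * u)) * iexp (z * u)"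
    by (simp add: distrib_left[symmetric])
  then show ?thesis unfolding levy_integrand_def 1
    by (simp add: scaleR_conv_of_real algebra_simps add_divide_distrib diff_divide_distrib)
qed

text \<open>Both angles are multiples of 2 pi, so sqrt 2 would be rational unless u = 0: in 2 n^2 =
  m^2 the exponent of the prime 2 is odd on the left and even on the right.\<close>

lemma cos_sqrt_2_nontrivial:
  assumes "cos u = 1" "cos (sqrt 2 * u) = 1" shows "u = 0"
proof -
  obtain n m :: int where n: "u = of_int n * (2 * pi)" and m: "sqrt 2 * u = of_int m * (2 * pi)"
    using assms by (auto simp: cos_one_2pi_int mult.assoc)
  have "(sqrt 2 * of_int n) * (2 * pi) = of_int m * (2 * pi)" using n m by simp
  then have "sqrt 2 * of_int n = (of_int m :: real)" by (simp only: mult_cancel_right) simp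
  then have "(sqrt 2 * of_int n)\<^sup>2 = (of_int m :: real)\<^sup>2" by simp
  then have "real_of_int (2 * n\<^sup>2) = of_int (m\<^sup>2)" by (simp add: power_mult_distrib)
  then have eq: "2 * n\<^sup>2 = m\<^sup>2" by (simp only: of_int_eq_iff)
  have "n = 0"
  proof (rule ccontr)
    assume n0: "n \<noteq> 0"
    then have m0: "m \<noteq> 0" using eq by auto
    have p: "prime (2::int)" by simp
    have "multiplicity 2 (2 * n\<^sup>2) = 1 + 2 * multiplicity 2 n"
      using n0 p by (simp add: prime_elem_multiplicity_mult_distrib prime_elem_multiplicity_power_distrib multiplicity_self)
    moreover have "multiplicity 2 (m\<^sup>2) = 2 * multiplicity 2 m"
      using m0 p by (simp add: prime_elem_multiplicity_power_distrib)
    ultimately have "1 + 2 * multiplicity 2 n = 2 * multiplicity 2 m" using eq by simp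
    then show False using even_plus_one_iff[of "2 * multiplicity 2 n"] by (metis add.commute dvd_triv_left)
  qed
  then show ?thesis using n by simp
qed

text \<open>A single 1 - cos u vanishes on all multiples of 2 pi and would not see atoms there. Two
  incommensurable frequencies leave 0 as the only zero, a point which Levy measures do not
  charge.\<close>

definition levy_weight :: "real \<Rightarrow> real" where
  "levy_weight u = (1 - cos u) + (1 - cos (sqrt 2 * u))"

lemma levy_weight_measurable[measurable]: "levy_weight \<in> borel_measurable borel"
  unfolding levy_weight_def[abs_def] by measurable

lemma levy_weight_nonneg: "0 \<le> levy_weight u"
  using cos_le_one[of u] cos_le_one[of "sqrt 2 * u"] unfolding levy_weight_def by linarith

lemma levy_weight_pos: "u \<noteq> 0 \<Longrightarrow> 0 < levy_weight u"
proof -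
  assume "u \<noteq> 0"
  then have "cos u \<noteq> 1 \<or> cos (sqrt 2 * u) \<noteq> 1" using cos_sqrt_2_nontrivial by blast
  moreover have "cos u \<le> 1" "cos (sqrt 2 * u) \<le> 1" by auto
  ultimately show ?thesis unfolding levy_weight_def by linarith
qed

lemma integral_levy_weight:
  assumes \<nu>: "is_levy_measure \<nu>"
  defines "\<Psi> \<equiv> \<lambda>z. \<integral>u. levy_integrand z u \<partial>\<nu>"
  shows "integrable \<nu> levy_weight"
    and "(\<integral>u. levy_weight u *\<^sub>R iexp (z * u) \<partial>\<nu>) = (\<Psi> z - (\<Psi> (z + 1) + \<Psi> (z - 1)) / 2) + (\<Psi> z - (\<Psi> (z + sqrt 2) + \<Psi> (z - sqrt 2)) / 2)"
proof -
  have s[measurable_cong]: "sets \<nu> = sets borel" using \<nu> by (simp add: is_levy_measure_def)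
  note i = integrable_levy_integrand[OF \<nu>]
  have w: "levy_weight = (\<lambda>u. - Re (levy_integrand 1 u) - Re (levy_integrand (sqrt 2) u))"
    by (rule ext) (simp add: levy_weight_def levy_integrand_def Re_exp)
  show "integrable \<nu> levy_weight"
    unfolding w by (intro Bochner_Integration.integrable_diff Bochner_Integration.integrable_minus integrable_Re i)
  have e: "levy_weight u *\<^sub>R iexp (z * u) = (levy_integrand z u - (levy_integrand (z + 1) u + levy_integrand (z - 1) u) / 2) +
     (levy_integrand z u - (levy_integrand (z + sqrt 2) u + levy_integrand (z - sqrt 2) u) / 2)" for u
    unfolding levy_integrand_second_difference levy_weight_def mult_1_left by (rule scaleR_add_left)
  show "(\<integral>u. levy_weight u *\<^sub>R iexp (z * u) \<partial>\<nu>) = (\<Psi> z - (\<Psi> (z + 1) + \<Psi> (z - 1)) / 2) + (\<Psi> z - (\<Psi> (z + sqrt 2) + \<Psi> (z - sqrt 2)) / 2)"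
    unfolding e \<Psi>_def using i by simp
qed

text \<open>Weighted by \<open>levy_weight\<close> both measures are finite with the same Fourier
  transform; normalized, they are probability measures and Levy's uniqueness theorem applies. The
  weight is positive almost everywhere and is divided out again. Total weight 0 admits no
  normalization but makes both measures vanish.\<close>

lemma is_levy_measure_eqI:
  assumes 1: "is_levy_measure \<nu>1" and 2: "is_levy_measure \<nu>2"
    and eq: "\<And>z. (\<integral>u. levy_weight u *\<^sub>R iexp (z * u) \<partial>\<nu>1) = (\<integral>u. levy_weight u *\<^sub>R iexp (z * u) \<partial>\<nu>2)"
  shows "\<nu>1 = \<nu>2"
proof -
  define m where "m = (\<integral>u. levy_weight u \<partial>\<nu>1)"
  have m2: "m = (\<integral>u. levy_weight u \<partial>\<nu>2)"
  proof -
    have "complex_of_real (\<integral>u. levy_weight u \<partial>\<nu>1) = of_real (\<integral>u. levy_weight u \<partial>\<nu>2)"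
      using eq[of 0] by (simp add: scaleR_conv_of_real)
    then show ?thesis by (simp add: m_def)
  qed
  have ae: "AE u in \<nu>. 0 < levy_weight u" if "is_levy_measure \<nu>" for \<nu>
  proof -
    have "{0} \<in> null_sets \<nu>" using that by (simp add: is_levy_measure_def null_sets_def)
    then have "AE u in \<nu>. u \<noteq> 0" using AE_not_in by fastforce
    then show ?thesis by eventually_elim (rule levy_weight_pos)
  qed
  have m0: "0 \<le> m" unfolding m_def by (intro Bochner_Integration.integral_nonneg levy_weight_nonneg)
  show ?thesis
  proof (cases "m = 0")
    case True
    have null: "emeasure \<nu> A = 0" if \<nu>: "is_levy_measure \<nu>" and z: "(\<integral>u. levy_weight u \<partial>\<nu>) = 0" and A: "A \<in> sets \<nu>" for \<nu> A
    proof -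
      have "AE u in \<nu>. levy_weight u = 0"
        using integral_nonneg_eq_0_iff_AE[OF integral_levy_weight(1)[OF \<nu>]] z by (simp add: levy_weight_nonneg)
      with ae[OF \<nu>] have "AE u in \<nu>. u \<notin> A" by eventually_elim auto
      then have "emeasure \<nu> A = emeasure \<nu> {}" using A by (intro emeasure_eq_AE) auto
      then show ?thesis by simp
    qed
    show ?thesis
    proof (rule measure_eqI)
      show "sets \<nu>1 = sets \<nu>2" using 1 2 by (simp add: is_levy_measure_def)
      then show "A \<in> sets \<nu>1 \<Longrightarrow> emeasure \<nu>1 A = emeasure \<nu>2 A" for A
        using null[OF 1 m_def[symmetric, unfolded True], of A] null[OF 2 m2[symmetric, unfolded True], of A] by simp
    qed
  next
    case False
    with m0 have m: "0 < m" by simp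
    let ?d = "\<lambda>\<nu>. density \<nu> (\<lambda>u. ennreal (levy_weight u / m))"
    have rd: "real_distribution (?d \<nu>)" and ch: "char (?d \<nu>) z = (\<integral>u. levy_weight u *\<^sub>R iexp (z * u) \<partial>\<nu>) / of_real m"
      and inv: "density (?d \<nu>) (\<lambda>u. ennreal (m / levy_weight u)) = \<nu>"
      if \<nu>: "is_levy_measure \<nu>" and mm: "(\<integral>u. levy_weight u \<partial>\<nu>) = m" for \<nu> z
    proof -
      have s[measurable_cong]: "sets \<nu> = sets borel" using \<nu> by (simp add: is_levy_measure_def)
      have sp: "space \<nu> = UNIV" using sets_eq_imp_space_eq[OF s] by simp
      have "emeasure (?d \<nu>) (space (?d \<nu>)) = (\<integral>\<^sup>+u. ennreal (levy_weight u / m) \<partial>\<nu>)"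
        by (simp add: emeasure_density sp)
      also have "\<dots> = ennreal (\<integral>u. levy_weight u / m \<partial>\<nu>)"
        using m integral_levy_weight(1)[OF \<nu>] by (intro nn_integral_eq_integral) (auto simp: levy_weight_nonneg)
      also have "\<dots> = 1" using mm m by simp
      finally have "prob_space (?d \<nu>)" by (rule prob_spaceI)
      then show "real_distribution (?d \<nu>)"
        by (simp add: real_distribution_def real_distribution_axioms_def s sp)
      have "char (?d \<nu>) z = (\<integral>u. (levy_weight u / m) *\<^sub>R iexp (z * u) \<partial>\<nu>)"
        unfolding char_def using m by (intro integral_density) (auto simp: levy_weight_nonneg)
      also have "\<dots> = (\<integral>u. levy_weight u *\<^sub>R iexp (z * u) / of_real m \<partial>\<nu>)"
        by (simp add: scaleR_conv_of_real)
      finally show "char (?d \<nu>) z = (\<integral>u. levy_weight u *\<^sub>R iexp (z * u) \<partial>\<nu>) / of_real m"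
        by simp
      have "density (?d \<nu>) (\<lambda>u. ennreal (m / levy_weight u)) = density \<nu> (\<lambda>u. ennreal (levy_weight u / m) * ennreal (m / levy_weight u))"
        by (rule density_density_eq) auto
      also have "\<dots> = density \<nu> (\<lambda>_. 1)"
      proof (rule density_cong)
        show "AE u in \<nu>. ennreal (levy_weight u / m) * ennreal (m / levy_weight u) = 1"
          using ae[OF \<nu>]
        proof eventually_elim
          case (elim u)
          then show ?case using m by (subst ennreal_mult[symmetric]) auto
        qed
      qed auto
      finally show "density (?d \<nu>) (\<lambda>u. ennreal (m / levy_weight u)) = \<nu>" by (simp add: density_1)
    qed
    note d1 = 1 m_def[symmetric] and d2 = 2 m2[symmetric]
    have "?d \<nu>1 = ?d \<nu>2"
    proof (rule Levy_uniqueness[OF rd[OF d1] rd[OF d2]])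
      show "char (?d \<nu>1) = char (?d \<nu>2)"
        by (rule ext) (simp only: ch[OF d1] ch[OF d2] eq)
    qed
    then have "density (?d \<nu>1) (\<lambda>u. ennreal (m / levy_weight u)) = density (?d \<nu>2) (\<lambda>u. ennreal (m / levy_weight u))"
      by (rule arg_cong)
    then show ?thesis by (simp only: inv[OF d1] inv[OF d2])
  qed
qed

text \<open>Equal exponentials leave a difference of exponents with values in 2 pi i times the
  integers; it is continuous and 0 at 0, hence 0. The remaining linear term from the two drifts
  drops out of the second differences that express the weighted Fourier transform.\<close>

lemma has_levy_triplet_unique:
  assumes 1: "has_levy_triplet M Z b1 0 \<nu>1" and 2: "has_levy_triplet M Z b2 0 \<nu>2"
  shows "\<nu>1 = \<nu>2"
proof -
  have l: "is_levy_measure \<nu>1" "is_levy_measure \<nu>2" using 1 2 by (auto simp: has_levy_triplet_def)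
  define \<Psi> where "\<Psi> b \<nu> z = \<i> * of_real (z * b) + (\<integral>u. levy_integrand z u \<partial>\<nu>)" for b \<nu> and z :: real
  have e: "exp (\<Psi> b1 \<nu>1 z) = exp (\<Psi> b2 \<nu>2 z)" for z
    using 1 2 by (simp add: has_levy_triplet_def \<Psi>_def levy_integrand_def)
  have z0: "(\<integral>u. levy_integrand 0 u \<partial>\<nu>) = 0" for \<nu> by (simp add: levy_integrand_def)
  have c: "continuous_on UNIV (\<Psi> b \<nu>)" if "is_levy_measure \<nu>" for b \<nu>
    unfolding \<Psi>_def[abs_def] by (intro continuous_intros continuous_integral_levy_integrand that)
  let ?d = "\<lambda>z. \<Psi> b1 \<nu>1 z - \<Psi> b2 \<nu>2 z"
  have int: "\<exists>n::int. ?d z = of_int (2 * n) * pi * \<i>" for z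
    using e[of z] unfolding exp_eq by (auto simp: algebra_simps)
  have "?d constant_on UNIV"
  proof (rule continuous_discrete_range_constant)
    show "\<exists>e>0. \<forall>y. y \<in> UNIV \<and> ?d y \<noteq> ?d x \<longrightarrow> e \<le> norm (?d y - ?d x)" for x
    proof (intro exI[of _ "2 * pi"] conjI allI impI)
      fix y assume y: "y \<in> UNIV \<and> ?d y \<noteq> ?d x"
      obtain n k :: int where n: "?d y = of_int (2 * n) * pi * \<i>" and k: "?d x = of_int (2 * k) * pi * \<i>"
        using int by meson
      then have "n \<noteq> k" using y by auto
      then have "1 \<le> \<bar>n - k\<bar>" by linarith
      then have "real_of_int 1 \<le> real_of_int \<bar>n - k\<bar>" by (simp only: of_int_le_iff)
      then have "1 \<le> \<bar>real_of_int (n - k)\<bar>" by simp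
      have "?d y - ?d x = of_real (of_int (n - k)) * (2 * pi * \<i>)" using n k by (simp add: algebra_simps)
      then have "norm (?d y - ?d x) = \<bar>real_of_int (n - k)\<bar> * (2 * pi)"
        by (simp add: norm_mult del: of_int_diff)
      then show "2 * pi \<le> norm (?d y - ?d x)" using \<open>1 \<le> \<bar>real_of_int (n - k)\<bar>\<close> by (simp del: of_int_diff)
    qed simp
  qed (auto intro!: continuous_intros c l)
  then obtain k where k: "\<And>z. ?d z = k" by (auto simp: constant_on_def)
  have "?d 0 = 0" by (simp add: \<Psi>_def z0)
  then have eq: "\<Psi> b1 \<nu>1 z = \<Psi> b2 \<nu>2 z" for z using k[of 0] k[of z] by simp
  have I: "(\<integral>u. levy_integrand z u \<partial>\<nu>1) = (\<integral>u. levy_integrand z u \<partial>\<nu>2) + \<i> * of_real z * of_real (b2 - b1)" for z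
    using eq[of z] by (simp add: \<Psi>_def algebra_simps)
  show ?thesis
  proof (rule is_levy_measure_eqI[OF l])
    show "(\<integral>u. levy_weight u *\<^sub>R iexp (z * u) \<partial>\<nu>1) = (\<integral>u. levy_weight u *\<^sub>R iexp (z * u) \<partial>\<nu>2)" for z
      unfolding integral_levy_weight(2)[OF l(1)] integral_levy_weight(2)[OF l(2)] I
      by (simp add: algebra_simps add_divide_distrib diff_divide_distrib)
  qed
qed

lemma levy_measure_of_eq: "has_levy_triplet M Z b 0 \<nu> \<Longrightarrow> levy_measure_of M Z = \<nu>"
  unfolding levy_measure_of_def using has_levy_triplet_unique by blast

section \<open>Small jumps and the tail of the Thorin measure\<close>

lemma nn_integral_gamma_kernel:
  assumes p: "0 < p" and x: "0 < x"
  shows "(\<integral>\<^sup>+u. ennreal (indicator {0<..} u * u powr (p - 1) * exp (- (x * u))) \<partial>lborel) = ennreal (Gamma p * x powr - p)"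
proof -
  have e: "indicator {0<..} u * u powr (p - 1) * exp (- (x * u)) = (Gamma p * x powr - p) * gamma_density p x u" for u
    using x Gamma_real_pos[OF p] by (simp add: gamma_density_def indicator_def powr_minus field_simps)
  have "(\<integral>\<^sup>+u. ennreal (indicator {0<..} u * u powr (p - 1) * exp (- (x * u))) \<partial>lborel) =
     (\<integral>\<^sup>+u. ennreal (Gamma p * x powr - p) * ennreal (gamma_density p x u) \<partial>lborel)"
    unfolding e using Gamma_real_pos[OF p] by (intro nn_integral_cong ennreal_mult) (auto simp: gamma_density_nonneg[OF p])
  also have "\<dots> = ennreal (Gamma p * x powr - p)"
    using nn_integral_gamma_density[OF p x] by (subst nn_integral_cmult) auto
  finally show ?thesis .
qed

text \<open>For x > 1 the integral is essentially the complete gamma integral Gamma(p) x^(-p),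
  concentrated at u of order 1 / x, which the cut-off at 1 does not reach. For x <= 1 it is merely
  bounded.\<close>

lemma small_jump_kernel_bounds:
  fixes p x :: real
  assumes p: "0 < p" and x: "0 < x"
  defines "J \<equiv> (\<integral>\<^sup>+u. ennreal (\<bar>u\<bar> powr p) * indicator {u. \<bar>u\<bar> \<le> 1} u * ennreal (levy_kernel x u) \<partial>lborel)"
  shows "J \<le> ennreal (exp 1 * Gamma p) * indicator {0<..1} x + ennreal (Gamma p) * (ennreal (x powr - p) * indicator {1<..} x)"
    and "ennreal (2 powr - p * exp (- 1) / 2) * (ennreal (x powr - p) * indicator {1<..} x) \<le> J"
proof -
  have G: "0 < Gamma p" by (rule Gamma_real_pos[OF p])
  have e: "ennreal (\<bar>u\<bar> powr p) * indicator {u. \<bar>u\<bar> \<le> 1} u * ennreal (levy_kernel x u) =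
     ennreal (indicator {0<..1} u * u powr (p - 1) * exp (- (x * u)))" for u
    by (auto simp: levy_kernel_def indicator_def powr_diff ennreal_mult[symmetric])
  show "J \<le> ennreal (exp 1 * Gamma p) * indicator {0<..1} x + ennreal (Gamma p) * (ennreal (x powr - p) * indicator {1<..} x)"
  proof (cases "x \<le> 1")
    case True
    have "J \<le> (\<integral>\<^sup>+u. ennreal (exp 1) * ennreal (indicator {0<..} u * u powr (p - 1) * exp (- (1 * u))) \<partial>lborel)"
      unfolding J_def e
    proof (rule nn_integral_mono)
      fix u :: real
      \<comment> \<open>Since exp(-u) >= exp(-1) on the range of u, this inserts a decay independent
        of x and makes the integral over all u > 0 a bound.\<close>
      have "exp (- (x * u)) \<le> exp 1 * exp (- u)" if "0 < u" "u \<le> 1"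
      proof -
        have "0 \<le> x * u" using that x by simp
        then have "- (x * u) \<le> 1 - u" using that by linarith
        then show ?thesis by (simp add: exp_add[symmetric])
      qed
      then have "indicator {0<..1} u * u powr (p - 1) * exp (- (x * u)) \<le> exp 1 * (indicator {0<..} u * u powr (p - 1) * exp (- (1 * u)))"
        by (auto simp: indicator_def mult.left_commute[of "exp 1"] intro: mult_left_mono)
      then show "ennreal (indicator {0<..1} u * u powr (p - 1) * exp (- (x * u))) \<le> ennreal (exp 1) * ennreal (indicator {0<..} u * u powr (p - 1) * exp (- (1 * u)))"
        by (subst ennreal_mult[symmetric]) (auto intro: ennreal_leI)
    qed
    also have "\<dots> = ennreal (exp 1) * ennreal (Gamma p)"
      using nn_integral_gamma_kernel[OF p, of 1] by (subst nn_integral_cmult) auto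
    also have "\<dots> = ennreal (exp 1 * Gamma p)" using G by (intro ennreal_mult[symmetric]) auto
    finally show ?thesis using True x by simp
  next
    case False
    have "J \<le> (\<integral>\<^sup>+u. ennreal (indicator {0<..} u * u powr (p - 1) * exp (- (x * u))) \<partial>lborel)"
      unfolding J_def e by (intro nn_integral_mono ennreal_leI) (auto simp: indicator_def)
    also have "\<dots> = ennreal (Gamma p) * ennreal (x powr - p)"
      unfolding nn_integral_gamma_kernel[OF p x] using G by (intro ennreal_mult) auto
    finally show ?thesis using False by simp
  qed
  show "ennreal (2 powr - p * exp (- 1) / 2) * (ennreal (x powr - p) * indicator {1<..} x) \<le> J"
  proof (cases "1 < x")
    case True
    \<comment> \<open>A lower bound for the integrand on the interval from 1/(2x) to 1/x, taken
      factor by factor: the power at the left end, 1 / u and the exponential at the right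
      end.\<close>
    let ?c = "(1 / (2 * x)) powr p * x * exp (- 1)"
    have "ennreal (?c * (1 / x - 1 / (2 * x))) = ennreal ?c * emeasure lborel {1 / (2 * x)<..1 / x}"
      using x by (subst emeasure_lborel_Ioc) (auto simp: frac_le ennreal_mult[symmetric])
    also have "\<dots> = (\<integral>\<^sup>+u. ennreal ?c * indicator {1 / (2 * x)<..1 / x} u \<partial>lborel)"
      by (subst nn_integral_cmult) auto
    also have "\<dots> \<le> J" unfolding J_def e
    proof (rule nn_integral_mono)
      fix u :: real
      show "ennreal ?c * indicator {1 / (2 * x)<..1 / x} u \<le> ennreal (indicator {0<..1} u * u powr (p - 1) * exp (- (x * u)))"
      proof (cases "u \<in> {1 / (2 * x)<..1 / x}")
        case u: True
        have "0 < 1 / (2 * x)" using x by simp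
        then have u0: "0 < u" using u by auto
        have "1 / x \<le> 1" using True by simp
        then have u1: "u \<le> 1" using u by auto
        have xu: "x * u \<le> 1" using u x by (auto simp: field_simps)
        have "(1 / (2 * x)) powr p \<le> u powr p" using u x p by (intro powr_mono2) auto
        moreover have "x \<le> 1 / u" using xu u0 by (simp add: field_simps)
        moreover have "exp (- 1) \<le> exp (- (x * u))" using xu by simp
        ultimately have "?c \<le> u powr p * (1 / u) * exp (- (x * u))"
          using x u0 by (intro mult_mono) auto
        also have "u powr p * (1 / u) = u powr (p - 1)" using u0 by (simp add: powr_diff)
        finally show ?thesis using u u0 u1 by (simp add: ennreal_leI)
      qed simp
    qed
    finally have 1: "ennreal (?c * (1 / x - 1 / (2 * x))) \<le> J" .
    have "?c * (1 / x - 1 / (2 * x)) = 2 powr - p * exp (- 1) / 2 * (x powr - p)"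
    proof -
      have "x * (1 / x - 1 / (2 * x)) = 1 / 2" using x by (simp add: field_simps)
      moreover have "(1 / (2 * x)) powr p = 2 powr - p * x powr - p"
        using x by (simp add: powr_divide powr_mult powr_minus field_simps)
      ultimately show ?thesis by (simp add: field_simps)
    qed
    with 1 show ?thesis using True by (subst (asm) (1) \<open>?c * _ = _\<close>) (simp add: ennreal_mult[symmetric])
  qed simp
qed

text \<open>Small x contribute boundedly and carry finite mass, so only the tail of \<eta>
  decides.\<close>

lemma nn_integral_small_jumps_finite_iff:
  assumes \<eta>: "thorin_part \<eta>" and p: "0 < p"
  shows "(\<integral>\<^sup>+u\<in>{u. \<bar>u\<bar> \<le> 1}. ennreal (\<bar>u\<bar> powr p) \<partial>gamma_levy \<eta>) < \<infinity> \<longleftrightarrow> (\<integral>\<^sup>+x\<in>{1<..}. ennreal (x powr - p) \<partial>\<eta>) < \<infinity>"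
proof -
  note s[measurable_cong] = thorin_partD(1)[OF \<eta>]
  let ?J = "\<lambda>x. \<integral>\<^sup>+u. ennreal (\<bar>u\<bar> powr p) * indicator {u. \<bar>u\<bar> \<le> 1} u * ennreal (levy_kernel x u) \<partial>lborel"
  have I: "(\<integral>\<^sup>+u\<in>{u. \<bar>u\<bar> \<le> 1}. ennreal (\<bar>u\<bar> powr p) \<partial>gamma_levy \<eta>) = (\<integral>\<^sup>+x. ?J x \<partial>\<eta>)"
    by (rule nn_integral_gamma_levy[OF \<eta>]) measurable
  have fin1: "emeasure \<eta> {0<..1} < \<infinity>"
  proof -
    have "emeasure \<eta> {0<..1} = (\<integral>\<^sup>+x. indicator {0<..1} x \<partial>\<eta>)" by (simp add: s)
    also have "\<dots> \<le> (\<integral>\<^sup>+x\<in>{0<..1}. ennreal (1 + \<bar>ln x\<bar>) \<partial>\<eta>)"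
      by (intro nn_integral_mono) (auto simp: indicator_def)
    finally show ?thesis using thorin_partD(3)[OF \<eta>] by simp
  qed
  show ?thesis
  proof
    assume "(\<integral>\<^sup>+u\<in>{u. \<bar>u\<bar> \<le> 1}. ennreal (\<bar>u\<bar> powr p) \<partial>gamma_levy \<eta>) < \<infinity>"
    then have J: "(\<integral>\<^sup>+x. ?J x \<partial>\<eta>) < \<infinity>" by (simp only: I)
    let ?c = "2 powr - p * exp (- 1) / 2 :: real"
    have c: "0 < ?c" by simp
    have "ennreal ?c * (\<integral>\<^sup>+x\<in>{1<..}. ennreal (x powr - p) \<partial>\<eta>) = (\<integral>\<^sup>+x. ennreal ?c * (ennreal (x powr - p) * indicator {1<..} x) \<partial>\<eta>)"
      by (rule nn_integral_cmult[symmetric]) measurable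
    also have "\<dots> \<le> (\<integral>\<^sup>+x. ?J x \<partial>\<eta>)"
      by (rule nn_integral_mono_AE)
         (use thorin_partD(2)[OF \<eta>] in eventually_elim, rule small_jump_kernel_bounds(2)[OF p])
    also note J
    finally show "(\<integral>\<^sup>+x\<in>{1<..}. ennreal (x powr - p) \<partial>\<eta>) < \<infinity>"
      using c by (auto simp: ennreal_mult_less_top)
  next
    assume F: "(\<integral>\<^sup>+x\<in>{1<..}. ennreal (x powr - p) \<partial>\<eta>) < \<infinity>"
    have "(\<integral>\<^sup>+x. ?J x \<partial>\<eta>) \<le> (\<integral>\<^sup>+x. ennreal (exp 1 * Gamma p) * indicator {0<..1} x + ennreal (Gamma p) * (ennreal (x powr - p) * indicator {1<..} x) \<partial>\<eta>)"
      by (rule nn_integral_mono_AE)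
         (use thorin_partD(2)[OF \<eta>] in eventually_elim, rule small_jump_kernel_bounds(1)[OF p])
    also have "\<dots> = ennreal (exp 1 * Gamma p) * emeasure \<eta> {0<..1} + ennreal (Gamma p) * (\<integral>\<^sup>+x\<in>{1<..}. ennreal (x powr - p) \<partial>\<eta>)"
      by (subst nn_integral_add, measurable) (simp add: nn_integral_cmult s)
    also have "\<dots> < \<infinity>" using F fin1 by (simp add: ennreal_mult_less_top)
    finally show "(\<integral>\<^sup>+u\<in>{u. \<bar>u\<bar> \<le> 1}. ennreal (\<bar>u\<bar> powr p) \<partial>gamma_levy \<eta>) < \<infinity>" by (simp only: I)
  qed
qed

lemma thorin_root_le:
  assumes \<sigma>: "0 < \<sigma>" and x: "1 \<le> x"
  shows "thorin_root \<sigma> \<theta> x \<le> (sqrt (\<theta>\<^sup>2 + 2 * \<sigma>\<^sup>2) + \<bar>\<theta>\<bar>) / \<sigma>\<^sup>2 * sqrt x"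
proof -
  have "\<theta>\<^sup>2 * 1 \<le> \<theta>\<^sup>2 * x" using x by (intro mult_left_mono) auto
  then have "sqrt (\<theta>\<^sup>2 + 2 * \<sigma>\<^sup>2 * x) \<le> sqrt ((\<theta>\<^sup>2 + 2 * \<sigma>\<^sup>2) * x)"
    by (intro real_sqrt_le_mono) (simp add: distrib_right)
  then have 1: "sqrt (\<theta>\<^sup>2 + 2 * \<sigma>\<^sup>2 * x) \<le> sqrt (\<theta>\<^sup>2 + 2 * \<sigma>\<^sup>2) * sqrt x" by (simp add: real_sqrt_mult)
  have "\<bar>\<theta>\<bar> * 1 \<le> \<bar>\<theta>\<bar> * sqrt x" using x by (intro mult_left_mono) auto
  then have "- \<theta> \<le> \<bar>\<theta>\<bar> * sqrt x" by linarith
  with 1 have "sqrt (\<theta>\<^sup>2 + 2 * \<sigma>\<^sup>2 * x) - \<theta> \<le> (sqrt (\<theta>\<^sup>2 + 2 * \<sigma>\<^sup>2) + \<bar>\<theta>\<bar>) * sqrt x"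
    by (simp add: distrib_right)
  then show ?thesis using \<sigma> by (simp add: thorin_root_def divide_right_mono)
qed

text \<open>The root is of order sqrt x for x > 1 in both directions. The cut-offs
  \<open>1 < x\<close> and root > 1 differ only on bounded sets, the interval up to 1 / c^2 and the
  one up to 1, where \<rho> is finite and the integrands are at most 1.\<close>

lemma nn_integral_thorin_root_tail_iff:
  assumes \<rho>: "thorin_measure \<rho>" and \<sigma>: "0 < \<sigma>" and p: "0 < p"
  shows "(\<integral>\<^sup>+x\<in>{1<..}. ennreal (x powr - p) \<partial>distr \<rho> borel (thorin_root \<sigma> \<theta>)) < \<infinity> \<longleftrightarrow>
    (\<integral>\<^sup>+x\<in>{1<..}. ennreal (x powr - (p / 2)) \<partial>\<rho>) < \<infinity>"
proof -
  note s[measurable_cong] = thorin_sets[OF \<rho>]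
  let ?P = "thorin_root \<sigma> \<theta>"
  define c where "c = 2 / (sqrt (\<theta>\<^sup>2 + 2 * \<sigma>\<^sup>2) + \<bar>\<theta>\<bar>)"
  define C where "C = (sqrt (\<theta>\<^sup>2 + 2 * \<sigma>\<^sup>2) + \<bar>\<theta>\<bar>) / \<sigma>\<^sup>2"
  have "0 < sqrt (\<theta>\<^sup>2 + 2 * \<sigma>\<^sup>2) + \<bar>\<theta>\<bar>" using \<sigma> by (intro add_pos_nonneg) (auto intro: add_nonneg_pos)
  then have c: "0 < c" and C: "0 < C" using \<sigma> by (auto simp: c_def C_def)
  have lb: "c * sqrt x \<le> ?P x" if "1 < x" for x
    using thorin_root_ge[OF \<sigma>, of x \<theta>] that by (simp add: c_def)
  have ub: "?P x \<le> C * sqrt x" if "1 < x" for x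
    using thorin_root_le[OF \<sigma>, of x \<theta>] that by (simp add: C_def)
  have pw: "(k * sqrt x) powr - p = k powr - p * x powr - (p / 2)" if "0 < x" "0 < k" for k x :: real
    using that by (simp add: powr_mult powr_half_sqrt[symmetric] powr_powr)
  have L: "(\<integral>\<^sup>+x\<in>{1<..}. ennreal (x powr - p) \<partial>distr \<rho> borel ?P) = (\<integral>\<^sup>+x. ennreal (?P x powr - p) * indicator {1<..} (?P x) \<partial>\<rho>)"
    by (rule nn_integral_distr) measurable
  have fin: "emeasure \<rho> {1<..k} < \<infinity>" for k :: real
  proof -
    have "emeasure \<rho> {1<..k} \<le> emeasure \<rho> {1..k}" by (rule emeasure_mono) (auto simp: s)
    moreover have "compact {1..k}" "{1..k} \<subseteq> {0<..}" by auto
    then have "emeasure \<rho> {1..k} < \<infinity>" using \<rho> unfolding thorin_measure_def by blast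
    ultimately show ?thesis by (rule order.strict_trans1)
  qed
  show ?thesis
  proof
    assume "(\<integral>\<^sup>+x\<in>{1<..}. ennreal (x powr - p) \<partial>distr \<rho> borel ?P) < \<infinity>"
    then have F: "(\<integral>\<^sup>+x. ennreal (?P x powr - p) * indicator {1<..} (?P x) \<partial>\<rho>) < \<infinity>" by (simp only: L)
    have "(\<integral>\<^sup>+x\<in>{1<..}. ennreal (x powr - (p / 2)) \<partial>\<rho>) \<le>
      (\<integral>\<^sup>+x. indicator {1<..1 / c\<^sup>2} x + ennreal (C powr p) * (ennreal (?P x powr - p) * indicator {1<..} (?P x)) \<partial>\<rho>)"
    proof (rule nn_integral_mono)
      fix x :: real
      show "ennreal (x powr - (p / 2)) * indicator {1<..} x \<le> indicator {1<..1 / c\<^sup>2} x + ennreal (C powr p) * (ennreal (?P x powr - p) * indicator {1<..} (?P x))"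
      proof (cases "1 < x")
        case x: True
        show ?thesis
        proof (cases "x \<le> 1 / c\<^sup>2")
          case True
          have "x powr - (p / 2) \<le> 1 powr - (p / 2)" using x p by (intro powr_mono2') auto
          then have "ennreal (x powr - (p / 2)) \<le> 1" by (simp add: ennreal_le_1)
          then show ?thesis using x True by (simp add: add_increasing2)
        next
          case False
          then have "1 < c\<^sup>2 * x" using c by (simp add: field_simps)
          also have "\<dots> = (c * sqrt x)\<^sup>2" using x by (simp add: power_mult_distrib)
          finally have "1\<^sup>2 < (c * sqrt x)\<^sup>2" by simp
          then have "1 < c * sqrt x" by (rule power2_less_imp_less) (use c x in simp)
          then have P1: "1 < ?P x" using lb[OF x] by linarith
          have "(C * sqrt x) powr - p \<le> ?P x powr - p" using P1 ub[OF x] p by (intro powr_mono2') auto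
          then have "C powr - p * x powr - (p / 2) \<le> ?P x powr - p" using x C by (simp add: pw)
          then have "C powr p * (C powr - p * x powr - (p / 2)) \<le> C powr p * ?P x powr - p" by (intro mult_left_mono) auto
          then have "x powr - (p / 2) \<le> C powr p * ?P x powr - p" using C by (simp add: powr_minus field_simps)
          then have "ennreal (x powr - (p / 2)) \<le> ennreal (C powr p) * ennreal (?P x powr - p)"
            by (subst ennreal_mult[symmetric]) (auto intro: ennreal_leI)
          then show ?thesis using x P1 False by simp
        qed
      qed simp
    qed
    also have "\<dots> = emeasure \<rho> {1<..1 / c\<^sup>2} + ennreal (C powr p) * (\<integral>\<^sup>+x. ennreal (?P x powr - p) * indicator {1<..} (?P x) \<partial>\<rho>)"
      by (subst nn_integral_add, measurable) (simp add: nn_integral_cmult s)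
    also have "\<dots> < \<infinity>" using F fin by (simp add: ennreal_mult_less_top)
    finally show "(\<integral>\<^sup>+x\<in>{1<..}. ennreal (x powr - (p / 2)) \<partial>\<rho>) < \<infinity>" .
  next
    assume F: "(\<integral>\<^sup>+x\<in>{1<..}. ennreal (x powr - (p / 2)) \<partial>\<rho>) < \<infinity>"
    have "(\<integral>\<^sup>+x. ennreal (?P x powr - p) * indicator {1<..} (?P x) \<partial>\<rho>) \<le>
       (\<integral>\<^sup>+x. indicator {0<..1} x + ennreal (c powr - p) * (ennreal (x powr - (p / 2)) * indicator {1<..} x) \<partial>\<rho>)"
    proof (rule nn_integral_mono_AE)
      show "AE x in \<rho>. ennreal (?P x powr - p) * indicator {1<..} (?P x) \<le> indicator {0<..1} x + ennreal (c powr - p) * (ennreal (x powr - (p / 2)) * indicator {1<..} x)"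
        using thorin_AE_pos[OF \<rho>]
      proof eventually_elim
        fix x :: real assume x: "0 < x"
        show "ennreal (?P x powr - p) * indicator {1<..} (?P x) \<le> indicator {0<..1} x + ennreal (c powr - p) * (ennreal (x powr - (p / 2)) * indicator {1<..} x)"
        proof (cases "1 < ?P x")
          case P1: True
          show ?thesis
          proof (cases "x \<le> 1")
            case True
            have "?P x powr - p \<le> 1 powr - p" using P1 p by (intro powr_mono2') auto
            then have "ennreal (?P x powr - p) \<le> 1" by (simp add: ennreal_le_1)
            then show ?thesis using x True P1 by simp
          next
            case False
            have "?P x powr - p \<le> (c * sqrt x) powr - p" using lb[of x] False c p by (intro powr_mono2') auto
            also have "\<dots> = c powr - p * x powr - (p / 2)" using x c by (rule pw)
            finally have "ennreal (?P x powr - p) \<le> ennreal (c powr - p) * ennreal (x powr - (p / 2))"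
              by (subst ennreal_mult[symmetric]) (auto intro: ennreal_leI)
            then show ?thesis using P1 False by simp
          qed
        qed simp
      qed
    qed
    also have "\<dots> = emeasure \<rho> {0<..1} + ennreal (c powr - p) * (\<integral>\<^sup>+x\<in>{1<..}. ennreal (x powr - (p / 2)) \<partial>\<rho>)"
      by (subst nn_integral_add, measurable) (simp add: nn_integral_cmult s)
    also have "\<dots> < \<infinity>" using F thorin_finite[OF \<rho>] by (simp add: ennreal_mult_less_top)
    finally show "(\<integral>\<^sup>+x\<in>{1<..}. ennreal (x powr - p) \<partial>distr \<rho> borel ?P) < \<infinity>" by (simp only: L)
  qed
qed

text \<open>Neither infimum need be attained, so both comparisons are rephrased as: every number
  above the bound exceeds some element.\<close>

lemma Inf_le_half_iff:
  fixes A :: "real set"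
  assumes "A \<noteq> {}" and "\<And>x. x \<in> A \<Longrightarrow> 0 < x"
  shows "Inf A \<le> p / 2 \<longleftrightarrow> Inf {q. q / 2 \<in> A} \<le> p"
proof -
  let ?B = "{q. q / 2 \<in> A}"
  obtain a0 where "a0 \<in> A" using assms by auto
  then have ne: "?B \<noteq> {}" by (auto intro!: exI[of _ "2 * a0"])
  have bA: "bdd_below A" and bB: "bdd_below ?B"
    using assms(2) by (auto intro!: bdd_belowI[of _ 0] less_imp_le simp: zero_less_divide_iff dest: assms(2))
  have le: "x \<le> y \<longleftrightarrow> (\<forall>z>y. x < z)" for x y :: real
    by (meson dense_ge less_imp_le le_less_trans)
  have "Inf A \<le> p / 2 \<longleftrightarrow> (\<forall>z>p / 2. \<exists>x\<in>A. x < z)"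
    unfolding le[of "Inf A"] using cInf_less_iff[OF assms(1) bA] by auto
  also have "\<dots> \<longleftrightarrow> (\<forall>z>p. \<exists>x\<in>?B. x < z)"
  proof safe
    fix z assume *: "\<forall>z>p / 2. \<exists>x\<in>A. x < z" and "p < z"
    then obtain x where "x \<in> A" "x < z / 2" by (metis divide_strict_right_mono zero_less_numeral)
    then show "\<exists>x\<in>?B. x < z" by (intro bexI[of _ "2 * x"]) auto
  next
    fix z assume *: "\<forall>z>p. \<exists>x\<in>?B. x < z" and "p / 2 < z"
    then have "p < 2 * z" by simp
    with * obtain x where "x / 2 \<in> A" "x < 2 * z" by auto
    then show "\<exists>x\<in>A. x < z" by (intro bexI[of _ "x / 2"]) auto
  qed
  also have "\<dots> \<longleftrightarrow> Inf ?B \<le> p"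
    unfolding le[of "Inf ?B"] using cInf_less_iff[OF ne bB] by auto
  finally show ?thesis .
qed

section \<open>The Levy measures and indices of T and Y\<close>

context brownian_subordination
begin

text \<open>The characteristic function of T is its Laplace transform at -i z, on the boundary of
  the half-plane. The drift \<open>k - c\<close> removes the compensation of the Thorin integrand,
  \<open>k\<close>, and that between Thorin and Levy exponents, \<open>c\<close>.\<close>

lemma levy_measure_of_T:
  assumes a: "a = 0"
  shows "levy_measure_of M T = gamma_levy \<rho>"
proof -
  note s[measurable_cong] = thorin_sets[OF thorin_\<rho>]
  note tp = thorin_part_thorin_measure[OF thorin_\<rho>]
  obtain c where c: "\<And>z. (\<integral>u. levy_integrand z u \<partial>gamma_levy \<rho>) = \<i> * of_real (z * c) - (\<integral>x. thorin_integrand z x \<partial>\<rho>)"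
    using integral_levy_integrand_gamma_levy[OF tp] by blast
  define k where "k = (\<integral>x. indicator {x. 1 \<le> \<bar>x\<bar>} x / x \<partial>\<rho>)"
  have e: "thorin_integrand z x = Ln (1 + (- \<i> * of_real z) / of_real x) + \<i> * of_real z * of_real (indicator {x. 1 \<le> \<bar>x\<bar>} x / x)" for z x
    by (auto simp: thorin_integrand_def indicator_def)
  have iLn: "integrable \<rho> (\<lambda>x. Ln (1 + (- \<i> * of_real z) / of_real x))" for z
    by (rule integrable_thorin_exponent[OF thorin_\<rho>]) simp
  have ik: "integrable \<rho> (\<lambda>x. indicator {x. 1 \<le> \<bar>x\<bar>} x / x :: real)"
  proof -
    have "integrable \<rho> (\<lambda>x. Im (thorin_integrand 1 x - Ln (1 + (- \<i> * of_real 1) / of_real x)))"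
      by (intro integrable_Im Bochner_Integration.integrable_diff iLn integrable_thorin_integrand tp)
    then show ?thesis unfolding e by simp
  qed
  have te: "thorin_exponent \<rho> (- \<i> * of_real z) = (\<integral>x. thorin_integrand z x \<partial>\<rho>) - \<i> * of_real z * of_real k" for z
  proof -
    have "(\<integral>x. thorin_integrand z x \<partial>\<rho>) = thorin_exponent \<rho> (- \<i> * of_real z) + (\<integral>x. \<i> * of_real z * of_real (indicator {x. 1 \<le> \<bar>x\<bar>} x / x) \<partial>\<rho>)"
      unfolding e thorin_exponent_def
      by (intro Bochner_Integration.integral_add iLn integrable_mult_right integrable_of_real ik)
    also have "(\<integral>x. \<i> * of_real z * of_real (indicator {x. 1 \<le> \<bar>x\<bar>} x / x) \<partial>\<rho>) = \<i> * of_real z * of_real k"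
      unfolding k_def integral_mult_right_zero integral_complex_of_real ..
    finally show ?thesis by simp
  qed
  have "has_levy_triplet M T (k - c) 0 (gamma_levy \<rho>)"
    unfolding has_levy_triplet_def
  proof (intro conjI allI)
    show "is_levy_measure (gamma_levy \<rho>)" by (rule is_levy_measure_gamma_levy[OF tp])
    fix z
    have "char (distr M borel (T 1)) z = (\<integral>\<omega>. exp (- ((- \<i> * of_real z) * complex_of_real (T 1 \<omega>))) \<partial>M)"
      unfolding char_def by (subst integral_distr) (auto simp: mult_ac)
    also have "\<dots> = exp (- thorin_exponent \<rho> (- \<i> * of_real z))"
      using thorin_subordinator_laplace[OF T, of "- \<i> * of_real z"] a by simp
    also have "\<dots> = exp (\<i> * of_real (z * (k - c)) + (\<integral>u. levy_integrand z u \<partial>gamma_levy \<rho>))"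
      unfolding te c by (simp add: algebra_simps)
    finally show "char (distr M borel (T 1)) z = exp (\<i> * complex_of_real (z * (k - c)) - complex_of_real (0 / 2 * z\<^sup>2) +
      (CLINT x|gamma_levy \<rho>. iexp (z * x) - 1 - \<i> * complex_of_real (z * x * indicat_real {- 1..1} x)))"
      by (simp add: levy_integrand_def)
  qed simp
  then show ?thesis by (rule levy_measure_of_eq)
qed

text \<open>Each half of the Thorin measure contributes its own gamma mixture. Reflection replaces z
  by -z, whence the opposite signs of \<open>cp\<close> and \<open>cm\<close> in the drift.\<close>

lemma levy_measure_of_Y:
  assumes a: "a = 0"
  shows "levy_measure_of (completion M) Y = two_sided (gamma_levy \<tau>\<^sub>p) (gamma_levy \<tau>\<^sub>m)"
proof -
  let ?\<nu> = "two_sided (gamma_levy \<tau>\<^sub>p) (gamma_levy \<tau>\<^sub>m)"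
  note gp = sets_gamma_levy[of \<tau>\<^sub>p] sets_gamma_levy[of \<tau>\<^sub>m] AE_gamma_levy[OF thorin_part_p] AE_gamma_levy[OF thorin_part_m]
  obtain cp where cp: "\<And>z. (\<integral>u. levy_integrand z u \<partial>gamma_levy \<tau>\<^sub>p) = \<i> * of_real (z * cp) - (\<integral>x. thorin_integrand z x \<partial>\<tau>\<^sub>p)"
    using integral_levy_integrand_gamma_levy[OF thorin_part_p] by blast
  obtain cm where cm: "\<And>z. (\<integral>u. levy_integrand z u \<partial>gamma_levy \<tau>\<^sub>m) = \<i> * of_real (z * cm) - (\<integral>x. thorin_integrand z x \<partial>\<tau>\<^sub>m)"
    using integral_levy_integrand_gamma_levy[OF thorin_part_m] by blast
  define k where "k = (\<integral>t. compensator t \<partial>\<rho>)"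
  have lev: "is_levy_measure ?\<nu>"
  proof -
    have d0: "emeasure (distr (gamma_levy \<tau>\<^sub>m) borel uminus) {0} = 0"
    proof -
      have "uminus -` {0::real} = {0}" by auto
      then show ?thesis
        using is_levy_measure_gamma_levy[OF thorin_part_m] sets_eq_imp_space_eq[OF gp(2)]
        by (subst emeasure_distr) (auto simp: is_levy_measure_def)
    qed
    have "emeasure ?\<nu> {0} = 0"
      using is_levy_measure_gamma_levy[OF thorin_part_p] d0
      by (subst emeasure_two_sided[OF gp]) (auto simp: is_levy_measure_def)
    moreover have "(\<integral>\<^sup>+x. ennreal (min 1 (x\<^sup>2)) \<partial>?\<nu>) < \<infinity>"
      using levy_gamma_levy[OF thorin_part_p] levy_gamma_levy[OF thorin_part_m]
      by (subst nn_integral_two_sided[OF gp]) auto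
    ultimately show ?thesis using sets_two_sided[OF gp] by (simp add: is_levy_measure_def)
  qed
  have I: "(\<integral>u. levy_integrand z u \<partial>?\<nu>) = \<i> * of_real (z * cp) - \<i> * of_real (z * cm) - ((\<integral>x. thorin_integrand z x \<partial>\<tau>\<^sub>p) + (\<integral>x. thorin_integrand (- z) x \<partial>\<tau>\<^sub>m))" for z
  proof -
    have "(\<integral>u. levy_integrand z u \<partial>?\<nu>) = (\<integral>u. levy_integrand z u \<partial>gamma_levy \<tau>\<^sub>p) + (\<integral>u. levy_integrand z (- u) \<partial>gamma_levy \<tau>\<^sub>m)"
      by (rule integral_two_sided[OF gp])
         (auto simp: levy_integrand_uminus intro: integrable_levy_integrand is_levy_measure_gamma_levy thorin_part_p thorin_part_m)
    then show ?thesis by (simp add: levy_integrand_uminus cp cm)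
  qed
  have te: "(\<integral>x. thorin_integrand z x \<partial>\<tau>\<^sub>p) + (\<integral>x. thorin_integrand (- z) x \<partial>\<tau>\<^sub>m) = thorin_exponent \<rho> (bm_exponent \<sigma> \<theta> z) + \<i> * of_real z * of_real k" for z
  proof -
    have "(\<integral>x. thorin_integrand z x \<partial>two_sided \<tau>\<^sub>p \<tau>\<^sub>m) = (\<integral>x. thorin_integrand z x \<partial>\<tau>\<^sub>p) + (\<integral>x. thorin_integrand z (- x) \<partial>\<tau>\<^sub>m)"
      using thorin_partD(2)[OF thorin_part_p] thorin_partD(2)[OF thorin_part_m]
      by (intro integral_two_sided) (auto simp: thorin_integrand_uminus intro: integrable_thorin_integrand thorin_part_p thorin_part_m)
    then show ?thesis using thorin_exponent_two_sided[of z] by (simp add: thorin_integrand_uminus k_def)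
  qed
  have "has_levy_triplet (completion M) Y (k - cp + cm) 0 ?\<nu>"
    unfolding has_levy_triplet_def
  proof (intro conjI allI lev)
    fix z
    have E: "- thorin_exponent \<rho> (bm_exponent \<sigma> \<theta> z) = \<i> * of_real (z * (k - cp + cm)) + (\<integral>u. levy_integrand z u \<partial>?\<nu>)"
      unfolding I te by (simp add: algebra_simps)
    have "char (distr (completion M) borel (Y 1)) z = exp (- thorin_exponent \<rho> (bm_exponent \<sigma> \<theta> z))"
      using char_Y_1[of z] a by simp
    then show "char (distr (completion M) borel (Y 1)) z = exp (\<i> * complex_of_real (z * (k - cp + cm)) - complex_of_real (0 / 2 * z\<^sup>2) +
      (CLINT x|?\<nu>. iexp (z * x) - 1 - \<i> * complex_of_real (z * x * indicat_real {- 1..1} x)))"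
      unfolding E by (simp add: levy_integrand_def[abs_def])
  qed simp
  then show ?thesis by (rule levy_measure_of_eq)
qed

text \<open>An exponent q is admissible for Y exactly when q / 2 is admissible for T, as both amount
  to the same tail integral of \<rho>.\<close>

theorem beta_index_T_Y:
  assumes a: "a = 0"
  shows "beta_index M T \<le> p / 2 \<longleftrightarrow> beta_index (completion M) Y \<le> p"
proof -
  let ?A = "{q. 0 < q \<and> (\<integral>\<^sup>+x\<in>{1<..}. ennreal (x powr - q) \<partial>\<rho>) < \<infinity>}"
  note tp = thorin_part_thorin_measure[OF thorin_\<rho>]
  note gp = sets_gamma_levy[of \<tau>\<^sub>p] sets_gamma_levy[of \<tau>\<^sub>m] AE_gamma_levy[OF thorin_part_p] AE_gamma_levy[OF thorin_part_m]
  have T: "beta_index M T = Inf ?A"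
    unfolding beta_index_def levy_measure_of_T[OF a]
    using nn_integral_small_jumps_finite_iff[OF tp] by (intro arg_cong[where f=Inf]) auto
  have "(\<integral>\<^sup>+u\<in>{u. \<bar>u\<bar> \<le> 1}. ennreal (\<bar>u\<bar> powr q) \<partial>two_sided (gamma_levy \<tau>\<^sub>p) (gamma_levy \<tau>\<^sub>m)) < \<infinity> \<longleftrightarrow> q / 2 \<in> ?A" if q: "0 < q" for q
  proof -
    have "(\<integral>\<^sup>+u\<in>{u. \<bar>u\<bar> \<le> 1}. ennreal (\<bar>u\<bar> powr q) \<partial>two_sided (gamma_levy \<tau>\<^sub>p) (gamma_levy \<tau>\<^sub>m)) =
      (\<integral>\<^sup>+u\<in>{u. \<bar>u\<bar> \<le> 1}. ennreal (\<bar>u\<bar> powr q) \<partial>gamma_levy \<tau>\<^sub>p) + (\<integral>\<^sup>+u\<in>{u. \<bar>u\<bar> \<le> 1}. ennreal (\<bar>u\<bar> powr q) \<partial>gamma_levy \<tau>\<^sub>m)"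
      by (subst nn_integral_two_sided[OF gp]) (auto simp: indicator_def)
    then show ?thesis
      using nn_integral_small_jumps_finite_iff[OF thorin_part_p q] nn_integral_small_jumps_finite_iff[OF thorin_part_m q]
        nn_integral_thorin_root_tail_iff[OF thorin_\<rho> \<sigma> q, of \<theta>] nn_integral_thorin_root_tail_iff[OF thorin_\<rho> \<sigma> q, of "- \<theta>"] q
      by simp
  qed
  then have Y: "beta_index (completion M) Y = Inf {q. q / 2 \<in> ?A}"
    unfolding beta_index_def levy_measure_of_Y[OF a]
    by (intro arg_cong[where f=Inf]) auto
  \<comment> \<open>The condition on \<rho> at infinity makes the exponent 1 admissible for T;
    without an admissible exponent the real infimum would carry no information.\<close>
  have "(\<integral>\<^sup>+x\<in>{1<..}. ennreal (x powr - 1) \<partial>\<rho>) \<le> (\<integral>\<^sup>+x\<in>{1..}. ennreal (1 / x) \<partial>\<rho>)"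
    by (intro nn_integral_mono) (auto simp: indicator_def powr_minus inverse_eq_divide)
  also have "\<dots> < \<infinity>" by (rule thorin_inverse[OF thorin_\<rho>])
  finally have "1 \<in> ?A" using zero_less_one by blast
  then have "?A \<noteq> {}" by blast
  then show ?thesis unfolding T Y by (rule Inf_le_half_iff) blast
qed

end

section \<open>Approximation by gamma convolutions\<close>

lemma real_distribution_convolution:
  assumes "real_distribution \<mu>" "real_distribution \<nu>"
  shows "real_distribution (convolution \<mu> \<nu>)"
    and "char (convolution \<mu> \<nu>) z = char \<mu> z * char \<nu> z"
proof -
  interpret M: real_distribution \<mu> by fact
  interpret N: real_distribution \<nu> by fact
  interpret P: pair_prob_space \<mu> \<nu> ..
  have [measurable]: "(\<lambda>(x, y). x + y) \<in> borel_measurable (\<mu> \<Otimes>\<^sub>M \<nu>)" by measurable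
  show "real_distribution (convolution \<mu> \<nu>)"
    unfolding convolution_def
    by (intro real_distribution.intro P.prob_space_distr) (auto simp: real_distribution_axioms_def)
  have i: "integrable (\<mu> \<Otimes>\<^sub>M \<nu>) (\<lambda>(x, y). iexp (z * x) * iexp (z * y))"
    by (rule P.integrable_const_bound[where B=1]) (auto simp: norm_mult)
  have "char (convolution \<mu> \<nu>) z = (\<integral>p. iexp (z * (case p of (x, y) \<Rightarrow> x + y)) \<partial>(\<mu> \<Otimes>\<^sub>M \<nu>))"
    unfolding char_def convolution_def by (rule integral_distr) auto
  also have "\<dots> = (\<integral>p. (case p of (x, y) \<Rightarrow> iexp (z * x) * iexp (z * y)) \<partial>(\<mu> \<Otimes>\<^sub>M \<nu>))"
    by (intro Bochner_Integration.integral_cong) (auto simp: exp_add[symmetric] distrib_left)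
  also have "\<dots> = (\<integral>x. \<integral>y. iexp (z * x) * iexp (z * y) \<partial>\<nu> \<partial>\<mu>)"
    by (rule P.integral_fst[OF i, symmetric])
  also have "\<dots> = char \<mu> z * char \<nu> z" by (simp add: char_def)
  finally show "char (convolution \<mu> \<nu>) z = char \<mu> z * char \<nu> z" .
qed

lemma real_distribution_gamma_convolutions:
  "\<mu> \<in> gamma_convolutions \<Longrightarrow> real_distribution \<mu>"
proof (induction rule: gamma_convolutions.induct)
  case (scaled k l x)
  interpret prob_space "density lborel (\<lambda>v. ennreal (gamma_density k l v))"
    by (rule prob_space_gamma) fact+
  show ?case by (intro real_distribution.intro prob_space_distr) (auto simp: real_distribution_axioms_def)
qed (rule real_distribution_convolution)

text \<open>Grid points lie to the right of x, so a decreasing majorant evaluated at the grid point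
  is bounded by its value at x.\<close>

lemma thorin_dominator_mono:
  fixes K x s :: real
  assumes "0 \<le> K" "0 < x" "x \<le> s"
  shows "thorin_dominator K s \<le> thorin_dominator K x"
proof -
  consider "s \<le> 1" | "x \<le> 1" "1 < s" | "1 < x" using assms by linarith
  then show ?thesis
  proof cases
    case 1
    have "ln x \<le> ln s" using assms by simp
    moreover have "ln s \<le> 0" using 1 assms by simp
    ultimately have "\<bar>ln s\<bar> \<le> \<bar>ln x\<bar>" by linarith
    then show ?thesis using 1 assms by simp
  next
    case 2
    have "K / s \<le> K / 1" using 2 assms by (intro divide_left_mono) auto
    then have "K / s \<le> K + \<bar>ln x\<bar>" using abs_ge_zero[of "ln x"] by linarith
    then show ?thesis using 2 by simp
  next
    case 3
    have "K / s \<le> K / x" using 3 assms by (intro divide_left_mono) auto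
    then show ?thesis using 3 assms by simp
  qed
qed

lemma grid_ge: 
  assumes "0 \<le> u" shows "u \<le> grid k 0 u"
proof -
  have "real (Suc k) * u \<le> real (nat \<lceil>real (Suc k) * u\<rceil>)" by linarith
  then show ?thesis by (simp add: grid_def field_simps)
qed

context brownian_subordination
begin

abbreviation "\<psi> z \<equiv> bm_exponent \<sigma> \<theta> z"

text \<open>The law of Brownian motion with drift at an independent gamma time, a variance-gamma
  law: by the factorization it is the law of a difference of two independent gamma variables with
  equal shape and rates p(x) and m(x).\<close>

lemma gamma_convolution_bm:
  assumes c: "0 < c" and x: "0 < x"
  shows "\<exists>\<mu>\<in>gamma_convolutions. \<forall>z. char \<mu> z = exp (- (of_real c * Ln (1 + \<psi> z / of_real x)))"
proof -
  let ?p = "thorin_root \<sigma> \<theta> x" and ?m = "thorin_root \<sigma> (- \<theta>) x"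
  have pos: "0 < ?p" "0 < ?m" using thorin_root_pos[OF \<sigma> x] by auto
  let ?g = "\<lambda>l y. distr (density lborel (\<lambda>v. ennreal (gamma_density c l v))) borel (\<lambda>v. v * y)"
  have g: "?g ?p 1 \<in> gamma_convolutions" "?g ?m (- 1) \<in> gamma_convolutions"
    by (rule gamma_convolutions.scaled[OF c pos(1)], simp) (rule gamma_convolutions.scaled[OF c pos(2)], simp)
  have "char (convolution (?g ?p 1) (?g ?m (- 1))) z = exp (- (of_real c * Ln (1 + \<psi> z / of_real x)))" for z
    unfolding real_distribution_convolution(2)[OF g[THEN real_distribution_gamma_convolutions]]
      char_scaled_gamma[OF c pos(1)] char_scaled_gamma[OF c pos(2)] Ln_one_plus_bm_exponent[OF \<sigma> x]
    by (simp add: exp_add[symmetric] algebra_simps)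
  then show ?thesis using gamma_convolutions.convolve[OF g] by blast
qed

text \<open>Vanishing weights \<open>c j\<close> are allowed; the extra factor with \<open>c0 > 0\<close> is needed because
  \<^const>\<open>gamma_convolutions\<close> does not contain the point mass at \<open>0\<close>.\<close>

lemma gamma_convolution_sum:
  assumes J: "finite J" and c: "\<And>j. j \<in> J \<Longrightarrow> 0 \<le> c j" and x: "\<And>j. j \<in> J \<Longrightarrow> 0 < x j"
    and c0: "0 < c0" and x0: "0 < x0"
  shows "\<exists>\<mu>\<in>gamma_convolutions. \<forall>z. char \<mu> z =
    exp (- (of_real c0 * Ln (1 + \<psi> z / of_real x0) + (\<Sum>j\<in>J. of_real (c j) * Ln (1 + \<psi> z / of_real (x j)))))"
  using J c x
proof (induction J rule: finite_induct)
  case empty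
  then show ?case using gamma_convolution_bm[OF c0 x0] by simp
next
  case (insert j J)
  then obtain \<mu> where \<mu>: "\<mu> \<in> gamma_convolutions"
    and ch: "\<And>z. char \<mu> z = exp (- (of_real c0 * Ln (1 + \<psi> z / of_real x0) + (\<Sum>j\<in>J. of_real (c j) * Ln (1 + \<psi> z / of_real (x j)))))"
    by auto
  show ?case
  proof (cases "c j = 0")
    case True
    then show ?thesis using insert \<mu> ch by (intro bexI[of _ \<mu>]) auto
  next
    case False
    then have "0 < c j" "0 < x j" using insert.prems[of j] by (auto simp: less_le)
    then obtain \<nu> where \<nu>: "\<nu> \<in> gamma_convolutions" and ch': "\<And>z. char \<nu> z = exp (- (of_real (c j) * Ln (1 + \<psi> z / of_real (x j))))"
      using gamma_convolution_bm by blast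
    have "char (convolution \<mu> \<nu>) z = char \<mu> z * char \<nu> z" for z
      by (rule real_distribution_convolution(2)[OF \<mu>[THEN real_distribution_gamma_convolutions] \<nu>[THEN real_distribution_gamma_convolutions]])
    then have "char (convolution \<mu> \<nu>) z = exp (- (of_real c0 * Ln (1 + \<psi> z / of_real x0) + (\<Sum>j\<in>insert j J. of_real (c j) * Ln (1 + \<psi> z / of_real (x j)))))" for z
      using insert.hyps by (simp add: ch ch' exp_add[symmetric] algebra_simps)
    then show ?thesis using gamma_convolutions.convolve[OF \<mu> \<nu>] by blast
  qed
qed

text \<open>The points which the grid rounds up to \<open>k / Suc n\<close>; for k >= 1 a half-open
  interval of length \<open>1 / Suc n\<close> ending there, while the cell of 0 is the nonpositive
  half-line.\<close>

definition cell :: "nat \<Rightarrow> nat \<Rightarrow> real set" where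
  "cell n k = {x. nat \<lceil>real (Suc n) * x\<rceil> = k}"

lemma cell_measurable[measurable]: "cell n k \<in> sets borel"
  unfolding cell_def by measurable

text \<open>From k = 2 on the cell keeps the distance \<open>1 / Suc n\<close> from 0 and lies in a
  compact subset of the open half-line, where \<rho> is finite.\<close>

lemma emeasure_cell_finite:
  assumes "2 \<le> k" shows "emeasure \<rho> (cell n k) < \<infinity>"
proof -
  have "cell n k \<subseteq> {1 / real (Suc n)..real k / real (Suc n)}"
  proof
    fix x assume x: "x \<in> cell n k"
    then have "1 < real (Suc n) * x" "real (Suc n) * x \<le> real k"
      using assms unfolding cell_def by (auto simp del: of_nat_Suc) linarith+
    then show "x \<in> {1 / real (Suc n)..real k / real (Suc n)}" by (auto simp: field_simps simp del: of_nat_Suc)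
  qed
  then have "emeasure \<rho> (cell n k) \<le> emeasure \<rho> {1 / real (Suc n)..real k / real (Suc n)}"
    by (intro emeasure_mono) (auto simp: thorin_sets[OF thorin_\<rho>])
  also have "\<dots> < \<infinity>"
  proof -
    have p: "0 < 1 / real (Suc n)" by simp
    then have "compact {1 / real (Suc n)..real k / real (Suc n)}" "{1 / real (Suc n)..real k / real (Suc n)} \<subseteq> {0<..}"
      by (auto simp del: of_nat_Suc intro: less_le_trans[OF p])
    then show ?thesis using thorin_\<rho> unfolding thorin_measure_def by blast
  qed
  finally show ?thesis .
qed

text \<open>Riemann sums of the Thorin exponent over the cells between \<open>1 / N\<close> and \<open>N\<close>, where \<open>N = Suc n\<close>.\<close>

definition riemann_exponent :: "nat \<Rightarrow> real \<Rightarrow> complex" where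
  "riemann_exponent n z = (\<Sum>k\<in>{2..Suc n * Suc n}. of_real (measure \<rho> (cell n k)) * Ln (1 + \<psi> z / of_real (real k / real (Suc n))))"

text \<open>The sums are integrals of step functions that sample the logarithm at the right end of
  each cell. Sampling to the right keeps them below the integrable majorant, and the range of cells
  exhausts the half-line.\<close>

lemma riemann_exponent_tendsto:
  "(\<lambda>n. riemann_exponent n z) \<longlonglongrightarrow> thorin_exponent \<rho> (\<psi> z)"
proof -
  note s[measurable_cong] = thorin_sets[OF thorin_\<rho>]
  let ?J = "\<lambda>n. {2..Suc n * Suc n}"
  define h where "h n x = (\<Sum>k\<in>?J n. indicat_real (cell n k) x *\<^sub>R Ln (1 + \<psi> z / of_real (real k / real (Suc n))))" for n x
  have hm[measurable]: "h n \<in> borel_measurable borel" for n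
    unfolding h_def by measurable
  have "has_bochner_integral \<rho> (h n) (\<Sum>k\<in>?J n. measure \<rho> (cell n k) *\<^sub>R Ln (1 + \<psi> z / of_real (real k / real (Suc n))))" for n
    unfolding h_def
    by (intro has_bochner_integral_sum has_bochner_integral_indicator emeasure_cell_finite) (auto simp: s)
  then have int: "(\<integral>x. h n x \<partial>\<rho>) = riemann_exponent n z" for n
    by (simp add: has_bochner_integral_integral_eq riemann_exponent_def scaleR_conv_of_real)
  have h: "h n x = (if nat \<lceil>real (Suc n) * x\<rceil> \<in> ?J n then Ln (1 + \<psi> z / of_real (grid n 0 x)) else 0)" for n x
  proof -
    let ?v = "\<lambda>k. Ln (1 + \<psi> z / of_real (real k / real (Suc n)))"
    have "h n x = (\<Sum>k\<in>?J n. if nat \<lceil>real (Suc n) * x\<rceil> = k then ?v k else 0)"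
      unfolding h_def by (intro sum.cong) (auto simp: cell_def)
    also have "\<dots> = (if nat \<lceil>real (Suc n) * x\<rceil> \<in> ?J n then ?v (nat \<lceil>real (Suc n) * x\<rceil>) else 0)"
      by (rule sum.delta') simp
    finally show ?thesis by (simp add: grid_def)
  qed
  let ?K = "ln (1 + norm (\<psi> z)) + pi + norm (\<psi> z)"
  have K: "0 \<le> ?K" using pi_gt_zero by (intro add_nonneg_nonneg) auto
  have "(\<lambda>n. \<integral>x. h n x \<partial>\<rho>) \<longlonglongrightarrow> (\<integral>x. Ln (1 + \<psi> z / of_real x) \<partial>\<rho>)"
  proof (rule integral_dominated_convergence[OF _ _ integrable_thorin_dominator[OF thorin_\<rho> K]])
    show "AE x in \<rho>. norm (h n x) \<le> thorin_dominator ?K x" for n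
      using thorin_AE_pos[OF thorin_\<rho>]
    proof eventually_elim
      fix x :: real assume x: "0 < x"
      have g: "x \<le> grid n 0 x" using x by (intro grid_ge) simp
      show "norm (h n x) \<le> thorin_dominator ?K x"
      proof (cases "nat \<lceil>real (Suc n) * x\<rceil> \<in> ?J n")
        case True
        then have "norm (h n x) = norm (Ln (1 + \<psi> z / of_real (grid n 0 x)))" by (simp add: h)
        also have "\<dots> \<le> thorin_dominator ?K (grid n 0 x)"
          using x g by (intro norm_Ln_one_plus_divide_le_dominator Re_bm_exponent) auto
        also have "\<dots> \<le> thorin_dominator ?K x"
          by (rule thorin_dominator_mono[OF K x g])
        finally show ?thesis .
      next
        case False
        then have "h n x = 0" by (simp only: h if_False)
        moreover have "0 \<le> thorin_dominator k x" if "0 \<le> k" for k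
          using that x by (cases "x \<le> 1") (simp_all only: if_True if_False add_nonneg_nonneg abs_ge_zero divide_nonneg_pos)
        from this[OF K] have "norm (0 :: complex) \<le> thorin_dominator ?K x" by (simp only: norm_zero)
        ultimately show ?thesis by (simp only:)
      qed
    qed
    show "AE x in \<rho>. (\<lambda>n. h n x) \<longlonglongrightarrow> Ln (1 + \<psi> z / of_real x)"
      using thorin_AE_pos[OF thorin_\<rho>]
    proof eventually_elim
      fix x :: real assume x: "0 < x"
      have "(\<lambda>n. Ln (1 + \<psi> z / of_real (grid n 0 x))) \<longlonglongrightarrow> Ln (1 + \<psi> z / of_real x)"
      proof (intro tendsto_intros grid_tendsto one_plus_not_nonpos)
        show "0 \<le> Re (\<psi> z / complex_of_real x)" using Re_bm_exponent[of \<sigma> \<theta> z] x by simp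
      qed (use x in auto)
      moreover have "\<forall>\<^sub>F n in sequentially. h n x = Ln (1 + \<psi> z / of_real (grid n 0 x))"
        unfolding eventually_sequentially
      proof (intro exI allI impI)
        \<comment> \<open>With N = Suc n, the bounds N >= x and N >= 2 / x give N x <= N^2 and N x
          >= 2, so that the cell of x is among those summed.\<close>
        fix n assume n: "nat \<lceil>max x (2 / x)\<rceil> \<le> n"
        then have "x \<le> real (Suc n)" "2 / x \<le> real (Suc n)" by linarith+
        have 1: "real (Suc n) * x \<le> real (Suc n * Suc n)"
          unfolding of_nat_mult using \<open>x \<le> real (Suc n)\<close> by (intro mult_left_mono) auto
        have 2: "2 \<le> real (Suc n) * x"
          using x \<open>2 / x \<le> real (Suc n)\<close> by (simp add: field_simps del: of_nat_Suc)
        have "nat \<lceil>real (Suc n) * x\<rceil> \<in> ?J n"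
          using 1 2 by (simp only: atLeastAtMost_iff) (intro conjI; linarith)
        then show "h n x = Ln (1 + \<psi> z / of_real (grid n 0 x))" by (simp add: h)
      qed
      ultimately show "(\<lambda>n. h n x) \<longlonglongrightarrow> Ln (1 + \<psi> z / of_real x)"
        using tendsto_cong[of "\<lambda>n. h n x" "\<lambda>n. Ln (1 + \<psi> z / of_real (grid n 0 x))"] by blast
    qed
  qed measurable
  then show ?thesis unfolding int thorin_exponent_def .
qed

text \<open>The summand \<open>1\<close> only serves to make the weight positive when \<open>a = 0\<close>.\<close>

lemma drift_exponent_tendsto:
  "(\<lambda>n. of_real (a * real (Suc n) + 1) * Ln (1 + w / of_real (real (Suc n)))) \<longlonglongrightarrow> of_real a * w"
  if w: "0 \<le> Re w" for w
proof -
  let ?N = "\<lambda>n. real (Suc n)"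
  let ?L = "\<lambda>n. Ln (1 + w / of_real (?N n))"
  have inv: "(\<lambda>n. 1 / ?N n) \<longlonglongrightarrow> 0"
    using LIMSEQ_inverse_real_of_nat by (simp add: inverse_eq_divide)
  \<comment> \<open>The second-order bound for the logarithm leaves an error N |w / N|^2.\<close>
  have 1: "(\<lambda>n. of_real (?N n) * ?L n - w) \<longlonglongrightarrow> 0"
  proof (rule Lim_null_comparison)
    show "\<forall>\<^sub>F n in sequentially. norm (of_real (?N n) * ?L n - w) \<le> (norm w)\<^sup>2 * (1 / ?N n)"
    proof (intro always_eventually allI)
      fix n
      let ?v = "w / of_real (?N n)"
      have "0 \<le> Re ?v" using w by simp
      then have "norm (?L n - ?v) \<le> norm ?v ^ 2" by (rule norm_Ln_one_plus_minus_le)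
      then have "?N n * norm (?L n - ?v) \<le> ?N n * norm ?v ^ 2" by (intro mult_left_mono) auto
      also have "?N n * norm ?v ^ 2 = (norm w)\<^sup>2 * (1 / ?N n)"
        by (simp add: norm_divide power_divide power2_eq_square del: of_nat_Suc)
      also have "?N n * norm (?L n - ?v) = norm (of_real (?N n) * (?L n - ?v))"
        by (simp add: norm_mult del: of_nat_Suc)
      also have "of_real (?N n) * (?L n - ?v) = of_real (?N n) * ?L n - w"
        by (simp add: right_diff_distrib del: of_nat_Suc)
      finally show "norm (of_real (?N n) * ?L n - w) \<le> (norm w)\<^sup>2 * (1 / ?N n)" .
    qed
    show "(\<lambda>n. (norm w)\<^sup>2 * (1 / ?N n)) \<longlonglongrightarrow> 0"
      using tendsto_mult[OF tendsto_const inv, of "(norm w)\<^sup>2"] by simp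
  qed
  have 2: "?L \<longlonglongrightarrow> 0"
  proof (rule Lim_null_comparison)
    show "\<forall>\<^sub>F n in sequentially. norm (?L n) \<le> norm w * (1 / ?N n)"
    proof (intro always_eventually allI)
      fix n
      have "norm (?L n) \<le> norm (w / of_real (?N n))" using w by (intro norm_Ln_one_plus_le) simp
      then show "norm (?L n) \<le> norm w * (1 / ?N n)" by (simp add: norm_divide del: of_nat_Suc)
    qed
    show "(\<lambda>n. norm w * (1 / ?N n)) \<longlonglongrightarrow> 0"
      using tendsto_mult[OF tendsto_const inv, of "norm w"] by simp
  qed
  have "(\<lambda>n. of_real a * (of_real (?N n) * ?L n - w) + ?L n + of_real a * w) \<longlonglongrightarrow> of_real a * 0 + 0 + of_real a * w"
    by (intro tendsto_intros 1 2)
  then show ?thesis by (simp add: algebra_simps)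
qed

theorem thorin_process_Y: "thorin_process (completion M) Y"
proof -
  have "\<exists>\<mu>\<in>gamma_convolutions. \<forall>z. char \<mu> z =
     exp (- (of_real (a * real (Suc n) + 1) * Ln (1 + \<psi> z / of_real (real (Suc n))) + riemann_exponent n z))" for n
    unfolding riemann_exponent_def
  proof (rule gamma_convolution_sum)
    show "0 < a * real (Suc n) + 1" using a_nonneg by (intro add_nonneg_pos mult_nonneg_nonneg) auto
  qed auto
  then obtain \<mu> where \<mu>: "\<And>n. \<mu> n \<in> gamma_convolutions"
    and ch: "\<And>n z. char (\<mu> n) z = exp (- (of_real (a * real (Suc n) + 1) * Ln (1 + \<psi> z / of_real (real (Suc n))) + riemann_exponent n z))"
    by metis
  have "weak_conv_m \<mu> (distr (completion M) borel (Y 1))"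
  proof (rule levy_continuity)
    show "real_distribution (\<mu> n)" for n by (rule real_distribution_gamma_convolutions[OF \<mu>])
    show "real_distribution (distr (completion M) borel (Y 1))" by (rule real_distribution_distr_completion) simp
    fix z
    have "(\<lambda>n. char (\<mu> n) z) \<longlonglongrightarrow> exp (- (of_real a * \<psi> z + thorin_exponent \<rho> (\<psi> z)))"
      unfolding ch
      by (intro tendsto_exp tendsto_minus tendsto_add drift_exponent_tendsto riemann_exponent_tendsto Re_bm_exponent)
    then show "(\<lambda>n. char (\<mu> n) z) \<longlonglongrightarrow> char (distr (completion M) borel (Y 1)) z"
      unfolding char_Y_1 by (simp only: minus_add_distrib diff_conv_add_uminus)
  qed
  then show ?thesis unfolding thorin_process_def using levy_process_Y \<mu> by blast
qed

end

section \<open>Moments\<close>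

lemma AE_std_normal_iff:
  assumes [measurable]: "Measurable.pred borel P"
  shows "(AE x in std_normal_distribution. P x) \<longleftrightarrow> (AE x in lborel. P x)"
  by (subst AE_density) (auto simp: normal_density_pos)

text \<open>The normal density is positive everywhere, so a null set of the normal law is Lebesgue
  null and cannot contain an interval.\<close>

lemma nn_integral_std_normal_pos:
  fixes g :: "real \<Rightarrow> ennreal"
  assumes [measurable]: "g \<in> borel_measurable borel" and "c < d" and pos: "\<And>x. c < x \<Longrightarrow> x < d \<Longrightarrow> 0 < g x"
  shows "0 < (\<integral>\<^sup>+x. g x \<partial>std_normal_distribution)"
proof (rule ccontr)
  assume "\<not> 0 < (\<integral>\<^sup>+x. g x \<partial>std_normal_distribution)"
  then have "(\<integral>\<^sup>+x. g x \<partial>std_normal_distribution) = 0" by (simp add: zero_less_iff_neq_zero)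
  then have "AE x in std_normal_distribution. g x = 0"
    by (subst (asm) nn_integral_0_iff_AE) auto
  then have "AE x in lborel. g x = 0" by (subst (asm) AE_std_normal_iff) auto
  then have "AE x in lborel. x \<notin> {c<..<d}"
  proof eventually_elim
    case (elim x)
    then show ?case using pos[of x] by auto
  qed
  then have "emeasure lborel {c<..<d} = emeasure lborel ({} :: real set)" by (intro emeasure_eq_AE) auto
  then show False using \<open>c < d\<close> by (simp add: ennreal_eq_0_iff)
qed

definition absolute_moment :: "real \<Rightarrow> ennreal" where
  "absolute_moment p = (\<integral>\<^sup>+x. ennreal (\<bar>x\<bar> powr p) \<partial>std_normal_distribution)"

lemma absolute_moment_pos: "0 < absolute_moment p"
  unfolding absolute_moment_def by (rule nn_integral_std_normal_pos[of _ 0 1]) auto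

lemma absolute_moment_finite:
  assumes p: "0 \<le> p" shows "absolute_moment p < \<infinity>"
proof -
  define k where "k = nat \<lceil>p\<rceil>"
  have pk: "p \<le> real k" unfolding k_def by linarith
  have i: "integrable std_normal_distribution (\<lambda>x. 1 + \<bar>x\<bar> ^ k)"
  proof (rule Bochner_Integration.integrable_add)
    interpret real_distribution std_normal_distribution by (rule real_dist_normal_dist)
    show "integrable std_normal_distribution (\<lambda>x. 1 :: real)" by simp
    show "integrable std_normal_distribution (\<lambda>x. \<bar>x\<bar> ^ k)"
      using integrable_abs[OF integrable_std_normal_distribution_moment[of k]] by (simp add: power_abs)
  qed
  have "\<bar>x\<bar> powr p \<le> 1 + \<bar>x\<bar> ^ k" for x :: real
  proof (cases "1 \<le> \<bar>x\<bar>")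
    case True
    have "\<bar>x\<bar> powr p \<le> \<bar>x\<bar> powr (real k)" using True pk by (intro powr_mono) auto
    also have "\<dots> = \<bar>x\<bar> ^ k" using True by (intro powr_realpow) auto
    finally show ?thesis by simp
  next
    case False
    then have "\<bar>x\<bar> powr p \<le> 1" using p by (intro powr_le1) auto
    then show ?thesis using zero_le_power[of "\<bar>x\<bar>" k] by linarith
  qed
  then have "absolute_moment p \<le> (\<integral>\<^sup>+x. ennreal (1 + \<bar>x\<bar> ^ k) \<partial>std_normal_distribution)"
    unfolding absolute_moment_def by (intro nn_integral_mono ennreal_leI)
  also have "\<dots> = ennreal (\<integral>x. 1 + \<bar>x\<bar> ^ k \<partial>std_normal_distribution)"
    by (rule nn_integral_eq_integral[OF i]) simp
  also have "\<dots> < \<infinity>" by simp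
  finally show ?thesis .
qed

context brownian_subordination
begin

text \<open>Compared through characteristic functions: integrating out the normal coordinate gives
  exp(-\<psi>(z) T), the integrand already found for Y in \<open>char_Y_laplace\<close>.\<close>

lemma distr_Y_mixture:
  assumes t: "0 \<le> t"
  shows "distr (completion M) borel (Y t) =
    distr (M \<Otimes>\<^sub>M std_normal_distribution) borel (\<lambda>p. \<sigma> * sqrt (T t (fst p)) * snd p + \<theta> * T t (fst p))"
    (is "?L = distr ?P borel ?V")
proof -
  interpret N: real_distribution std_normal_distribution by (rule real_dist_normal_dist)
  interpret P: pair_prob_space M std_normal_distribution ..
  note [measurable] = T_measurable[OF t]
  have Vm: "?V \<in> borel_measurable ?P" by measurable
  have "real_distribution (distr ?P borel ?V)"
    by (intro real_distribution.intro P.prob_space_distr Vm) (auto simp: real_distribution_axioms_def)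
  then show ?thesis
  proof (rule Levy_uniqueness[rotated])
    show "real_distribution ?L" by (rule real_distribution_distr_completion) (use t in simp)
    show "char ?L = char (distr ?P borel ?V)"
    proof (rule ext)
      fix z
      let ?G = "\<lambda>\<omega> n. iexp (z * (\<sigma> * sqrt (T t \<omega>) * n + \<theta> * T t \<omega>))"
      have Gm: "(\<lambda>(\<omega>, n). ?G \<omega> n) \<in> borel_measurable ?P" by measurable
      have i: "integrable ?P (\<lambda>(\<omega>, n). ?G \<omega> n)"
        by (rule P.integrable_const_bound[where B=1]) (use Gm in auto)
      have "char (distr ?P borel ?V) z = (\<integral>p. iexp (z * ?V p) \<partial>?P)"
        unfolding char_def by (rule integral_distr[OF Vm]) auto
      also have "\<dots> = (\<integral>p. (case p of (\<omega>, n) \<Rightarrow> ?G \<omega> n) \<partial>?P)"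
        by (intro Bochner_Integration.integral_cong) (auto split: prod.split)
      also have "\<dots> = (\<integral>\<omega>. \<integral>n. ?G \<omega> n \<partial>std_normal_distribution \<partial>M)"
        by (rule P.integral_fst[OF i, symmetric])
      also have "\<dots> = (\<integral>\<omega>. exp (- (bm_exponent \<sigma> \<theta> z * of_real (T t \<omega>))) \<partial>M)"
      proof (rule integral_cong_AE)
        show "(\<lambda>\<omega>. \<integral>n. ?G \<omega> n \<partial>std_normal_distribution) \<in> borel_measurable M"
          by (rule N.borel_measurable_lebesgue_integral[OF Gm])
        show "AE \<omega> in M. (\<integral>n. ?G \<omega> n \<partial>std_normal_distribution) = exp (- (bm_exponent \<sigma> \<theta> z * of_real (T t \<omega>)))"
          using T_nonneg
        proof eventually_elim
          fix \<omega> assume "\<forall>t\<ge>0. 0 \<le> T t \<omega>"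
          then have u: "0 \<le> T t \<omega>" using t by simp
          let ?q = "z * \<sigma> * sqrt (T t \<omega>)"
          have "(\<integral>n. ?G \<omega> n \<partial>std_normal_distribution) = (\<integral>n. iexp (z * \<theta> * T t \<omega>) * iexp (?q * n) \<partial>std_normal_distribution)"
            by (intro Bochner_Integration.integral_cong) (auto simp: exp_add[symmetric] algebra_simps)
          also have "\<dots> = iexp (z * \<theta> * T t \<omega>) * char std_normal_distribution ?q"
            unfolding char_def by (rule integral_mult_right_zero)
          also have "\<dots> = iexp (z * \<theta> * T t \<omega>) * of_real (exp (- (?q\<^sup>2) / 2))"
            unfolding char_std_normal_distribution ..
          also have "\<dots> = exp (- (bm_exponent \<sigma> \<theta> z * of_real (T t \<omega>)))"
            using u by (simp add: bm_exponent_def power_mult_distrib exp_of_real[symmetric] exp_add[symmetric] algebra_simps)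
          finally show "(\<integral>n. ?G \<omega> n \<partial>std_normal_distribution) = exp (- (bm_exponent \<sigma> \<theta> z * of_real (T t \<omega>)))" .
        qed
      qed measurable
      finally show "char ?L z = char (distr ?P borel ?V) z" using char_Y_laplace[OF t, of z] by simp
    qed
  qed
qed

lemma moment_Y_eq:
  assumes t: "0 \<le> t"
  shows "(\<integral>\<^sup>+\<omega>. ennreal (\<bar>Y t \<omega>\<bar> powr p) \<partial>completion M) =
    (\<integral>\<^sup>+\<omega>. \<integral>\<^sup>+n. ennreal (\<bar>\<sigma> * sqrt (T t \<omega>) * n + \<theta> * T t \<omega>\<bar> powr p) \<partial>std_normal_distribution \<partial>M)"
proof -
  interpret N: real_distribution std_normal_distribution by (rule real_dist_normal_dist)
  note [measurable] = T_measurable[OF t]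
  have "(\<integral>\<^sup>+\<omega>. ennreal (\<bar>Y t \<omega>\<bar> powr p) \<partial>completion M) = (\<integral>\<^sup>+x. ennreal (\<bar>x\<bar> powr p) \<partial>distr (completion M) borel (Y t))"
    using t by (subst nn_integral_distr) auto
  also have "\<dots> = (\<integral>\<^sup>+q. ennreal (\<bar>\<sigma> * sqrt (T t (fst q)) * snd q + \<theta> * T t (fst q)\<bar> powr p) \<partial>(M \<Otimes>\<^sub>M std_normal_distribution))"
    unfolding distr_Y_mixture[OF t] by (subst nn_integral_distr) auto
  also have "\<dots> = (\<integral>\<^sup>+\<omega>. \<integral>\<^sup>+n. ennreal (\<bar>\<sigma> * sqrt (T t \<omega>) * n + \<theta> * T t \<omega>\<bar> powr p) \<partial>std_normal_distribution \<partial>M)"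
    by (subst N.nn_integral_fst[symmetric]) auto
  finally show ?thesis .
qed

lemma sqrt_powr: "0 \<le> u \<Longrightarrow> sqrt u powr p = u powr (p / 2)"
  by (simp add: powr_half_sqrt[symmetric] powr_powr)

text \<open>Brownian scaling. The value u = 0 needs no case of its own because \<open>powr\<close>
  sends base 0 to 0 for every exponent.\<close>

lemma conditional_moment_driftless:
  assumes u: "0 \<le> u"
  shows "(\<integral>\<^sup>+n. ennreal (\<bar>\<sigma> * sqrt u * n\<bar> powr p) \<partial>std_normal_distribution) = ennreal (\<sigma> powr p) * absolute_moment p * ennreal (u powr (p / 2))"
proof -
  have "ennreal (\<bar>\<sigma> * sqrt u * n\<bar> powr p) = ennreal (\<sigma> powr p * u powr (p / 2)) * ennreal (\<bar>n\<bar> powr p)" for n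
    using \<sigma> u by (simp add: abs_mult powr_mult sqrt_powr ennreal_mult[symmetric])
  then have "(\<integral>\<^sup>+n. ennreal (\<bar>\<sigma> * sqrt u * n\<bar> powr p) \<partial>std_normal_distribution) = ennreal (\<sigma> powr p * u powr (p / 2)) * absolute_moment p"
    unfolding absolute_moment_def by (simp add: nn_integral_cmult)
  then show ?thesis by (simp add: ennreal_mult mult_ac)
qed

lemma moment_driftless_iff:
  assumes t: "0 \<le> t" and \<theta>: "\<theta> = 0" and p: "0 \<le> p"
  shows "(\<integral>\<^sup>+\<omega>. ennreal (\<bar>Y t \<omega>\<bar> powr p) \<partial>completion M) < \<infinity> \<longleftrightarrow> (\<integral>\<^sup>+\<omega>. ennreal (T t \<omega> powr (p / 2)) \<partial>M) < \<infinity>"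
proof -
  note [measurable] = T_measurable[OF t]
  have "(\<integral>\<^sup>+\<omega>. ennreal (\<bar>Y t \<omega>\<bar> powr p) \<partial>completion M) = (\<integral>\<^sup>+\<omega>. ennreal (\<sigma> powr p) * absolute_moment p * ennreal (T t \<omega> powr (p / 2)) \<partial>M)"
    unfolding moment_Y_eq[OF t]
  proof (rule nn_integral_cong_AE)
    show "AE \<omega> in M. (\<integral>\<^sup>+n. ennreal (\<bar>\<sigma> * sqrt (T t \<omega>) * n + \<theta> * T t \<omega>\<bar> powr p) \<partial>std_normal_distribution) =
      ennreal (\<sigma> powr p) * absolute_moment p * ennreal (T t \<omega> powr (p / 2))"
      using T_nonneg
    proof eventually_elim
      case (elim \<omega>)
      then show ?case using conditional_moment_driftless[of "T t \<omega>" p] t \<theta> by simp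
    qed
  qed
  also have "\<dots> = ennreal (\<sigma> powr p) * absolute_moment p * (\<integral>\<^sup>+\<omega>. ennreal (T t \<omega> powr (p / 2)) \<partial>M)"
    by (rule nn_integral_cmult) measurable
  finally show ?thesis
    using \<sigma> absolute_moment_pos[of p] absolute_moment_finite[OF p] by (auto simp: ennreal_mult_less_top)
qed

text \<open>On the event that the normal variable has the sign of \<theta>, both terms have the same
  sign and the sum is at least |\<theta>| u in modulus. The constant q is |\<theta>|^p times the
  probability of that event.\<close>

lemma conditional_moment_ge:
  assumes \<theta>: "\<theta> \<noteq> 0" and p: "0 \<le> p"
  obtains q :: ennreal where "0 < q" "\<And>u. 0 \<le> u \<Longrightarrow>
    q * ennreal (u powr p) \<le> (\<integral>\<^sup>+n. ennreal (\<bar>\<sigma> * sqrt u * n + \<theta> * u\<bar> powr p) \<partial>std_normal_distribution)"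
proof
  let ?i = "\<lambda>n. indicator {n. 0 < \<theta> * n} n :: ennreal"
  define q where "q = (\<integral>\<^sup>+n. ennreal (\<bar>\<theta>\<bar> powr p) * ?i n \<partial>std_normal_distribution)"
  have [measurable]: "{n. 0 < \<theta> * n} \<in> sets borel" by measurable
  show "0 < q"
  proof (cases "0 < \<theta>")
    case True
    then show ?thesis unfolding q_def by (intro nn_integral_std_normal_pos[of _ 0 1]) (auto simp: indicator_def)
  next
    case False
    then show ?thesis unfolding q_def using \<theta>
      by (intro nn_integral_std_normal_pos[of _ "- 1" 0]) (auto simp: indicator_def zero_less_mult_iff)
  qed
  fix u :: real assume u: "0 \<le> u"
  have "q * ennreal (u powr p) = (\<integral>\<^sup>+n. ennreal (\<bar>\<theta>\<bar> powr p) * ?i n * ennreal (u powr p) \<partial>std_normal_distribution)"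
    unfolding q_def by (rule nn_integral_multc[symmetric]) measurable
  also have "\<dots> \<le> (\<integral>\<^sup>+n. ennreal (\<bar>\<sigma> * sqrt u * n + \<theta> * u\<bar> powr p) \<partial>std_normal_distribution)"
  proof (rule nn_integral_mono)
    fix n :: real
    show "ennreal (\<bar>\<theta>\<bar> powr p) * ?i n * ennreal (u powr p) \<le> ennreal (\<bar>\<sigma> * sqrt u * n + \<theta> * u\<bar> powr p)"
    proof (cases "0 < \<theta> * n")
      case True
      have s: "0 \<le> \<sigma> * sqrt u" using \<sigma> u by simp
      have "\<bar>\<theta>\<bar> * u \<le> \<bar>\<sigma> * sqrt u * n + \<theta> * u\<bar>"
      proof (cases "0 < \<theta>")
        case t: True
        then have "0 \<le> n" using True by (auto simp: zero_less_mult_iff)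
        then have "0 \<le> \<sigma> * sqrt u * n" by (rule mult_nonneg_nonneg[OF s])
        then show ?thesis using t by simp
      next
        case f: False
        then have "n < 0" using True by (auto simp: zero_less_mult_iff)
        then have "\<sigma> * sqrt u * n \<le> 0" using s by (intro mult_nonneg_nonpos) auto
        moreover have "\<theta> * u \<le> 0" using f u by (intro mult_nonpos_nonneg) auto
        ultimately show ?thesis using f by simp
      qed
      then have "(\<bar>\<theta>\<bar> * u) powr p \<le> \<bar>\<sigma> * sqrt u * n + \<theta> * u\<bar> powr p" using u p by (intro powr_mono2) auto
      then show ?thesis using True u by (simp add: powr_mult ennreal_mult[symmetric] ennreal_leI)
    qed simp
  qed
  finally show "q * ennreal (u powr p) \<le> (\<integral>\<^sup>+n. ennreal (\<bar>\<sigma> * sqrt u * n + \<theta> * u\<bar> powr p) \<partial>std_normal_distribution)" .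
qed

lemma conditional_moment_le:
  assumes u: "0 \<le> u" and p: "0 \<le> p"
  shows "(\<integral>\<^sup>+n. ennreal (\<bar>\<sigma> * sqrt u * n + \<theta> * u\<bar> powr p) \<partial>std_normal_distribution) \<le>
    ennreal (2 powr p) * (ennreal (\<sigma> powr p) * absolute_moment p * (1 + ennreal (u powr p)) + ennreal (\<bar>\<theta>\<bar> powr p) * ennreal (u powr p))"
proof -
  interpret N: real_distribution std_normal_distribution by (rule real_dist_normal_dist)
  have "(\<integral>\<^sup>+n. ennreal (\<bar>\<sigma> * sqrt u * n + \<theta> * u\<bar> powr p) \<partial>std_normal_distribution) \<le>
     (\<integral>\<^sup>+n. ennreal (2 powr p) * (ennreal (\<bar>\<sigma> * sqrt u * n\<bar> powr p) + ennreal (\<bar>\<theta>\<bar> powr p) * ennreal (u powr p)) \<partial>std_normal_distribution)"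
  proof (rule nn_integral_mono)
    fix n :: real
    let ?A = "\<bar>\<sigma> * sqrt u * n\<bar>" and ?B = "\<bar>\<theta> * u\<bar>"
    have "\<bar>\<sigma> * sqrt u * n + \<theta> * u\<bar> \<le> 2 * max ?A ?B" by linarith
    then have "\<bar>\<sigma> * sqrt u * n + \<theta> * u\<bar> powr p \<le> (2 * max ?A ?B) powr p" using p by (intro powr_mono2) auto
    also have "\<dots> = 2 powr p * (max ?A ?B) powr p" by (rule powr_mult)
    also have "\<dots> \<le> 2 powr p * (?A powr p + ?B powr p)"
      by (intro mult_left_mono) (auto simp: max_def)
    finally have "ennreal (\<bar>\<sigma> * sqrt u * n + \<theta> * u\<bar> powr p) \<le> ennreal (2 powr p * (?A powr p + ?B powr p))"
      by (rule ennreal_leI)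
    also have "\<dots> = ennreal (2 powr p) * (ennreal (?A powr p) + ennreal (?B powr p))"
      by (subst ennreal_mult) auto
    also have "ennreal (?B powr p) = ennreal (\<bar>\<theta>\<bar> powr p) * ennreal (u powr p)"
      using u by (simp add: abs_mult powr_mult ennreal_mult[symmetric])
    finally show "ennreal (\<bar>\<sigma> * sqrt u * n + \<theta> * u\<bar> powr p) \<le> ennreal (2 powr p) * (ennreal (?A powr p) + ennreal (\<bar>\<theta>\<bar> powr p) * ennreal (u powr p))" .
  qed
  also have "\<dots> = ennreal (2 powr p) * (ennreal (\<sigma> powr p) * absolute_moment p * ennreal (u powr (p / 2)) + ennreal (\<bar>\<theta>\<bar> powr p) * ennreal (u powr p))"
    using N.emeasure_space_1
    by (subst nn_integral_cmult, measurable) (simp add: nn_integral_add conditional_moment_driftless[OF u])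
  also have "\<dots> \<le> ennreal (2 powr p) * (ennreal (\<sigma> powr p) * absolute_moment p * (1 + ennreal (u powr p)) + ennreal (\<bar>\<theta>\<bar> powr p) * ennreal (u powr p))"
  proof (intro mult_left_mono add_right_mono)
    have "u powr (p / 2) \<le> 1 + u powr p"
    proof (cases "u \<le> 1")
      case True
      then have "u powr (p / 2) \<le> 1" using u p by (intro powr_le1) auto
      then show ?thesis using powr_ge_zero[of u p] by linarith
    next
      case False
      then have "u powr (p / 2) \<le> u powr p" using p by (intro powr_mono) auto
      then show ?thesis by simp
    qed
    then have "ennreal (u powr (p / 2)) \<le> ennreal (1 + u powr p)" by (rule ennreal_leI)
    then show "ennreal (u powr (p / 2)) \<le> 1 + ennreal (u powr p)" by simp
  qed auto
  finally show ?thesis .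
qed

lemma moment_drift_iff:
  assumes t: "0 \<le> t" and \<theta>: "\<theta> \<noteq> 0" and p: "0 \<le> p"
  shows "(\<integral>\<^sup>+\<omega>. ennreal (\<bar>Y t \<omega>\<bar> powr p) \<partial>completion M) < \<infinity> \<longleftrightarrow> (\<integral>\<^sup>+\<omega>. ennreal (T t \<omega> powr p) \<partial>M) < \<infinity>"
proof
  note [measurable] = T_measurable[OF t]
  have nn: "AE \<omega> in M. 0 \<le> T t \<omega>" using T_nonneg by eventually_elim (use t in simp)
  {
    assume F: "(\<integral>\<^sup>+\<omega>. ennreal (\<bar>Y t \<omega>\<bar> powr p) \<partial>completion M) < \<infinity>"
    obtain q :: ennreal where q: "0 < q" and ge: "\<And>u. 0 \<le> u \<Longrightarrow>
      q * ennreal (u powr p) \<le> (\<integral>\<^sup>+n. ennreal (\<bar>\<sigma> * sqrt u * n + \<theta> * u\<bar> powr p) \<partial>std_normal_distribution)"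
      using conditional_moment_ge[OF \<theta> p] by blast
    have "q * (\<integral>\<^sup>+\<omega>. ennreal (T t \<omega> powr p) \<partial>M) = (\<integral>\<^sup>+\<omega>. q * ennreal (T t \<omega> powr p) \<partial>M)"
      by (rule nn_integral_cmult[symmetric]) measurable
    also have "\<dots> \<le> (\<integral>\<^sup>+\<omega>. ennreal (\<bar>Y t \<omega>\<bar> powr p) \<partial>completion M)"
      unfolding moment_Y_eq[OF t]
      by (rule nn_integral_mono_AE) (use nn in eventually_elim, rule ge)
    also note F
    finally show "(\<integral>\<^sup>+\<omega>. ennreal (T t \<omega> powr p) \<partial>M) < \<infinity>"
      using q by (auto simp: ennreal_mult_less_top)
  next
    assume F: "(\<integral>\<^sup>+\<omega>. ennreal (T t \<omega> powr p) \<partial>M) < \<infinity>"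
    let ?A = "ennreal (\<sigma> powr p) * absolute_moment p"
    have "(\<integral>\<^sup>+\<omega>. ennreal (\<bar>Y t \<omega>\<bar> powr p) \<partial>completion M) \<le>
      (\<integral>\<^sup>+\<omega>. ennreal (2 powr p) * (?A * (1 + ennreal (T t \<omega> powr p)) + ennreal (\<bar>\<theta>\<bar> powr p) * ennreal (T t \<omega> powr p)) \<partial>M)"
      unfolding moment_Y_eq[OF t]
      by (rule nn_integral_mono_AE) (use nn in eventually_elim, rule conditional_moment_le[OF _ p])
    also have "\<dots> = ennreal (2 powr p) * (?A * (1 + (\<integral>\<^sup>+\<omega>. ennreal (T t \<omega> powr p) \<partial>M)) + ennreal (\<bar>\<theta>\<bar> powr p) * (\<integral>\<^sup>+\<omega>. ennreal (T t \<omega> powr p) \<partial>M))"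
      by (simp add: nn_integral_cmult nn_integral_add emeasure_space_1)
    also have "\<dots> < \<infinity>"
      using F absolute_moment_finite[OF p] by (simp add: ennreal_mult_less_top)
    finally show "(\<integral>\<^sup>+\<omega>. ennreal (\<bar>Y t \<omega>\<bar> powr p) \<partial>completion M) < \<infinity>" .
  }
qed

end

section \<open>Brownian motion subordinated by a Thorin process\<close>

theorem theorem5:
  fixes M :: "'a measure" and W X T Y :: "real \<Rightarrow> 'a \<Rightarrow> real"
    and \<sigma> \<theta> a b :: real and \<rho> \<tau>p \<tau>m :: "real measure" and f :: "real \<Rightarrow> real"
  assumes "standard_brownian_motion M W"
    and "0 < \<sigma>"
    and X: "X = (\<lambda>t \<omega>. \<sigma> * W t \<omega> + \<theta> * t)"
    and "thorin_subordinator M T a \<rho>"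
    and "independent_processes M X T"
    and Y: "Y = (\<lambda>t \<omega>. X (T t \<omega>) \<omega>)"
    and f: "f = (\<lambda>x. sqrt (\<theta>\<^sup>2 + 2 * \<sigma>\<^sup>2 * x) / \<sigma>\<^sup>2)"
    and b: "b = \<theta> * a + \<theta> * (LINT t:{\<sigma>\<^sup>2 / 2 + \<bar>\<theta>\<bar>..}|\<rho>. 1 / t)
              - sgn \<theta> * (LINT t:{\<sigma>\<^sup>2 / 2 - \<bar>\<theta>\<bar>..<\<sigma>\<^sup>2 / 2 + \<bar>\<theta>\<bar>}|\<rho>. 1 / (f t + \<bar>\<theta>\<bar> / \<sigma>\<^sup>2))"
    and \<tau>p: "\<tau>p = left_translation (distr \<rho> borel f) (\<theta> / \<sigma>\<^sup>2)"
    and \<tau>m: "\<tau>m = left_translation (distr \<rho> borel f) (- \<theta> / \<sigma>\<^sup>2)"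
  shows "thorin_process (completion M) Y \<and>
    has_thorin_triplet (completion M) Y b (a * \<sigma>\<^sup>2) \<tau>p \<tau>m \<and>
    (a = 0 \<longrightarrow>
      (\<forall>p\<in>{0..2}. beta_index M T \<le> p / 2 \<longleftrightarrow> beta_index (completion M) Y \<le> p)) \<and>
    (\<forall>p\<ge>0. \<forall>t>0.
      (\<integral>\<^sup>+\<omega>. ennreal (\<bar>Y t \<omega>\<bar> powr p) \<partial>completion M) < \<infinity> \<longleftrightarrow>
      (\<integral>\<^sup>+\<omega>. ennreal (T t \<omega> powr (p - p / 2 * of_bool (\<theta> = 0))) \<partial>M) < \<infinity>)"
proof -
  interpret B: brownian_subordination M W T \<sigma> \<theta> a \<rho>
    using assms by (simp add: brownian_subordination_def)
  have YB: "B.Y = Y"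
    by (simp add: fun_eq_iff B.Y_def X Y)
  \<comment> \<open>Translation and quotient combine into a single fraction; c = \<theta> and c =
    -\<theta> are then the two roots.\<close>
  have tr: "left_translation (distr \<rho> borel f) (c / \<sigma>\<^sup>2) = distr \<rho> borel (\<lambda>x. (sqrt (\<theta>\<^sup>2 + 2 * \<sigma>\<^sup>2 * x) - c) / \<sigma>\<^sup>2)" for c
    unfolding left_translation_def f using thorin_sets[OF B.thorin_\<rho>]
    by (subst distr_distr) (auto simp: comp_def diff_divide_distrib cong: measurable_cong_sets)
  have p: "\<tau>p = distr \<rho> borel (thorin_root \<sigma> \<theta>)" and m: "\<tau>m = distr \<rho> borel (thorin_root \<sigma> (- \<theta>))"
    unfolding \<tau>p \<tau>m tr thorin_root_def[abs_def] by simp_all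
  have "has_thorin_triplet (completion M) Y b (a * \<sigma>\<^sup>2) \<tau>p \<tau>m"
    using B.has_thorin_triplet_Y[OF b[unfolded f]] unfolding YB p m .
  moreover have "(\<integral>\<^sup>+\<omega>. ennreal (\<bar>Y t \<omega>\<bar> powr p) \<partial>completion M) < \<infinity> \<longleftrightarrow>
      (\<integral>\<^sup>+\<omega>. ennreal (T t \<omega> powr (p - p / 2 * of_bool (\<theta> = 0))) \<partial>M) < \<infinity>" if "0 \<le> p" "0 < t" for p t
    using B.moment_driftless_iff[of t p, unfolded YB] B.moment_drift_iff[of t p, unfolded YB] that
    by (cases "\<theta> = 0") simp_all
  ultimately show ?thesis
    using B.thorin_process_Y B.beta_index_T_Y unfolding YB by blast
qed

end
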